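(* For $z_{ij}=u^i_1S(u^1_j)\in\mathbf{C}_q[\mathbf{C}P^{N-1}]$, the holomorphic and anti-holomorphic derivatives act as $$\partial z_{ij}=q^{\frac2N-1}\sum_{k=2}^Nu^i_kS(u^1_j)\,e^+_{k-1},\qquad \overline{\partial}z_{ij}=-q^{3+\frac2N}\sum_{k=2}^Nq^{-2k}u^i_1S(u^k_j)\,e^-_{k-1}.$$ Moreover, for all $1\le i,j,r,s\le N$, $$(\partial z_{ij})z_{rs}=\sum_{a,b,c,d,e,f=1}^Nq^{\lambda}\,R^{ja}_{rb}\,\overline{R}^{ai}_{cd}\,R^{ec}_{fs}\;z_{de}\,\partial z_{fb},$$ $$(\overline{\partial}z_{ij})z_{rs}=\sum_{a,b,c,d,e,f=1}^Nq^{\overline{\lambda}}\,R^{ra}_{jb}\,R^{sa}_{cd}\,\overline{R}^{ie}_{df}\;z_{be}\,\overline{\partial}z_{fc},$$ where $\lambda=2(b-j)+\mathrm{sgn}(b-s)-1$ and $\overline{\lambda}=2(b-r)+\mathrm{sgn}(b-i)+1$, with $\mathrm{sgn}$ the sign function ($\mathrm{sgn}(0)=0$).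
   Context: Algebras are unital over $\mathbf{C}$; Sweedler notation is used. Fix $N\ge 2$, $q\in(0,1]$, $\nu=q-q^{-1}$, and an $N$-th root $q^{1/N}$ of $q$. Let $H(x)=1$ for $x>0$ and $H(x)=0$ for $x\le 0$, $R^{ik}_{jl}=q^{\delta_{ik}}\delta_{il}\delta_{kj}+\nu H(k-i)\delta_{ij}\delta_{kl}$, $\overline{R}^{ik}_{jl}=q^{-\delta_{ik}}\delta_{il}\delta_{kj}-\nu H(k-i)\delta_{ij}\delta_{kl}$. Quantum groups. For $n\ge1$, $\mathbf{C}_q[M_n]$ is the bialgebra generated by $u^i_j$ ($1\le i,j\le n$) with relations $\sum_{w,x}R^{ac}_{wx}u^w_bu^x_d=\sum_{y,z}R^{yz}_{bd}u^a_yu^c_z$, $\Delta(u^i_j)=\sum_k u^i_k\otimes u^k_j$, $\varepsilon(u^i_j)=\delta_{ij}$. The element $\det_n=\sum_{\pi\in S_n}(-q)^{\ell(\pi)}u^1_{\pi(1)}\cdots u^n_{\pi(n)}$ is central and grouplike. $\mathbf{C}_q[U_n]$ is the Hopf algebra obtained by adjoining $\det_n^{-1}$, and $\mathbf{C}_q[SU_n]=\mathbf{C}_q[M_n]/\langle\det_n-1\rangle$. Put $G=\mathbf{C}_q[SU_N]$, $G^+=\ker\varepsilon$. $\alpha_N:G\to\mathbf{C}_q[U_{N-1}]$ is the Hopf algebra map with $\alpha_N(u^1_1)=\det_{N-1}^{-1}$, $\alpha_N(u^1_i)=\alpha_N(u^i_1)=0$ ($i\ne1$), $\alpha_N(u^i_j)=u^{i-1}_{j-1}$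 ($i,j\ge2$), and $M=\mathbf{C}_q[\mathbf{C}P^{N-1}]$ is the algebra of coinvariants of $(\mathrm{id}\otimes\alpha_N)\Delta$ on $G$. Calculus. $G$ is coquasi-triangular with $r$ determined by $r(u^i_j\otimes u^k_l)=q^{-1/N}R^{ki}_{jl}$, $r(fg\otimes h)=r(f\otimes h_{(1)})r(g\otimes h_{(2)})$, $r(f\otimes gh)=r(f_{(1)}\otimes h)r(f_{(2)}\otimes g)$. Define $Q:G\to M_N(\mathbf{C})$ by $Q_{kl}(h)=\mathcal{Q}(h\otimes u^k_l)$, $\mathcal{Q}(h\otimes g)=r(g_{(1)}\otimes h_{(1)})r(h_{(2)}\otimes g_{(2)})$. Let $I_{SU_N}=(\ker Q\cap G^+)+\mathrm{span}\{u^i_1S(u^1_i):2\le i\le N\}+\mathrm{span}\{u^i_j:2\le i,j\le N,\ i\ne j\}$, a right ideal of $G^+$, and $\Lambda^1_{SU_N}=G^+/I_{SU_N}$ with classes $\overline{v}$. The calculus $\Omega^1_q(SU_N)$ is $G\otimes\Lambda^1_{SU_N}$ with left multiplication on the first factor, $(g\otimes\overline{v})h=gh_{(1)}\otimes\overline{vh_{(2)}}$, $\mathrm{d}h=h_{(1)}\otimes\overline{h_{(2)}-\varepsilon(h_{(2)})1}$. Write $e^+_i=1\otimes\overline{u^{i+1}_1}$, $e^-_i=1\otimes\overline{u^1_{i+1}}$ for $1\le i\le N-1$, and let $V_\pm$ be the spans of the corresponding elements $\overline{u^{i}_1}$, resp. $\overline{u^1_i}$ ($2\le i\le N$), of $\Lambda^1_{SU_N}$.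 The restriction to $M$ is $\Omega^1_q(\mathbf{C}P^{N-1})=\mathrm{span}\{f\,\mathrm{d}g:f,g\in M\}\subseteq G\otimes(V_+\oplus V_-)$. It is the direct sum of the holomorphic calculus $\Omega^{(1,0)}_q=\Omega^1_q(\mathbf{C}P^{N-1})\cap(G\otimes V_+)$ and the anti-holomorphic calculus $\Omega^{(0,1)}_q=\Omega^1_q(\mathbf{C}P^{N-1})\cap(G\otimes V_-)$, and $\partial,\overline{\partial}:M\to\Omega^1_q(\mathbf{C}P^{N-1})$ are $\mathrm{d}$ followed by the projections onto these summands. *)

theory Defs
  imports Complex_Main "HOL-Library.Poly_Mapping" "HOL-Library.Product_Plus"
    "HOL-Combinatorics.Permutations"
begin

section \<open>Free algebras, their tensor products, and quotients\<close>

text \<open>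
  The quantum groups are presented as free algebras modulo two-sided ideals. The ideals depend on
  \<open>N\<close> and \<open>q\<close>, so the quotients are not types: elements of a quotient \<open>V / U\<close> are handled through
  representatives in \<open>V\<close>, equality in \<open>V / U\<close> is congruence modulo \<open>U\<close>, and a subspace of \<open>V / U\<close>
  is given by its preimage in \<open>V\<close>.
\<close>

datatype 'x word = Word (letters: "'x list")

instantiation word :: (type) monoid_add
begin

definition "0 = Word []"

definition "v + w = Word (letters v @ letters w)"

instance
  by standard (simp_all add: zero_word_def plus_word_def)

end

text \<open>
  The convolution product of \<open>poly_mapping\<close> is concatenation on words and, via the product monoid,
  \<open>(a \<otimes> b) (c \<otimes> d) = a c \<otimes> b d\<close> on pairs of words.
\<close>

type_synonym 'x falg = "'x word \<Rightarrow>\<^sub>0 complex"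

type_synonym ('x, 'y) tensor = "('x word \<times> 'y word) \<Rightarrow>\<^sub>0 complex"

definition scal :: "complex \<Rightarrow> ('k \<Rightarrow>\<^sub>0 complex) \<Rightarrow> ('k \<Rightarrow>\<^sub>0 complex)"
  where "scal c f = Poly_Mapping.map ((*) c) f"

lemma lookup_scal [simp]: "Poly_Mapping.lookup (scal c f) k = c * Poly_Mapping.lookup f k"
  by (simp add: scal_def Poly_Mapping.map.rep_eq when_def)

global_interpretation cvec: vector_space "scal :: complex \<Rightarrow> ('k \<Rightarrow>\<^sub>0 complex) \<Rightarrow> _"
  by unfold_locales (auto intro!: poly_mapping_eqI simp: lookup_add algebra_simps)

definition eq_mod :: "('k \<Rightarrow>\<^sub>0 complex) set \<Rightarrow> ('k \<Rightarrow>\<^sub>0 complex) \<Rightarrow> ('k \<Rightarrow>\<^sub>0 complex) \<Rightarrow> bool"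
  where "eq_mod U x y \<longleftrightarrow> x - y \<in> U"

definition gen :: "'x \<Rightarrow> 'x falg"
  where "gen x = Poly_Mapping.single (Word [x]) 1"

definition free_on :: "'x set \<Rightarrow> 'x falg set"
  where "free_on X = {f. \<forall>w \<in> Poly_Mapping.keys f. set (letters w) \<subseteq> X}"

definition ideal_on :: "'x set \<Rightarrow> 'x falg set \<Rightarrow> 'x falg set"
  where "ideal_on X A = cvec.span {f * a * g | f a g. f \<in> free_on X \<and> a \<in> A \<and> g \<in> free_on X}"

text \<open>The algebra map given on generators by \<open>\<phi>\<close>; \<open>\<iota>\<close> is the unit map of the target algebra.\<close>

definition alg_ext :: "(complex \<Rightarrow> 'b) \<Rightarrow> ('x \<Rightarrow> 'b) \<Rightarrow> 'x falg \<Rightarrow> 'b::ring_1"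
  where "alg_ext \<iota> \<phi> f =
    (\<Sum>w \<in> Poly_Mapping.keys f. \<iota> (Poly_Mapping.lookup f w) * prod_list (map \<phi> (letters w)))"

definition tens :: "'x falg \<Rightarrow> 'y falg \<Rightarrow> ('x, 'y) tensor"
  where "tens f g = (\<Sum>v \<in> Poly_Mapping.keys f. \<Sum>w \<in> Poly_Mapping.keys g.
    Poly_Mapping.single (v, w) (Poly_Mapping.lookup f v * Poly_Mapping.lookup g w))"

text \<open>
  The linear map on the tensor product induced by a bilinear \<open>\<beta>\<close>, so that
  \<open>contract sc \<beta> (\<Delta> h)\<close> is \<open>\<beta> (h\<^sub>1, h\<^sub>2)\<close> in Sweedler notation; \<open>sc\<close> is the scalar
  multiplication of the target.
\<close>

definition contract ::
    "(complex \<Rightarrow> 'v \<Rightarrow> 'v) \<Rightarrow> ('x falg \<Rightarrow> 'y falg \<Rightarrow> 'v) \<Rightarrow> ('x, 'y) tensor \<Rightarrow> 'v::comm_monoid_add"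
  where "contract sc \<beta> t = (\<Sum>(v, w) \<in> Poly_Mapping.keys t.
    sc (Poly_Mapping.lookup t (v, w)) (\<beta> (Poly_Mapping.single v 1) (Poly_Mapping.single w 1)))"

text \<open>The kernel of \<open>X \<otimes> Y \<rightarrow> X/X\<^sub>0 \<otimes> Y/Y\<^sub>0\<close>.\<close>

definition tens_ker ::
    "'x falg set \<Rightarrow> 'x falg set \<Rightarrow> 'y falg set \<Rightarrow> 'y falg set \<Rightarrow> ('x, 'y) tensor set"
  where "tens_ker X X\<^sub>0 Y Y\<^sub>0 =
    cvec.span ({tens f g | f g. f \<in> X\<^sub>0 \<and> g \<in> Y} \<union> {tens f g | f g. f \<in> X \<and> g \<in> Y\<^sub>0})"


section \<open>Quantum groups\<close>

type_synonym mat_alg = "(nat \<times> nat) falg"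

text \<open>\<open>Rm q (i, k) (j, l)\<close> is $R^{ik}_{jl}$ (upper indices first), and \<open>Rb\<close> is $\overline{R}$.\<close>

definition Rm :: "real \<Rightarrow> nat \<times> nat \<Rightarrow> nat \<times> nat \<Rightarrow> real"
  where "Rm q = (\<lambda>(i, k) (j, l).
    q powi of_bool (i = k) * of_bool (i = l) * of_bool (k = j)
      + (q - inverse q) * of_bool (i < k) * of_bool (i = j) * of_bool (k = l))"

definition Rb :: "real \<Rightarrow> nat \<times> nat \<Rightarrow> nat \<times> nat \<Rightarrow> real"
  where "Rb q = (\<lambda>(i, k) (j, l).
    q powi (- of_bool (i = k)) * of_bool (i = l) * of_bool (k = j)
      - (q - inverse q) * of_bool (i < k) * of_bool (i = j) * of_bool (k = l))"

definition idx :: "nat \<Rightarrow> (nat \<times> nat) set"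
  where "idx n = {1..n} \<times> {1..n}"

definition u :: "nat \<Rightarrow> nat \<Rightarrow> mat_alg"
  where "u i j = gen (i, j)"

text \<open>The defining relations of \<open>\<complex>\<^sub>q[M\<^sub>n]\<close> and its determinant, for generators \<open>U i j\<close>.\<close>

definition rtt_rels :: "nat \<Rightarrow> real \<Rightarrow> (nat \<Rightarrow> nat \<Rightarrow> 'x falg) \<Rightarrow> 'x falg set"
  where "rtt_rels n q U =
    {(\<Sum>w = 1..n. \<Sum>x = 1..n. scal (of_real (Rm q (a, c) (w, x))) (U w b * U x d))
      - (\<Sum>y = 1..n. \<Sum>z = 1..n. scal (of_real (Rm q (y, z) (b, d))) (U a y * U c z))
     | a b c d. a \<in> {1..n} \<and> b \<in> {1..n} \<and> c \<in> {1..n} \<and> d \<in> {1..n}}"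

definition perm_length :: "nat \<Rightarrow> (nat \<Rightarrow> nat) \<Rightarrow> nat"
  where "perm_length n \<pi> = card {(i, j). 1 \<le> i \<and> i < j \<and> j \<le> n \<and> \<pi> j < \<pi> i}"

definition qdet :: "nat \<Rightarrow> real \<Rightarrow> (nat \<Rightarrow> nat \<Rightarrow> 'x falg) \<Rightarrow> 'x falg"
  where "qdet n q U = (\<Sum>\<pi> | \<pi> permutes {1..n}.
    scal ((- of_real q) ^ perm_length n \<pi>) (prod_list (map (\<lambda>i. U i (\<pi> i)) [1..<Suc n])))"

text \<open>\<open>G = \<complex>\<^sub>q[SU\<^sub>N]\<close> is \<open>matA N\<close> modulo \<open>SU_ideal N q\<close>.\<close>

definition matA :: "nat \<Rightarrow> mat_alg set"
  where "matA n = free_on (idx n)"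

definition SU_ideal :: "nat \<Rightarrow> real \<Rightarrow> mat_alg set"
  where "SU_ideal N q = ideal_on (idx N) (rtt_rels N q u \<union> {qdet N q u - 1})"

definition Delta :: "nat \<Rightarrow> mat_alg \<Rightarrow> (nat \<times> nat, nat \<times> nat) tensor"
  where "Delta n = alg_ext (Poly_Mapping.single 0) (\<lambda>(i, j). \<Sum>k = 1..n. tens (u i k) (u k j))"

definition counit :: "mat_alg \<Rightarrow> complex"
  where "counit = alg_ext id (\<lambda>(i, j). of_bool (i = j))"

definition matA_plus :: "nat \<Rightarrow> mat_alg set"
  where "matA_plus n = {f \<in> matA n. counit f = 0}"

text \<open>
  \<open>S\<close> represents the antipode of \<open>G\<close>. Linearity on all of \<open>mat_alg\<close> is no restriction, since
  linear maps extend from the subspace \<open>matA N\<close>.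
\<close>

definition SU_antipode :: "nat \<Rightarrow> real \<Rightarrow> (mat_alg \<Rightarrow> mat_alg) \<Rightarrow> bool"
  where "SU_antipode N q S \<longleftrightarrow>
    Vector_Spaces.linear scal scal S \<and>
    S ` matA N \<subseteq> matA N \<and> S ` SU_ideal N q \<subseteq> SU_ideal N q \<and>
    (\<forall>h \<in> matA N.
      eq_mod (SU_ideal N q) (contract scal (\<lambda>h\<^sub>1 h\<^sub>2. S h\<^sub>1 * h\<^sub>2) (Delta N h)) (scal (counit h) 1) \<and>
      eq_mod (SU_ideal N q) (contract scal (\<lambda>h\<^sub>1 h\<^sub>2. h\<^sub>1 * S h\<^sub>2) (Delta N h)) (scal (counit h) 1))"

text \<open>\<open>\<complex>\<^sub>q[U\<^sub>n]\<close>: generator \<open>Some (i, j)\<close> is $u^i_j$, and \<open>None\<close> is the inverse determinant.\<close>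

type_synonym u_alg = "(nat \<times> nat) option falg"

definition U_gens :: "nat \<Rightarrow> (nat \<times> nat) option set"
  where "U_gens n = insert None (Some ` idx n)"

definition uU :: "nat \<Rightarrow> nat \<Rightarrow> u_alg"
  where "uU i j = gen (Some (i, j))"

definition U_ideal :: "nat \<Rightarrow> real \<Rightarrow> u_alg set"
  where "U_ideal n q = ideal_on (U_gens n)
    (rtt_rels n q uU \<union> {qdet n q uU * gen None - 1, gen None * qdet n q uU - 1})"

definition alpha :: "mat_alg \<Rightarrow> u_alg"
  where "alpha = alg_ext (Poly_Mapping.single 0) (\<lambda>(i, j).
    if i = 1 \<and> j = 1 then gen None else if i = 1 \<or> j = 1 then 0 else uU (i - 1) (j - 1))"

text \<open>The coinvariants \<open>M = \<complex>\<^sub>q[\<complex>P\<^bsup>N-1\<^esup>]\<close>.\<close>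

definition CP :: "nat \<Rightarrow> real \<Rightarrow> mat_alg set"
  where "CP N q = {f \<in> matA N.
    eq_mod (tens_ker (matA N) (SU_ideal N q) (free_on (U_gens (N - 1))) (U_ideal (N - 1) q))
      (contract scal (\<lambda>f\<^sub>1 f\<^sub>2. tens f\<^sub>1 (alpha f\<^sub>2)) (Delta N f)) (tens f 1)}"

definition zz :: "(mat_alg \<Rightarrow> mat_alg) \<Rightarrow> nat \<Rightarrow> nat \<Rightarrow> mat_alg"
  where "zz S i j = u i 1 * S (u 1 j)"


section \<open>The differential calculus\<close>

text \<open>The coquasi-triangular structure of \<open>G\<close>; \<open>p\<close> is the chosen \<open>N\<close>-th root of \<open>q\<close>.\<close>

definition SU_coquasi :: "nat \<Rightarrow> real \<Rightarrow> complex \<Rightarrow> (mat_alg \<Rightarrow> mat_alg \<Rightarrow> complex) \<Rightarrow> bool"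
  where "SU_coquasi N q p r \<longleftrightarrow>
    (\<forall>f. Vector_Spaces.linear scal (*) (\<lambda>h. r f h)) \<and>
    (\<forall>h. Vector_Spaces.linear scal (*) (\<lambda>f. r f h)) \<and>
    (\<forall>f \<in> SU_ideal N q. \<forall>h \<in> matA N. r f h = 0 \<and> r h f = 0) \<and>
    (\<forall>i \<in> {1..N}. \<forall>j \<in> {1..N}. \<forall>k \<in> {1..N}. \<forall>l \<in> {1..N}.
      r (u i j) (u k l) = inverse p * of_real (Rm q (k, i) (j, l))) \<and>
    (\<forall>h \<in> matA N. r 1 h = counit h \<and> r h 1 = counit h) \<and>
    (\<forall>f \<in> matA N. \<forall>g \<in> matA N. \<forall>h \<in> matA N.
      r (f * g) h = contract (*) (\<lambda>h\<^sub>1 h\<^sub>2. r f h\<^sub>1 * r g h\<^sub>2) (Delta N h) \<and>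
      r f (g * h) = contract (*) (\<lambda>f\<^sub>1 f\<^sub>2. r f\<^sub>1 h * r f\<^sub>2 g) (Delta N f))"

definition Qform :: "nat \<Rightarrow> (mat_alg \<Rightarrow> mat_alg \<Rightarrow> complex) \<Rightarrow> mat_alg \<Rightarrow> mat_alg \<Rightarrow> complex"
  where "Qform N r h g =
    contract (*) (\<lambda>h\<^sub>1 h\<^sub>2. contract (*) (\<lambda>g\<^sub>1 g\<^sub>2. r g\<^sub>1 h\<^sub>1 * r h\<^sub>2 g\<^sub>2) (Delta N g)) (Delta N h)"

definition kerQ :: "nat \<Rightarrow> (mat_alg \<Rightarrow> mat_alg \<Rightarrow> complex) \<Rightarrow> mat_alg set"
  where "kerQ N r = {h \<in> matA N. \<forall>k \<in> {1..N}. \<forall>l \<in> {1..N}. Qform N r h (u k l) = 0}"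

text \<open>The preimage in \<open>matA_plus N\<close> of the right ideal $I_{SU_N}$.\<close>

definition I_SU :: "nat \<Rightarrow> real \<Rightarrow> (mat_alg \<Rightarrow> mat_alg) \<Rightarrow> (mat_alg \<Rightarrow> mat_alg \<Rightarrow> complex)
    \<Rightarrow> mat_alg set"
  where "I_SU N q S r = cvec.span
    (SU_ideal N q \<union> (kerQ N r \<inter> matA_plus N)
      \<union> {u i 1 * S (u 1 i) | i. i \<in> {2..N}}
      \<union> {u i j | i j. i \<in> {2..N} \<and> j \<in> {2..N} \<and> i \<noteq> j})"

text \<open>
  Forms \<open>g \<otimes> v\<close> with \<open>g\<close> in \<open>matA N\<close> and \<open>v\<close> in \<open>matA_plus N\<close>; \<open>forms_zero\<close> is the subspace
  of those that vanish in \<open>G \<otimes> G\<^sup>+/I\<close>, where \<open>I\<close> is $I_{SU_N}$.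
\<close>

type_synonym form = "(nat \<times> nat, nat \<times> nat) tensor"

definition forms_zero :: "nat \<Rightarrow> real \<Rightarrow> (mat_alg \<Rightarrow> mat_alg) \<Rightarrow> (mat_alg \<Rightarrow> mat_alg \<Rightarrow> complex)
    \<Rightarrow> form set"
  where "forms_zero N q S r = tens_ker (matA N) (SU_ideal N q) (matA_plus N) (I_SU N q S r)"

definition lact :: "mat_alg \<Rightarrow> form \<Rightarrow> form"
  where "lact f \<omega> = tens f 1 * \<omega>"

text \<open>\<open>(g \<otimes> v) h = g h\<^sub>1 \<otimes> v h\<^sub>2\<close> is multiplication by \<open>\<Delta> h\<close> in the tensor product algebra.\<close>

definition ract :: "nat \<Rightarrow> form \<Rightarrow> mat_alg \<Rightarrow> form"
  where "ract N \<omega> h = \<omega> * Delta N h"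

definition dd :: "nat \<Rightarrow> mat_alg \<Rightarrow> form"
  where "dd N h = contract scal (\<lambda>h\<^sub>1 h\<^sub>2. tens h\<^sub>1 (h\<^sub>2 - scal (counit h\<^sub>2) 1)) (Delta N h)"

definition e_plus :: "nat \<Rightarrow> form"
  where "e_plus i = tens 1 (u (i + 1) 1)"

definition e_minus :: "nat \<Rightarrow> form"
  where "e_minus i = tens 1 (u 1 (i + 1))"

definition Omega_CP :: "nat \<Rightarrow> real \<Rightarrow> (mat_alg \<Rightarrow> mat_alg) \<Rightarrow> (mat_alg \<Rightarrow> mat_alg \<Rightarrow> complex)
    \<Rightarrow> form set"
  where "Omega_CP N q S r = cvec.span
    ({lact f (dd N g) | f g. f \<in> CP N q \<and> g \<in> CP N q} \<union> forms_zero N q S r)"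

text \<open>The holomorphic and anti-holomorphic calculi, as intersections with \<open>G \<otimes> V\<^sub>\<plusminus>\<close>.\<close>

definition Omega10 :: "nat \<Rightarrow> real \<Rightarrow> (mat_alg \<Rightarrow> mat_alg) \<Rightarrow> (mat_alg \<Rightarrow> mat_alg \<Rightarrow> complex)
    \<Rightarrow> form set"
  where "Omega10 N q S r = Omega_CP N q S r \<inter>
    cvec.span ({tens g (u i 1) | g i. g \<in> matA N \<and> i \<in> {2..N}} \<union> forms_zero N q S r)"

definition Omega01 :: "nat \<Rightarrow> real \<Rightarrow> (mat_alg \<Rightarrow> mat_alg) \<Rightarrow> (mat_alg \<Rightarrow> mat_alg \<Rightarrow> complex)
    \<Rightarrow> form set"
  where "Omega01 N q S r = Omega_CP N q S r \<inter>
    cvec.span ({tens g (u 1 i) | g i. g \<in> matA N \<and> i \<in> {2..N}} \<union> forms_zero N q S r)"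

text \<open>
  \<open>d\<close> followed by the projections of \<open>Omega_CP\<close> onto its two summands. Each value is some
  representative of the component; the component itself is unique modulo \<open>forms_zero\<close> because the
  sum is direct.
\<close>

definition del :: "nat \<Rightarrow> real \<Rightarrow> (mat_alg \<Rightarrow> mat_alg) \<Rightarrow> (mat_alg \<Rightarrow> mat_alg \<Rightarrow> complex)
    \<Rightarrow> mat_alg \<Rightarrow> form"
  where "del N q S r f = (SOME \<omega>. \<omega> \<in> Omega10 N q S r \<and> dd N f - \<omega> \<in> Omega01 N q S r)"

definition delbar :: "nat \<Rightarrow> real \<Rightarrow> (mat_alg \<Rightarrow> mat_alg) \<Rightarrow> (mat_alg \<Rightarrow> mat_alg \<Rightarrow> complex)
    \<Rightarrow> mat_alg \<Rightarrow> form"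
  where "delbar N q S r f = (SOME \<omega>. \<omega> \<in> Omega01 N q S r \<and> dd N f - \<omega> \<in> Omega10 N q S r)"

end

theory Submission
  imports Defs
begin

text \<open>
  Let \<open>W\<close> be the matrix of the $S(u^i_j)$, which is inverse to \<open>U = u\<close>. Multiplying the defining
  relations by \<open>W\<close> from one or both sides gives exchange relations between the
  $x_i = u^i_1$, the $u^i_k$, and the rows $w_j = S(u^1_j)$ and $S(u^k_j)$ of \<open>W\<close> with $k \ge 2$.
  Only those for $w_j x_m$ and $S(u^k_j) x_m$ are not immediate: together with
  $\sum_a w_a x_a = 1$ and $\sum_a S(u^k_a) x_a = 0$ they form a triangular system, whose solution
  produces the powers $q^{2(b-j)}$. Chaining four exchanges gives the stated bimodule relations,
  once it is known that the $e^\pm_k$ commute with the $z_{rs}$.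

  For the latter, the matrix \<open>Q\<close> satisfies $Q(v g) = T^-(g_{(1)})\, Q(v)\, T^+(g_{(2)})$, where
  $T^\pm$ are given by \<open>r\<close>. Modulo $\ker Q$ the ideal \<open>I\<close> is spanned by elements whose images are
  multiples of the matrix units with both indices at least 2, so that the classes of
  $v\, z_{ab}$ and of $z_{ab}$ are read off from explicit matrices.

  That the $z_{ij}$ are coinvariant needs $\alpha_N$ to be well defined, hence the centrality of
  $\det_{N-1}$: by the braid relation, moving a letter through the $q$-antisymmetric tensor
  \<open>\<epsilon>\<close> maps \<open>e\<^sub>j \<otimes> \<epsilon>\<close> to \<open>q \<epsilon> \<otimes> e\<^sub>j\<close>, and this intertwines
  $u^i_j \det$ with $\det u^i_j$.
\<close>

section \<open>Linear maps on free algebras\<close>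

text \<open>The off-diagonal entries of each Q(u^i_j) carry the factor nu = q - 1/q, which is 0 at q
  = 1, so membership in the ideal is never obtained by dividing by nu. The generators z_kk already
  have images of order nu^2, and every remainder met below is shown to be a multiple of nu^2 as
  well; this lets one argument cover all q. The antipode is given only as a convolution inverse of
  the identity. Coproduct and counit of the S(u^i_j) are therefore derived from the matrix
  identities that express this. The derivatives are chosen representatives of components.
  Identifying them requires that the expected values lie in the calculus over the projective space,
  and not just in the forms over G, and that the two summands meet only in zero forms. The power
  q^{2/N} in both derivatives stems from the normalisation q^{-1/N} of r, which enters
  \<open>Q\<close> twice.\<close>

lemma scal_conv_mult: "scal c f = Poly_Mapping.single 0 c * f"
  for f :: "'k::monoid_add \<Rightarrow>\<^sub>0 complex"
  by (simp add: scal_def mult_map_scale_conv_mult)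

lemma scal_mult_left [simp]: "scal c f * g = scal c (f * g)"
  for f :: "'k::monoid_add \<Rightarrow>\<^sub>0 complex"
  by (simp add: scal_conv_mult mult.assoc)

lemma single_0_central: "Poly_Mapping.single 0 c * f = f * Poly_Mapping.single 0 c"
  for f :: "'k::monoid_add \<Rightarrow>\<^sub>0 complex"
proof (induction f rule: update_induct)
  case const
  then show ?case by simp
next
  case (update f a b)
  have "Poly_Mapping.update a b f = f + Poly_Mapping.single a b"
    using update(1) by (intro poly_mapping_eqI)
      (auto simp: lookup_update lookup_add lookup_single in_keys_iff)
  then show ?case
    using update by (simp add: algebra_simps mult_single)
qed

lemma scal_mult_right [simp]: "f * scal c g = scal c (f * g)"
  for f :: "'k::monoid_add \<Rightarrow>\<^sub>0 complex"
proof -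
  have "f * scal c g = (f * Poly_Mapping.single 0 c) * g"
    by (simp only: scal_conv_mult mult.assoc)
  also have "\<dots> = scal c (f * g)"
    by (simp only: scal_conv_mult mult.assoc flip: single_0_central)
  finally show ?thesis .
qed

lemma scal_single [simp]: "scal c (Poly_Mapping.single k d) = Poly_Mapping.single k (c * d)"
  by (intro poly_mapping_eqI) (simp add: lookup_single when_def)

lemma scal_scal [simp]: "scal c (scal d f) = scal (c * d) f"
  by (intro poly_mapping_eqI) simp

lemma poly_mapping_expand:
  "f = (\<Sum>k \<in> Poly_Mapping.keys f. scal (Poly_Mapping.lookup f k) (Poly_Mapping.single k 1))"
  by (intro poly_mapping_eqI)
    (auto simp: lookup_sum lookup_single when_def in_keys_iff if_distrib sum.If_cases
      cong: if_cong)

lemma linear_scalD: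
  assumes "Vector_Spaces.linear scal sc L"
  shows "L (f + g) = L f + L g" "L (scal c f) = sc c (L f)" "L 0 = 0" "L (f - g) = L f - L g"
    "L (sum h X) = (\<Sum>x\<in>X. L (h x))"
proof -
  interpret Vector_Spaces.linear scal sc L by fact
  show "L (f + g) = L f + L g" "L (scal c f) = sc c (L f)" "L 0 = 0" "L (f - g) = L f - L g"
    "L (sum h X) = (\<Sum>x\<in>X. L (h x))"
    by (simp_all add: add scale zero diff sum)
qed

text \<open>\<open>contract sc \<beta>\<close> and \<open>alg_ext\<close> are both of this form.\<close>

lemma linear_sum_keys:
  fixes b :: "'k \<Rightarrow> 'v::ab_group_add"
  assumes "vector_space sc"
  shows "Vector_Spaces.linear scal sc
    (\<lambda>t. \<Sum>k \<in> Poly_Mapping.keys t. sc (Poly_Mapping.lookup t k) (b k))"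
proof -
  interpret vector_space sc by fact
  have fin: "(\<Sum>k \<in> Poly_Mapping.keys t. sc (Poly_Mapping.lookup t k) (b k))
    = (\<Sum>k \<in> K. sc (Poly_Mapping.lookup t k) (b k))"
    if "finite K" "Poly_Mapping.keys t \<subseteq> K" for t K
    using that by (intro sum.mono_neutral_left) (auto simp: in_keys_iff)
  show ?thesis
  proof (rule Vector_Spaces.linear_iff[THEN iffD2], intro conjI allI)
    fix s t :: "'k \<Rightarrow>\<^sub>0 complex"
    let ?K = "Poly_Mapping.keys s \<union> Poly_Mapping.keys t"
    have 1: "(\<Sum>k \<in> Poly_Mapping.keys (s + t). sc (Poly_Mapping.lookup (s + t) k) (b k)) =
      (\<Sum>k \<in> ?K. sc (Poly_Mapping.lookup (s + t) k) (b k))"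
      by (rule fin) (use keys_add[of s t] in simp_all)
    have 2: "(\<Sum>k \<in> Poly_Mapping.keys s. sc (Poly_Mapping.lookup s k) (b k)) =
      (\<Sum>k \<in> ?K. sc (Poly_Mapping.lookup s k) (b k))"
      by (rule fin) simp_all
    have 3: "(\<Sum>k \<in> Poly_Mapping.keys t. sc (Poly_Mapping.lookup t k) (b k)) =
      (\<Sum>k \<in> ?K. sc (Poly_Mapping.lookup t k) (b k))"
      by (rule fin) simp_all
    show "(\<Sum>k \<in> Poly_Mapping.keys (s + t). sc (Poly_Mapping.lookup (s + t) k) (b k)) =
      (\<Sum>k \<in> Poly_Mapping.keys s. sc (Poly_Mapping.lookup s k) (b k)) +
      (\<Sum>k \<in> Poly_Mapping.keys t. sc (Poly_Mapping.lookup t k) (b k))"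
      unfolding 1 2 3 by (simp only: lookup_add scale_left_distrib sum.distrib)
  next
    fix c and t :: "'k \<Rightarrow>\<^sub>0 complex"
    have "Poly_Mapping.keys (scal c t) \<subseteq> Poly_Mapping.keys t"
      by (auto simp: in_keys_iff)
    then show "(\<Sum>k \<in> Poly_Mapping.keys (scal c t). sc (Poly_Mapping.lookup (scal c t) k) (b k)) =
      sc c (\<Sum>k \<in> Poly_Mapping.keys t. sc (Poly_Mapping.lookup t k) (b k))"
      by (subst fin[of "Poly_Mapping.keys t"]) (simp_all add: scale_sum_right)
  qed unfold_locales
qed

lemma linear_contract:
  assumes "vector_space sc"
  shows "Vector_Spaces.linear scal sc (contract sc \<beta>)"
  using linear_sum_keys[OF assms, of "\<lambda>(v, w). \<beta> (Poly_Mapping.single v 1) (Poly_Mapping.single w 1)"]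
  by (simp add: contract_def[abs_def] case_prod_beta)

section \<open>Bilinear maps, Sweedler contractions and tensor products\<close>

definition bilinear_scal ::
    "(complex \<Rightarrow> 'v \<Rightarrow> 'v) \<Rightarrow> ('x falg \<Rightarrow> 'y falg \<Rightarrow> 'v::ab_group_add) \<Rightarrow> bool"
  where "bilinear_scal sc \<beta> \<longleftrightarrow> (\<forall>g. Vector_Spaces.linear scal sc (\<lambda>f. \<beta> f g)) \<and>
    (\<forall>f. Vector_Spaces.linear scal sc (\<beta> f))"

text \<open>\<open>contract\<close> is defined through basis words; bilinearity makes its value on a
  pure tensor independent of the expansion. This is the rule by which Sweedler sums are evaluated
  below.\<close>

lemma contract_tens:
  assumes "bilinear_scal sc \<beta>"
  shows "contract sc \<beta> (tens f g) = \<beta> f g"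
proof -
  have l1: "Vector_Spaces.linear scal sc (\<lambda>f. \<beta> f g)"
    and l2: "Vector_Spaces.linear scal sc (\<beta> f)" for f g
    using assms by (auto simp: bilinear_scal_def)
  interpret L: Vector_Spaces.linear scal sc "\<beta> f" by (rule l2)
  have lin: "Vector_Spaces.linear scal sc (contract sc \<beta>)"
    by (rule linear_contract) unfold_locales
  have single: "contract sc \<beta> (Poly_Mapping.single (v, w) c)
    = sc c (\<beta> (Poly_Mapping.single v 1) (Poly_Mapping.single w 1))" for v w c
    by (cases "c = 0") (simp_all add: contract_def)
  have "contract sc \<beta> (tens f g) = (\<Sum>v \<in> Poly_Mapping.keys f. \<Sum>w \<in> Poly_Mapping.keys g.
    sc (Poly_Mapping.lookup f v * Poly_Mapping.lookup g w)
      (\<beta> (Poly_Mapping.single v 1) (Poly_Mapping.single w 1)))"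
    by (simp add: tens_def linear_scalD[OF lin] single)
  also have "\<dots> = (\<Sum>v \<in> Poly_Mapping.keys f. sc (Poly_Mapping.lookup f v)
    (\<Sum>w \<in> Poly_Mapping.keys g. sc (Poly_Mapping.lookup g w)
      (\<beta> (Poly_Mapping.single v 1) (Poly_Mapping.single w 1))))"
    by (simp add: L.vs2.scale_sum_right)
  also have "\<dots> = (\<Sum>v \<in> Poly_Mapping.keys f. sc (Poly_Mapping.lookup f v)
    (\<beta> (Poly_Mapping.single v 1) g))"
  proof (intro sum.cong refl arg_cong[where f = "sc _"])
    fix v
    have "\<beta> (Poly_Mapping.single v 1) g = \<beta> (Poly_Mapping.single v 1)
      (\<Sum>w \<in> Poly_Mapping.keys g. scal (Poly_Mapping.lookup g w) (Poly_Mapping.single w 1))"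
      by (rule arg_cong[OF poly_mapping_expand])
    then show "(\<Sum>w \<in> Poly_Mapping.keys g. sc (Poly_Mapping.lookup g w)
      (\<beta> (Poly_Mapping.single v 1) (Poly_Mapping.single w 1))) = \<beta> (Poly_Mapping.single v 1) g"
      by (simp only: linear_scalD(2,5)[OF l2])
  qed
  also have "\<dots> = \<beta> (\<Sum>v \<in> Poly_Mapping.keys f.
    scal (Poly_Mapping.lookup f v) (Poly_Mapping.single v 1)) g"
    by (simp only: linear_scalD(2,5)[OF l1])
  also have "\<dots> = \<beta> f g"
    by (rule arg_cong[OF poly_mapping_expand[symmetric]])
  finally show ?thesis .
qed

lemma bilinear_scalD:
  assumes "bilinear_scal sc \<beta>"
  shows "\<beta> (f + f') g = \<beta> f g + \<beta> f' g" "\<beta> f (g + g') = \<beta> f g + \<beta> f g'"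
    "\<beta> (f - f') g = \<beta> f g - \<beta> f' g" "\<beta> f (g - g') = \<beta> f g - \<beta> f g'"
    "\<beta> (scal c f) g = sc c (\<beta> f g)" "\<beta> f (scal c g) = sc c (\<beta> f g)"
    "\<beta> 0 g = 0" "\<beta> f 0 = 0"
    "\<beta> (sum h X) g = (\<Sum>x\<in>X. \<beta> (h x) g)" "\<beta> f (sum h' X) = (\<Sum>x\<in>X. \<beta> f (h' x))"
proof -
  have l1: "Vector_Spaces.linear scal sc (\<lambda>f. \<beta> f g)"
    and l2: "Vector_Spaces.linear scal sc (\<beta> f)" for f g
    using assms by (auto simp: bilinear_scal_def)
  show "\<beta> (f + f') g = \<beta> f g + \<beta> f' g" "\<beta> f (g + g') = \<beta> f g + \<beta> f g'"
    "\<beta> (f - f') g = \<beta> f g - \<beta> f' g" "\<beta> f (g - g') = \<beta> f g - \<beta> f g'"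
    "\<beta> (scal c f) g = sc c (\<beta> f g)" "\<beta> f (scal c g) = sc c (\<beta> f g)"
    "\<beta> 0 g = 0" "\<beta> f 0 = 0"
    "\<beta> (sum h X) g = (\<Sum>x\<in>X. \<beta> (h x) g)" "\<beta> f (sum h' X) = (\<Sum>x\<in>X. \<beta> f (h' x))"
    by (simp_all only: linear_scalD[OF l1] linear_scalD[OF l2])
qed

lemma bilinear_scalI:
  assumes "vector_space sc"
    and "\<And>f f' g. \<beta> (f + f') g = \<beta> f g + \<beta> f' g" "\<And>f g g'. \<beta> f (g + g') = \<beta> f g + \<beta> f g'"
    and "\<And>c f g. \<beta> (scal c f) g = sc c (\<beta> f g)" "\<And>c f g. \<beta> f (scal c g) = sc c (\<beta> f g)"
  shows "bilinear_scal sc \<beta>"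
  unfolding bilinear_scal_def
  using assms by (auto simp: Vector_Spaces.linear_iff cvec.vector_space_axioms)

lemma vector_space_complex: "vector_space ((*) :: complex \<Rightarrow> complex \<Rightarrow> complex)"
  by unfold_locales (simp_all add: algebra_simps)

lemma bilinear_ext:
  assumes "bilinear_scal sc \<beta>" "bilinear_scal sc \<gamma>"
    and "\<And>v w. \<beta> (Poly_Mapping.single v 1) (Poly_Mapping.single w 1) =
      \<gamma> (Poly_Mapping.single v 1) (Poly_Mapping.single w 1)"
  shows "\<beta> f g = \<gamma> f g"
proof -
  have "contract sc \<beta> = contract sc \<gamma>"
    by (simp add: contract_def[abs_def] assms(3))
  then show ?thesis
    using contract_tens[OF assms(1), of f g] contract_tens[OF assms(2), of f g] by simp
qed

lemma bilinear_tens: "bilinear_scal scal tens"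
proof -
  have tens_alt: "tens f g = (\<Sum>v \<in> Poly_Mapping.keys f. scal (Poly_Mapping.lookup f v)
    (\<Sum>w \<in> Poly_Mapping.keys g. scal (Poly_Mapping.lookup g w) (Poly_Mapping.single (v, w) 1)))"
    for f :: "'x falg" and g :: "'y falg"
    by (simp add: tens_def cvec.scale_sum_right)
  have tens_alt': "tens f g = (\<Sum>w \<in> Poly_Mapping.keys g. scal (Poly_Mapping.lookup g w)
    (\<Sum>v \<in> Poly_Mapping.keys f. scal (Poly_Mapping.lookup f v) (Poly_Mapping.single (v, w) 1)))"
    for f :: "'x falg" and g :: "'y falg"
    unfolding tens_def by (subst sum.swap) (simp add: cvec.scale_sum_right mult.commute)
  show ?thesis
    unfolding bilinear_scal_def
  proof (intro conjI allI)
    show "Vector_Spaces.linear scal scal (\<lambda>f. tens f g)" for g :: "'y falg"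
      unfolding tens_alt by (rule linear_sum_keys) (rule cvec.vector_space_axioms)
    show "Vector_Spaces.linear scal scal (tens f)" for f :: "'x falg"
      unfolding tens_alt'[abs_def] by (rule linear_sum_keys) (rule cvec.vector_space_axioms)
  qed
qed

lemmas tens_simps = bilinear_scalD[OF bilinear_tens]

lemma tens_single [simp]:
  "tens (Poly_Mapping.single v c) (Poly_Mapping.single w d) = Poly_Mapping.single (v, w) (c * d)"
  by (cases "c = 0"; cases "d = 0") (simp_all add: tens_def)

lemma tens_1_1 [simp]: "tens 1 1 = 1"
  by (simp flip: single_one add: zero_prod_def)

text \<open>Both sides are bilinear in (f, g) and in (f', g'), so two applications of
  \<open>bilinear_ext\<close> reduce the claim to words.\<close>

lemma tens_mult [simp]: "tens f g * tens f' g' = tens (f * f') (g * g')"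
proof -
  have "tens f g * tens f' g' = tens (f * f') (g * g')"
    if "f' = Poly_Mapping.single v 1" "g' = Poly_Mapping.single w 1" for v w f' g'
    by (rule bilinear_ext[of scal "\<lambda>f g. tens f g * tens f' g'" "\<lambda>f g. tens (f * f') (g * g')"])
      (auto intro!: bilinear_scalI cvec.vector_space_axioms
        simp: tens_simps distrib_right mult_single that)
  note * = this[OF refl refl]
  show ?thesis
    by (rule bilinear_ext[where \<beta> = "\<lambda>f' g'. tens f g * tens f' g'"
          and \<gamma> = "\<lambda>f' g'. tens (f * f') (g * g')" and sc = scal])
      (use * in \<open>auto intro!: bilinear_scalI cvec.vector_space_axioms simp: tens_simps distrib_left\<close>)
qed

text \<open>One locale for all targets of \<open>alg_ext\<close>: free algebras and tensor products,
  with unit map \<open>Poly_Mapping.single 0\<close>, and the complex numbers, with unit map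
  \<open>id\<close>.\<close>

locale scalar_algebra = vector_space sc for sc :: "complex \<Rightarrow> 'b \<Rightarrow> 'b::ring_1" +
  fixes \<iota> :: "complex \<Rightarrow> 'b"
  assumes sc_left: "sc c x * y = sc c (x * y)"
    and sc_right: "x * sc c y = sc c (x * y)"
    and unit_map: "\<iota> c = sc c 1"
begin

lemma alg_ext_linear: "Vector_Spaces.linear scal sc (alg_ext \<iota> \<phi>)"
  using linear_sum_keys[OF vector_space_axioms, of "\<lambda>w. prod_list (map \<phi> (letters w))"]
  by (simp add: alg_ext_def[abs_def] unit_map sc_left)

lemmas alg_ext_lin = linear_scalD[OF alg_ext_linear]

lemma alg_ext_single:
  "alg_ext \<iota> \<phi> (Poly_Mapping.single w c) = sc c (prod_list (map \<phi> (letters w)))"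
  by (cases "c = 0") (simp_all add: alg_ext_def unit_map sc_left)

lemma alg_ext_gen: "alg_ext \<iota> \<phi> (gen x) = \<phi> x"
  by (simp add: gen_def alg_ext_single)

lemma alg_ext_1: "alg_ext \<iota> \<phi> 1 = 1"
  by (simp flip: single_one add: alg_ext_single zero_word_def)

lemma alg_ext_mult: "alg_ext \<iota> \<phi> (f * g) = alg_ext \<iota> \<phi> f * alg_ext \<iota> \<phi> g"
  by (rule bilinear_ext[of sc "\<lambda>f g. alg_ext \<iota> \<phi> (f * g)" "\<lambda>f g. alg_ext \<iota> \<phi> f * alg_ext \<iota> \<phi> g"])
    (auto intro!: bilinear_scalI vector_space_axioms simp: alg_ext_lin distrib_left distrib_right
      sc_left sc_right mult_single alg_ext_single plus_word_def)

lemma alg_ext_prod_list: "alg_ext \<iota> \<phi> (prod_list fs) = prod_list (map (alg_ext \<iota> \<phi>) fs)"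
  by (induction fs) (simp_all add: alg_ext_1 alg_ext_mult)

lemmas alg_ext_simps = alg_ext_lin alg_ext_gen alg_ext_1 alg_ext_mult alg_ext_prod_list

end

interpretation tscal: scalar_algebra scal "Poly_Mapping.single 0"
  by unfold_locales (simp_all flip: single_one)

text \<open>Not an interpretation, because \<open>scale_scale\<close> for \<open>(*)\<close> makes the simplifier loop.\<close>

lemma scalar_algebra_complex: "scalar_algebra (*) (id :: complex \<Rightarrow> complex)"
  by unfold_locales (simp_all add: algebra_simps)

lemmas Delta_simps = tscal.alg_ext_simps[of "\<lambda>(i, j). \<Sum>k = 1..n. tens (u i k) (u k j)" for n,
  folded Delta_def]
lemmas alpha_simps = tscal.alg_ext_simps[of "\<lambda>(i, j). if i = 1 \<and> j = 1 then gen None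
  else if i = 1 \<or> j = 1 then 0 else uU (i - 1) (j - 1)", folded alpha_def]
lemmas counit_simps = scalar_algebra.alg_ext_simps[OF scalar_algebra_complex, of "\<lambda>(i::nat, j). of_bool (i = j)", folded counit_def]

lemma Delta_u [simp]: "Delta n (u i j) = (\<Sum>k = 1..n. tens (u i k) (u k j))"
  by (simp add: u_def Delta_simps)

lemma counit_u [simp]: "counit (u i j) = of_bool (i = j)"
  by (simp add: u_def counit_simps)

lemma alpha_u: "alpha (u i j) = (if i = 1 \<and> j = 1 then gen None
  else if i = 1 \<or> j = 1 then 0 else uU (i - 1) (j - 1))"
  by (simp add: u_def alpha_simps)

section \<open>Congruence modulo an ideal of a subalgebra\<close>

lemma span_mult:
  fixes X Y Z :: "('k::monoid_add \<Rightarrow>\<^sub>0 complex) set"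
  assumes "x \<in> cvec.span X" "y \<in> cvec.span Y" "cvec.subspace Z"
    and XY: "\<And>a b. a \<in> X \<Longrightarrow> b \<in> Y \<Longrightarrow> a * b \<in> Z"
  shows "x * y \<in> Z"
proof -
  note Z = cvec.subspace_0[OF assms(3)] cvec.subspace_add[OF assms(3)] cvec.subspace_scale[OF assms(3)]
  have "cvec.span Y \<subseteq> {y. a * y \<in> Z}" if "a \<in> X" for a
    using XY that by (intro cvec.span_minimal) (auto simp: cvec.subspace_def distrib_left Z)
  then have "cvec.span X \<subseteq> {x. \<forall>y \<in> cvec.span Y. x * y \<in> Z}"
    by (intro cvec.span_minimal) (auto simp: cvec.subspace_def distrib_right Z)
  then show ?thesis using assms(1,2) by blast
qed

text \<open>The pair stands for the quotient A/I. It is used for the quantum groups, for their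
  tensor products, and in the degenerate cases of no relations and of I = A.\<close>

locale alg_ideal =
  fixes A I :: "('k::monoid_add \<Rightarrow>\<^sub>0 complex) set"
  assumes A_1: "1 \<in> A" and A_sub: "cvec.subspace A" and I_sub: "cvec.subspace I"
    and A_mult: "x \<in> A \<Longrightarrow> y \<in> A \<Longrightarrow> x * y \<in> A"
    and I_A: "I \<subseteq> A"
    and I_left: "x \<in> A \<Longrightarrow> y \<in> I \<Longrightarrow> x * y \<in> I"
    and I_right: "x \<in> I \<Longrightarrow> y \<in> A \<Longrightarrow> x * y \<in> I"
begin

lemmas A_0 = cvec.subspace_0[OF A_sub]
lemmas A_add = cvec.subspace_add[OF A_sub]
lemmas A_diff = cvec.subspace_diff[OF A_sub]
lemmas A_scal = cvec.subspace_scale[OF A_sub]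
lemmas A_sum = cvec.subspace_sum[OF A_sub]
lemmas A_neg = cvec.subspace_neg[OF A_sub]
lemmas I_0 = cvec.subspace_0[OF I_sub]
lemmas I_add = cvec.subspace_add[OF I_sub]
lemmas I_scal = cvec.subspace_scale[OF I_sub]
lemmas I_sum = cvec.subspace_sum[OF I_sub]
lemmas I_neg = cvec.subspace_neg[OF I_sub]

lemma A_prod_list: "set fs \<subseteq> A \<Longrightarrow> prod_list fs \<in> A"
  by (induction fs) (auto intro: A_1 A_mult)

lemmas A_closed = A_1 A_0 A_add A_diff A_scal A_sum A_neg A_mult

text \<open>Reflexive only on \<open>A\<close>: membership in \<open>A\<close> is carried along in calculations.\<close>

definition cg :: "('k \<Rightarrow>\<^sub>0 complex) \<Rightarrow> ('k \<Rightarrow>\<^sub>0 complex) \<Rightarrow> bool" (infix \<open>\<approx>\<close> 50)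
  where "x \<approx> y \<longleftrightarrow> x \<in> A \<and> y \<in> A \<and> x - y \<in> I"

lemma cg_refl: "x \<in> A \<Longrightarrow> x \<approx> x"
  by (simp add: cg_def I_0)

lemma cg_sym: "x \<approx> y \<Longrightarrow> y \<approx> x"
  using I_neg[of "x - y"] by (simp add: cg_def)

lemma cg_trans [trans]: "x \<approx> y \<Longrightarrow> y \<approx> z \<Longrightarrow> x \<approx> z"
  using I_add[of "x - y" "y - z"] by (simp add: cg_def)

lemma cg_add: "x \<approx> x' \<Longrightarrow> y \<approx> y' \<Longrightarrow> x + y \<approx> x' + y'"
  using I_add[of "x - x'" "y - y'"] by (simp add: cg_def A_add algebra_simps)

lemma cg_neg: "x \<approx> x' \<Longrightarrow> - x \<approx> - x'"
  using I_neg[of "x - x'"] by (simp add: cg_def A_neg algebra_simps)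

lemma cg_diff: "x \<approx> x' \<Longrightarrow> y \<approx> y' \<Longrightarrow> x - y \<approx> x' - y'"
  using cg_add[OF _ cg_neg] by fastforce

lemma cg_scal: "x \<approx> x' \<Longrightarrow> scal c x \<approx> scal c x'"
  using I_scal[of "x - x'" c] by (simp add: cg_def A_scal cvec.scale_right_diff_distrib)

lemma cg_mult: assumes "x \<approx> x'" "y \<approx> y'" shows "x * y \<approx> x' * y'"
proof -
  have "x * y - x' * y' = (x - x') * y + x' * (y - y')"
    by (simp add: algebra_simps)
  then show ?thesis
    using assms by (auto simp: cg_def intro: A_mult I_add I_left I_right)
qed

lemma cg_sum: "(\<And>i. i \<in> X \<Longrightarrow> f i \<approx> g i) \<Longrightarrow> sum f X \<approx> sum g X"
  by (auto simp: cg_def A_sum simp flip: sum_subtractf intro: I_sum)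

lemma cg_I: "x \<approx> y \<Longrightarrow> x - y \<in> I"
  by (simp add: cg_def)

text \<open>For congruences that follow linearly from two known ones: the coefficients
  \<open>c\<close> and \<open>d\<close> are supplied, and an identity remains that can be checked
  coefficientwise.\<close>

lemma cg_combine:
  assumes "a \<approx> b" "a' \<approx> b'" "x \<in> A" "y \<in> A" "x - y = scal c (a - b) + scal d (a' - b')"
  shows "x \<approx> y"
  using assms by (simp add: cg_def I_add I_scal)

end

section \<open>Free algebras and tensor products\<close>

lemma free_on_gen: "x \<in> X \<Longrightarrow> gen x \<in> free_on X"
  by (simp add: free_on_def gen_def)

lemma subspace_free_on: "cvec.subspace (free_on X)"
  using keys_add by (fastforce simp: cvec.subspace_def free_on_def in_keys_iff)

lemma alg_ideal_ideal_on:
  assumes "R \<subseteq> free_on X"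
  shows "alg_ideal (free_on X) (ideal_on X R)"
proof
  show 1: "1 \<in> free_on X"
    by (simp add: free_on_def zero_word_def)
  show "cvec.subspace (free_on X)" by (rule subspace_free_on)
  show "cvec.subspace (ideal_on X R)" by (simp add: ideal_on_def)
  show mult: "x * y \<in> free_on X" if "x \<in> free_on X" "y \<in> free_on X" for x y
    using that keys_mult[of x y] by (fastforce simp: free_on_def plus_word_def)
  show "ideal_on X R \<subseteq> free_on X"
    unfolding ideal_on_def using assms by (intro cvec.span_minimal subspace_free_on) (auto intro: mult)
  show "x * y \<in> ideal_on X R" if "x \<in> free_on X" "y \<in> ideal_on X R" for x y
    using cvec.span_base[OF that(1)] that(2) unfolding ideal_on_def
  proof (rule span_mult)
    fix a b assume "a \<in> free_on X" "b \<in> {f * a * g | f a g. f \<in> free_on X \<and> a \<in> R \<and> g \<in> free_on X}"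
    then obtain f c g where "b = f * c * g" "f \<in> free_on X" "c \<in> R" "g \<in> free_on X"
      by blast
    moreover have "a * (f * c * g) = (a * f) * c * g"
      by (simp add: mult.assoc)
    ultimately show "a * b \<in> cvec.span {f * a * g | f a g. f \<in> free_on X \<and> a \<in> R \<and> g \<in> free_on X}"
      using mult[OF \<open>a \<in> free_on X\<close>] by (intro cvec.span_base) blast
  qed simp
  show "x * y \<in> ideal_on X R" if "x \<in> ideal_on X R" "y \<in> free_on X" for x y
    using that(1) cvec.span_base[OF that(2)] unfolding ideal_on_def
  proof (rule span_mult)
    fix a b assume "b \<in> free_on X" "a \<in> {f * a * g | f a g. f \<in> free_on X \<and> a \<in> R \<and> g \<in> free_on X}"
    then obtain f c g where "a = f * c * g" "f \<in> free_on X" "c \<in> R" "g \<in> free_on X"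
      by blast
    moreover have "(f * c * g) * b = f * c * (g * b)"
      by (simp add: mult.assoc)
    ultimately show "a * b \<in> cvec.span {f * a * g | f a g. f \<in> free_on X \<and> a \<in> R \<and> g \<in> free_on X}"
      using mult[OF _ \<open>b \<in> free_on X\<close>] by (intro cvec.span_base) blast
  qed simp
qed

lemma ideal_on_base:
  assumes "R \<subseteq> free_on X" "a \<in> R"
  shows "a \<in> ideal_on X R"
proof -
  interpret alg_ideal "free_on X" "ideal_on X R"
    by (rule alg_ideal_ideal_on[OF assms(1)])
  have "1 * a * 1 \<in> ideal_on X R"
    unfolding ideal_on_def using assms A_1 by (intro cvec.span_base) blast
  then show ?thesis by simp
qed

lemma free_on_induct [consumes 1, case_names one gen add scal]:
  assumes "f \<in> free_on X" "P 1" "\<And>x g. x \<in> X \<Longrightarrow> g \<in> free_on X \<Longrightarrow> P g \<Longrightarrow> P (gen x * g)"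
    "\<And>g h. g \<in> free_on X \<Longrightarrow> h \<in> free_on X \<Longrightarrow> P g \<Longrightarrow> P h \<Longrightarrow> P (g + h)"
    "\<And>c g. g \<in> free_on X \<Longrightarrow> P g \<Longrightarrow> P (scal c g)"
  shows "P f"
proof -
  have word: "P (Poly_Mapping.single (Word xs) 1)" if "set xs \<subseteq> X" for xs
    using that
  proof (induction xs)
    case Nil
    then show ?case using assms(2) by (simp flip: zero_word_def)
  next
    case (Cons x xs)
    have "Poly_Mapping.single (Word (x # xs)) 1 = gen x * Poly_Mapping.single (Word xs) (1::complex)"
      by (simp add: gen_def mult_single plus_word_def)
    moreover have "Poly_Mapping.single (Word xs) 1 \<in> free_on X"
      using Cons.prems by (simp add: free_on_def)
    ultimately show ?case using Cons assms(3) by simp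
  qed
  have "f \<in> cvec.span {Poly_Mapping.single (Word xs) 1 | xs. set xs \<subseteq> X}"
  proof (subst poly_mapping_expand, intro cvec.span_sum cvec.span_scale cvec.span_base)
    fix k assume "k \<in> Poly_Mapping.keys f"
    then show "Poly_Mapping.single k 1 \<in> {Poly_Mapping.single (Word xs) 1 | xs. set xs \<subseteq> X}"
      using assms(1) by (cases k) (fastforce simp: free_on_def)
  qed
  moreover have "cvec.span {Poly_Mapping.single (Word xs) 1 | xs. set xs \<subseteq> X} \<subseteq> {g \<in> free_on X. P g}"
  proof (rule cvec.span_minimal)
    show "cvec.subspace {g \<in> free_on X. P g}"
      using assms(2,4,5) subspace_free_on[of X] assms(5)[of 1 0] alg_ideal.A_1[OF alg_ideal_ideal_on, of "{}" X]
      by (auto simp: cvec.subspace_def)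
  qed (use word in \<open>auto simp: free_on_def\<close>)
  ultimately show ?thesis by blast
qed

lemma ideal_on_subset:
  assumes "cvec.subspace T"
    and "\<And>f a g. f \<in> free_on X \<Longrightarrow> a \<in> R \<Longrightarrow> g \<in> free_on X \<Longrightarrow> f * a * g \<in> T"
  shows "ideal_on X R \<subseteq> T"
  unfolding ideal_on_def using assms by (intro cvec.span_minimal) auto

lemma alg_ext_free_on:
  assumes "alg_ideal B J" "f \<in> free_on X" "\<And>x. x \<in> X \<Longrightarrow> \<phi> x \<in> B"
  shows "alg_ext (Poly_Mapping.single 0) \<phi> f \<in> B"
  using assms(2)
  by (induction rule: free_on_induct)
    (auto simp: tscal.alg_ext_simps intro: assms(3) alg_ideal.A_closed[OF assms(1)])

lemma alg_ext_ideal_on: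
  assumes "alg_ideal B J" "f \<in> ideal_on X R" "\<And>x. x \<in> X \<Longrightarrow> \<phi> x \<in> B"
    "\<And>a. a \<in> R \<Longrightarrow> alg_ext (Poly_Mapping.single 0) \<phi> a \<in> J"
  shows "alg_ext (Poly_Mapping.single 0) \<phi> f \<in> J"
proof -
  interpret alg_ideal B J by fact
  have "ideal_on X R \<subseteq> {f. alg_ext (Poly_Mapping.single 0) \<phi> f \<in> J}"
    by (intro ideal_on_subset)
      (auto simp: cvec.subspace_def tscal.alg_ext_simps intro!: I_0 I_add I_scal
        I_right[OF I_left[OF alg_ext_free_on[OF assms(1) _ assms(3)] assms(4)]
          alg_ext_free_on[OF assms(1) _ assms(3)]])
  then show ?thesis using assms(2) by blast
qed

definition tens_alg :: "'x falg set \<Rightarrow> 'y falg set \<Rightarrow> ('x, 'y) tensor set"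
  where "tens_alg A B = cvec.span {tens f g | f g. f \<in> A \<and> g \<in> B}"

lemma tens_alg_base: "f \<in> A \<Longrightarrow> g \<in> B \<Longrightarrow> tens f g \<in> tens_alg A B"
  unfolding tens_alg_def by (blast intro: cvec.span_base)

lemma tens_ker_base:
  "f \<in> X\<^sub>0 \<Longrightarrow> g \<in> Y \<Longrightarrow> tens f g \<in> tens_ker X X\<^sub>0 Y Y\<^sub>0"
  "f \<in> X \<Longrightarrow> g \<in> Y\<^sub>0 \<Longrightarrow> tens f g \<in> tens_ker X X\<^sub>0 Y Y\<^sub>0"
  unfolding tens_ker_def by (blast intro: cvec.span_base)+

text \<open>The tensor product of two quotients is thereby again an instance of the locale, so
  \<open>Delta\<close> can be treated as an algebra map into such a quotient.\<close>

lemma alg_ideal_tens: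
  assumes "alg_ideal A I" "alg_ideal B K"
  shows "alg_ideal (tens_alg A B) (tens_ker A I B K)"
proof -
  interpret A: alg_ideal A I by fact
  interpret B: alg_ideal B K by fact
  show ?thesis
  proof
    have ker: "cvec.subspace (tens_ker A I B K)"
      by (simp add: tens_ker_def)
    have sub: "cvec.subspace (tens_alg A B)"
      by (simp add: tens_alg_def)
    show "1 \<in> tens_alg A B"
      using tens_alg_base[OF A.A_1 B.A_1] by simp
    show "cvec.subspace (tens_alg A B)" "cvec.subspace (tens_ker A I B K)"
      by (simp_all add: tens_alg_def tens_ker_def)
    show "tens_ker A I B K \<subseteq> tens_alg A B"
      unfolding tens_ker_def using A.I_A B.I_A
      by (intro cvec.span_minimal) (auto simp: tens_alg_def intro!: cvec.span_base)
    show "x * y \<in> tens_alg A B" if "x \<in> tens_alg A B" "y \<in> tens_alg A B" for x y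
      using that[unfolded tens_alg_def]
      by (rule span_mult) (auto intro!: tens_alg_base A.A_mult B.A_mult sub)
    show "x * y \<in> tens_ker A I B K" if "x \<in> tens_alg A B" "y \<in> tens_ker A I B K" for x y
      using that[unfolded tens_alg_def tens_ker_def[of A I B K]]
      by (rule span_mult, insert ker, auto)
        (blast intro: tens_ker_base A.A_mult A.I_left B.A_mult B.I_left)+
    show "x * y \<in> tens_ker A I B K" if "x \<in> tens_ker A I B K" "y \<in> tens_alg A B" for x y
      using that[unfolded tens_alg_def tens_ker_def[of A I B K]]
      by (rule span_mult, insert ker, auto)
        (blast intro: tens_ker_base A.A_mult A.I_right B.A_mult B.I_right)+
  qed
qed

text \<open>A bilinear map that sends both ideals into \<open>Z\<close> descends to the tensor
  product of the quotients. The instances are id (x) alpha, the map \<open>Q\<close>, the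
  differential, and the functionals that separate the two kinds of forms.\<close>

lemma contract_tens_ker:
  assumes "bilinear_scal sc \<beta>" "module.subspace sc Z" "t \<in> tens_ker A I B K"
    and "\<And>f g. f \<in> I \<Longrightarrow> g \<in> B \<Longrightarrow> \<beta> f g \<in> Z" "\<And>f g. f \<in> A \<Longrightarrow> g \<in> K \<Longrightarrow> \<beta> f g \<in> Z"
  shows "contract sc \<beta> t \<in> Z"
proof -
  interpret L: Vector_Spaces.linear scal sc "contract sc \<beta>"
    using assms(1) by (intro linear_contract) (auto simp: bilinear_scal_def Vector_Spaces.linear_def)
  have "tens_ker A I B K \<subseteq> {t. contract sc \<beta> t \<in> Z}"
    unfolding tens_ker_def
  proof (rule cvec.span_minimal)
    show "cvec.subspace {t. contract sc \<beta> t \<in> Z}"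
      using assms(2) by (auto simp: cvec.subspace_def L.vs2.subspace_def L.zero L.add L.scale)
  qed (auto simp: contract_tens[OF assms(1)] assms(4,5))
  then show ?thesis using assms(3) by blast
qed

section \<open>The quantum determinant\<close>

text \<open>\<open>rho\<close> is q^{delta_ac} and \<open>nuH\<close> is nu H(c - a): in R with
  upper pair (a, c), \<open>rho\<close> belongs to the exchanged lower pair (c, a) and
  \<open>nuH\<close> to the unchanged one.\<close>

definition rho :: "real \<Rightarrow> nat \<Rightarrow> nat \<Rightarrow> complex"
  where "rho q a c = (if a = c then of_real q else 1)"

definition nuH :: "real \<Rightarrow> nat \<Rightarrow> nat \<Rightarrow> complex"
  where "nuH q a c = (if a < c then of_real (q - inverse q) else 0)"

lemma rho_commute: "rho q a c = rho q c a"
  by (simp add: rho_def)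

lemma Rm_eq: "of_real (Rm q (a, c) (w, x)) =
    (if w = c then if x = a then rho q a c else 0 else 0) + (if w = a then if x = c then nuH q a c else 0 else 0)"
  by (auto simp: Rm_def rho_def nuH_def)

lemma Rb_eq: "of_real (Rb q (a, c) (w, x)) =
    (if w = c then if x = a then inverse (rho q a c) else 0 else 0)
      - (if w = a then if x = c then nuH q a c else 0 else 0)"
  by (auto simp: Rb_def rho_def nuH_def power_int_minus)

lemma Rm_sym: "Rm q (y, z) (b, d) = Rm q (b, d) (y, z)"
  by (auto simp: Rm_def)

lemma scal_if: "scal (if P then a else b) f = (if P then scal a f else scal b f)"
  by simp

lemma scal_0 [simp]: "scal 0 f = 0" by (rule cvec.scale_zero_left)

lemma scal_1 [simp]: "scal 1 f = f" by (rule cvec.scale_one)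

lemma sum_Rm:
  assumes "a \<in> {1..n}" "c \<in> {1..n}"
  shows "(\<Sum>w = 1..n. \<Sum>x = 1..n. scal (of_real (Rm q (a, c) (w, x))) (F w x)) =
    scal (rho q a c) (F c a) + scal (nuH q a c) (F a c)"
  using assms by (simp add: Rm_eq cvec.scale_left_distrib sum.distrib scal_if if_distrib
    [where f = "\<lambda>g. sum g _"] sum.If_cases if_distribR cong: if_cong)

section \<open>The operator of R on coordinates of tensors\<close>

definition swap :: "nat \<Rightarrow> 'a list \<Rightarrow> 'a list"
  where "swap p l = l[p := l ! Suc p, Suc p := l ! p]"

text \<open>The operator $\hat R$ acting on the tensor factors \<open>p\<close> and \<open>p + 1\<close>; the coordinates of a
  tensor are indexed by lists.\<close>

definition Rop :: "(complex \<Rightarrow> 'v \<Rightarrow> 'v::ab_group_add) \<Rightarrow> real \<Rightarrow> nat \<Rightarrow> (nat list \<Rightarrow> 'v) \<Rightarrow> nat list \<Rightarrow> 'v"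
  where "Rop sc q p f l = sc (rho q (l ! p) (l ! Suc p)) (f (swap p l)) + sc (nuH q (l ! p) (l ! Suc p)) (f l)"

definition idx_lists :: "nat \<Rightarrow> nat \<Rightarrow> nat list set"
  where "idx_lists n m = {l. set l \<subseteq> {1..n} \<and> length l = m}"

lemma finite_idx_lists [simp]: "finite (idx_lists n m)"
  by (simp add: idx_lists_def finite_lists_length_eq)

lemma swap_append [simp]: "swap (length xs) (xs @ a # b # ys) = xs @ b # a # ys"
  by (simp add: swap_def nth_append list_update_append)

lemma length_swap [simp]: "length (swap p l) = length l"
  by (simp add: swap_def)

lemma split_at:
  assumes "Suc p < length l"
  obtains xs a b ys where "l = xs @ a # b # ys" "length xs = p"
proof
  show "l = take p l @ l ! p # l ! Suc p # drop (Suc (Suc p)) l"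
    using assms by (simp add: Cons_nth_drop_Suc)
qed (use assms in simp)

lemma Rop_append:
  assumes "length xs = p"
  shows "Rop sc q p f (xs @ a # b # ys) = sc (rho q a b) (f (xs @ b # a # ys)) + sc (nuH q a b) (f (xs @ a # b # ys))"
  using assms[symmetric] by (simp add: Rop_def nth_append)

lemma swap_in_idx_lists: "l \<in> idx_lists n m \<Longrightarrow> Suc p < m \<Longrightarrow> swap p l \<in> idx_lists n m"
  by (auto simp: idx_lists_def elim!: split_at[of p l])

lemma mset_swap_Suc: "Suc p < length l \<Longrightarrow> mset (swap p l) = mset l"
  by (elim split_at[of p l]) auto

lemma bij_swap: "Suc p < m \<Longrightarrow> bij_betw (swap p) (idx_lists n m) (idx_lists n m)"
proof (rule bij_betw_byWitness[where f' = "swap p"])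
  assume p: "Suc p < m"
  have "swap p (swap p l) = l" if "length l = m" for l :: "nat list"
    using p that by (auto elim!: split_at[of p l])
  then show "\<forall>l\<in>idx_lists n m. swap p (swap p l) = l" "\<forall>l\<in>idx_lists n m. swap p (swap p l) = l"
    by (auto simp: idx_lists_def)
qed (auto simp: swap_in_idx_lists)

lemma sum_idx_lists_Suc:
  "sum f (idx_lists n (Suc m)) = (\<Sum>c = 1..n. \<Sum>l \<in> idx_lists n m. f (c # l))"
proof -
  have "bij_betw (\<lambda>(c, l). c # l) ({1..n} \<times> idx_lists n m) (idx_lists n (Suc m))"
    by (rule bij_betw_byWitness[where f' = "\<lambda>l. (hd l, tl l)"])
      (auto simp: idx_lists_def length_Suc_conv)
  from sum.reindex_bij_betw[OF this, of f] show ?thesis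
    by (simp add: sum.cartesian_product case_prod_beta)
qed

lemma sum_idx_lists_snoc:
  "sum f (idx_lists n (Suc m)) = (\<Sum>l \<in> idx_lists n m. \<Sum>c = 1..n. f (l @ [c]))"
proof -
  have "bij_betw (\<lambda>(l, c). l @ [c]) (idx_lists n m \<times> {1..n}) (idx_lists n (Suc m))"
    by (rule bij_betw_byWitness[where f' = "\<lambda>l. (butlast l, last l)"])
      (auto simp: idx_lists_def length_Suc_conv_rev)
  from sum.reindex_bij_betw[OF this, of f] show ?thesis
    by (simp add: sum.cartesian_product case_prod_beta)
qed

section \<open>Inversions and the q-antisymmetric tensor\<close>

fun invs :: "nat list \<Rightarrow> nat"
  where "invs [] = 0" | "invs (x # xs) = length (filter (\<lambda>y. y < x) xs) + invs xs"

definition sgn_q :: "real \<Rightarrow> nat list \<Rightarrow> complex"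
  where "sgn_q q l = (if distinct l then (- of_real q) ^ invs l else 0)"

lemma invs_swap: "a < b \<Longrightarrow> invs (xs @ b # a # ys) = Suc (invs (xs @ a # b # ys))"
  by (induction xs) auto

lemma sgn_q_upt [simp]: "sgn_q q [a..<b] = 1"
proof -
  have "invs [a..<b] = 0"
    by (induction "b - a" arbitrary: a) (auto simp: upt_conv_Cons)
  then show ?thesis by (simp add: sgn_q_def)
qed

lemma sgn_q_equal [simp]: "sgn_q q (xs @ a # a # ys) = 0"
  by (simp add: sgn_q_def)

lemma sgn_q_swap: "a < b \<Longrightarrow> sgn_q q (xs @ b # a # ys) = - of_real q * sgn_q q (xs @ a # b # ys)"
proof -
  assume "a < b"
  moreover have "distinct (xs @ b # a # ys) = distinct (xs @ a # b # ys)" by auto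
  ultimately show ?thesis
    unfolding sgn_q_def by (cases "distinct (xs @ a # b # ys)")
      (simp_all only: invs_swap power_Suc mult_zero_right if_True if_False)
qed

text \<open>For letters a < b the eigenvalue arises as -q + nu = -1/q, for a > b as the inverse of
  the swap factor -q; for equal letters both sides are 0.\<close>

lemma Rop_sgn_q:
  assumes "Suc p < length l" "q \<noteq> 0"
  shows "Rop (*) q p (sgn_q q) l = - inverse (of_real q) * sgn_q q l"
  using assms(1)
proof (rule split_at)
  fix xs a b ys assume l: "l = xs @ a # b # ys" "length xs = p"
  have q: "complex_of_real q * inverse (of_real q) = 1" "inverse (of_real q) * complex_of_real q = 1"
    using assms(2) by simp_all
  consider "a = b" | "a < b" | "b < a" by linarith
  then show ?thesis
  proof cases
    case 2
    then show ?thesis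
      by (simp add: l Rop_append rho_def nuH_def sgn_q_swap left_diff_distrib)
  next
    case 3
    then show ?thesis
      using q by (simp add: l Rop_append rho_def nuH_def sgn_q_swap)
  qed (simp add: l Rop_append)
qed

lemma set_distinct_idx_list:
  assumes "l \<in> idx_lists n n" "distinct l"
  shows "set l = {1..n}"
proof (rule card_subset_eq)
  show "set l \<subseteq> {1..n}" "card (set l) = card {1..n}"
    using assms distinct_card[of l] by (simp_all add: idx_lists_def)
qed simp

lemma sorted_idx_list:
  assumes "l \<in> idx_lists n n" "sorted_wrt (<) l"
  shows "l = [1..<Suc n]"
proof (rule sorted_distinct_set_unique)
  show "sorted l" "distinct l" using assms(2) by (simp_all add: strict_sorted_iff)
  then show "set l = set [1..<Suc n]"
    using set_distinct_idx_list[OF assms(1)] by (simp only: set_upt atLeastLessThanSuc_atLeastAtMost)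
qed (rule sorted_upt distinct_upt)+

text \<open>A list without equal or descending neighbours is strictly increasing, which for length n
  over {1..n} leaves only [1..n]. Undoing a descent lowers the number of inversions.\<close>

lemma bubble_sort_induct [consumes 1, case_names sorted equal swap]:
  assumes "l \<in> idx_lists n n" "P [1..<Suc n]"
    and "\<And>xs a ys. xs @ a # a # ys \<in> idx_lists n n \<Longrightarrow> P (xs @ a # a # ys)"
    and "\<And>xs a b ys. a < b \<Longrightarrow> xs @ a # b # ys \<in> idx_lists n n \<Longrightarrow> P (xs @ a # b # ys) \<Longrightarrow> P (xs @ b # a # ys)"
  shows "P l"
  using assms(1)
proof (induction "invs l" arbitrary: l rule: less_induct)
  case less
  show ?case
  proof (cases "\<forall>p. Suc p < length l \<longrightarrow> l ! p < l ! Suc p")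
    case True
    then have "sorted_wrt (<) l" by (simp add: sorted_wrt_iff_nth_Suc_transp)
    with sorted_idx_list[OF less.prems] assms(2) show ?thesis by simp
  next
    case False
    then obtain p where p: "Suc p < length l" "\<not> l ! p < l ! Suc p" by auto
    from p(1) obtain xs b a ys where l: "l = xs @ b # a # ys" "length xs = p"
      by (rule split_at)
    show ?thesis
    proof (cases "a = b")
      case True
      then show ?thesis using assms(3) less.prems l by simp
    next
      case False
      then have "a < b" using p(2) by (simp add: l(1) nth_append flip: l(2))
      moreover have "xs @ a # b # ys \<in> idx_lists n n"
        using less.prems by (simp add: l(1) idx_lists_def)
      ultimately show ?thesis
        using less.hyps[of "xs @ a # b # ys"] assms(4) by (simp add: l(1) invs_swap)
    qed
  qed
qed

text \<open>The composite $\hat R_{m-1} \cdots \hat R_0$, which moves the first tensor factor to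
  position \<open>m\<close>.\<close>

fun Zop :: "(complex \<Rightarrow> 'v \<Rightarrow> 'v::ab_group_add) \<Rightarrow> real \<Rightarrow> nat \<Rightarrow> (nat list \<Rightarrow> 'v) \<Rightarrow> nat list \<Rightarrow> 'v"
  where "Zop sc q 0 f = f" | "Zop sc q (Suc m) f = Rop sc q m (Zop sc q m f)"

lemma Rop_cong: "(\<And>l'. length l' = length l \<Longrightarrow> f l' = g l') \<Longrightarrow> Rop sc q p f l = Rop sc q p g l"
  by (simp add: Rop_def)

lemma Zop_cong:
  "(\<And>l'. length l' = length l \<Longrightarrow> f l' = g l') \<Longrightarrow> Zop sc q p f l = Zop sc q p g l"
proof (induction p arbitrary: l)
  case (Suc p)
  show ?case by (simp, rule Rop_cong, rule Suc.IH) (simp add: Suc.prems)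
qed simp

section \<open>The braid relation and the transport of a letter\<close>

lemma split_at3:
  assumes "Suc (Suc p) < length l"
  obtains xs a b c ys where "l = xs @ a # b # c # ys" "length xs = p"
proof
  show "l = take p l @ l ! p # l ! Suc p # l ! Suc (Suc p) # drop (Suc (Suc (Suc p))) l"
    using assms by (simp add: Cons_nth_drop_Suc)
qed (use assms in simp)

lemma Rop_append':
  assumes "length xs = p"
  shows "Rop sc q (Suc p) f (xs @ c # a # b # ys) = sc (rho q a b) (f (xs @ c # b # a # ys)) + sc (nuH q a b) (f (xs @ c # a # b # ys))"
  using Rop_append[of "xs @ [c]" "Suc p"] assms by simp

text \<open>A case check on the relative order of the three letters; the only scalar identity that
  enters is the Hecke relation q^2 = 1 + nu q.\<close>

lemma Rop_braid:
  assumes "Suc (Suc p) < length l" "q \<noteq> 0"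
  shows "Rop (*) q p (Rop (*) q (Suc p) (Rop (*) q p f)) l =
    Rop (*) q (Suc p) (Rop (*) q p (Rop (*) q (Suc p) f)) l"
  using assms(1)
proof (rule split_at3)
  fix xs a b c ys assume l: "l = xs @ a # b # c # ys" "length xs = p"
  define v h :: complex where "v = of_real (q - inverse q)" and "h = of_real q"
  have rho: "rho q x y = (if x = y then h else 1)" and nuH: "nuH q x y = (if x < y then v else 0)" for x y
    by (simp_all add: rho_def nuH_def v_def h_def)
  have hv: "h * h = 1 + v * h"
    using assms(2) by (simp add: v_def h_def left_diff_distrib)
  have hv': "h * (h * x) = x + v * (h * x)" for x
    by (simp add: mult.assoc[symmetric] hv distrib_right)
  have "a = b \<or> a < b \<or> b < a" "b = c \<or> b < c \<or> c < b" "a = c \<or> a < c \<or> c < a"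
    by linarith+
  then show ?thesis
    unfolding l(1)
    by (elim disjE) (simp_all add: l(2) Rop_append Rop_append' rho nuH algebra_simps hv hv')
qed

lemma swap_commute:
  assumes "Suc p < p'" "Suc p' < length l"
  shows "swap p (swap p' l) = swap p' (swap p l)"
  using assms by (intro nth_equalityI) (auto simp: swap_def nth_list_update)

lemma Rop_commute:
  assumes "Suc p < p'" "Suc p' < length l"
  shows "Rop (*) q p (Rop (*) q p' f) l = Rop (*) q p' (Rop (*) q p f) l"
proof -
  have "swap p l ! p' = l ! p'" "swap p l ! Suc p' = l ! Suc p'"
    "swap p' l ! p = l ! p" "swap p' l ! Suc p = l ! Suc p"
    using assms by (auto simp: swap_def nth_list_update)
  then show ?thesis
    using swap_commute[OF assms] by (simp add: Rop_def algebra_simps)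
qed

lemma Rop_Zop_commute:
  assumes "m < p" "Suc p < length l"
  shows "Rop (*) q p (Zop (*) q m f) l = Zop (*) q m (Rop (*) q p f) l"
  using assms
proof (induction m arbitrary: l)
  case (Suc m)
  have "Rop (*) q p (Zop (*) q (Suc m) f) l = Rop (*) q m (Rop (*) q p (Zop (*) q m f)) l"
    unfolding Zop.simps using Suc.prems by (intro Rop_commute[symmetric]) auto
  also have "\<dots> = Rop (*) q m (Zop (*) q m (Rop (*) q p f)) l"
    using Suc by (intro Rop_cong Suc.IH) auto
  finally show ?case by simp
qed simp

text \<open>R_p commutes with the factors of index above p + 1, the braid relation turns R_p R_{p+1}
  R_p into R_{p+1} R_p R_{p+1}, and R_{p+1} commutes with the remaining factors. The index rises
  because position p after the transport is position p + 1 before it.\<close>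

lemma Rop_Zop:
  assumes "Suc p < m" "m < length l" "q \<noteq> 0"
  shows "Rop (*) q p (Zop (*) q m f) l = Zop (*) q m (Rop (*) q (Suc p) f) l"
  using assms(1,2)
proof (induction m arbitrary: l)
  case (Suc m)
  show ?case
  proof (cases "Suc p = m")
    case True
    have "Rop (*) q p (Zop (*) q (Suc m) f) l = Rop (*) q p (Rop (*) q (Suc p) (Rop (*) q p (Zop (*) q p f))) l"
      by (simp flip: True)
    also have "\<dots> = Rop (*) q (Suc p) (Rop (*) q p (Rop (*) q (Suc p) (Zop (*) q p f))) l"
      using Suc.prems assms(3) by (intro Rop_braid) (auto simp flip: True)
    also have "\<dots> = Rop (*) q (Suc p) (Rop (*) q p (Zop (*) q p (Rop (*) q (Suc p) f))) l"
      using Suc.prems by (intro Rop_cong Rop_Zop_commute) auto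
    finally show ?thesis by (simp flip: True)
  next
    case False
    then have "Rop (*) q p (Zop (*) q (Suc m) f) l = Rop (*) q m (Rop (*) q p (Zop (*) q m f)) l"
      unfolding Zop.simps using Suc.prems by (intro Rop_commute) auto
    also have "\<dots> = Rop (*) q m (Zop (*) q m (Rop (*) q (Suc p) f)) l"
      using Suc False by (intro Rop_cong Suc.IH) auto
    finally show ?thesis by simp
  qed
qed simp

lemma Zop_scale: "Zop (*) q m (\<lambda>l. c * f l) l = c * Zop (*) q m f l"
proof (induction m arbitrary: l)
  case (Suc m)
  have "Zop (*) q m (\<lambda>l. c * f l) = (\<lambda>l. c * Zop (*) q m f l)" using Suc by blast
  then show ?case by (simp add: Rop_def algebra_simps)
qed simp

text \<open>The operators only swap or keep letters, so a coordinate of the result depends only on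
  the values of \<open>f\<close> at rearrangements of \<open>l\<close>.\<close>

lemma Zop_content:
  assumes "m < length l" "\<And>l'. mset l' = mset l \<Longrightarrow> f l' = 0"
  shows "Zop (*) q m f l = 0"
  using assms
proof (induction m arbitrary: l)
  case (Suc m)
  have "Zop (*) q m f l = 0" "Zop (*) q m f (swap m l) = 0"
    using Suc by (auto simp: mset_swap_Suc)
  then show ?case by (simp add: Rop_def)
qed simp

text \<open>The coordinates of \<open>e\<^sub>j \<otimes> \<epsilon>\<close> and \<open>\<epsilon> \<otimes> e\<^sub>j\<close>, where \<open>\<epsilon>\<close> is the $q$-antisymmetric
  tensor \<open>sgn_q\<close>.\<close>

definition sgn_pre :: "real \<Rightarrow> nat \<Rightarrow> nat list \<Rightarrow> complex"
  where "sgn_pre q j l = (if hd l = j then sgn_q q (tl l) else 0)"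

definition sgn_post :: "real \<Rightarrow> nat \<Rightarrow> nat list \<Rightarrow> complex"
  where "sgn_post q j l = (if last l = j then sgn_q q (butlast l) else 0)"

text \<open>While it is moved to the right, the letter \<open>c\<close> can only be replaced by a larger one.\<close>

lemma Zop_sgn_pre_le:
  assumes "length s = m" "c \<le> j"
  shows "Zop (*) q m (sgn_pre q j) (s @ c # t) =
    (if c = j then of_real q ^ count_list s j * sgn_q q (s @ t) else 0)"
  using assms
proof (induction m arbitrary: s c t)
  case 0
  then show ?case by (simp add: sgn_pre_def)
next
  case (Suc m)
  then obtain s' a where s: "s = s' @ [a]" "length s' = m"
    by (metis length_Suc_conv_rev)
  show ?case
    using Suc.IH[OF s(2), of c "a # t"] Suc.IH[OF s(2), of a "c # t"] Suc.prems(2)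
    by (auto simp: s Rop_append rho_def nuH_def)
qed

text \<open>The common eigenvectors for -1/q form a line: equal neighbours give (q + 1/q) f = 0 with
  q + 1/q > 0, and creating a descent multiplies the value by -q.\<close>

lemma sgn_q_unique:
  fixes f :: "nat list \<Rightarrow> complex"
  assumes "l \<in> idx_lists n n" "q > 0"
    and "\<And>p l. l \<in> idx_lists n n \<Longrightarrow> Suc p < n \<Longrightarrow> Rop (*) q p f l = - inverse (of_real q) * f l"
  shows "f l = sgn_q q l * f [1..<Suc n]"
  using assms(1)
proof (induction rule: bubble_sort_induct)
  case sorted
  show ?case by (simp del: upt_Suc)
next
  case (equal xs a ys)
  then have "Rop (*) q (length xs) f (xs @ a # a # ys) = - inverse (of_real q) * f (xs @ a # a # ys)"
    by (intro assms(3)) (auto simp: idx_lists_def)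
  then have "(of_real q + inverse (of_real q)) * f (xs @ a # a # ys) = 0"
    by (simp add: Rop_append rho_def nuH_def algebra_simps)
  moreover have "of_real q + inverse (of_real q) = (of_real (q + inverse q) :: complex)" by simp
  moreover have "q + inverse q > 0" using assms(2) by (intro add_pos_pos) auto
  ultimately show ?case by (simp add: sgn_q_def del: of_real_add)
next
  case (swap xs a b ys)
  then have "Rop (*) q (length xs) f (xs @ a # b # ys) = - inverse (of_real q) * f (xs @ a # b # ys)"
    by (intro assms(3)) (auto simp: idx_lists_def)
  then have "f (xs @ b # a # ys) = - of_real q * f (xs @ a # b # ys)"
    using swap(1) by (simp add: Rop_append rho_def nuH_def algebra_simps add_eq_0_iff)
  with swap show ?case
    by (simp add: sgn_q_swap)
qed

text \<open>If the last letter c is j, then j has crossed a permutation, which contains it once and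
  contributes one factor q. Otherwise the coordinates in the first n letters are q-antisymmetric by
  \<open>Rop_Zop\<close>, hence determined by the value at [1..n]; it vanishes, because removing a
  leading j from a rearrangement of [1..n] @ [c] leaves the letter c twice.\<close>

lemma Zop_sgn_pre:
  assumes "l \<in> idx_lists n (Suc n)" "j \<in> {1..n}" "q > 0"
  shows "Zop (*) q n (sgn_pre q j) l = of_real q * sgn_post q j l"
proof -
  obtain s c where l: "l = s @ [c]" "s \<in> idx_lists n n" "c \<in> {1..n}"
    using assms(1) by (cases l rule: rev_cases) (auto simp: idx_lists_def)
  show ?thesis
  proof (cases "c = j")
    case True
    have "count_list s j = 1" if "sgn_q q s \<noteq> 0"
    proof -
      have "distinct s" "set s = {1..n}"
        using that set_distinct_idx_list[OF l(2)] by (auto simp: sgn_q_def split: if_splits)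
      then have "j \<in> set s" using assms(2) by simp
      with \<open>distinct s\<close> show ?thesis by (induction s) auto
    qed
    then show ?thesis
      using Zop_sgn_pre_le[of s n c j q "[]"] l True
      by (cases "sgn_q q s = 0") (auto simp: sgn_post_def idx_lists_def)
  next
    case False
    define f where "f s = Zop (*) q n (sgn_pre q j) (s @ [c])" for s
    have "Rop (*) q p f l = - inverse (of_real q) * f l" if "l \<in> idx_lists n n" "Suc p < n" for p l
    proof -
      have "Rop (*) q p f l = Rop (*) q p (Zop (*) q n (sgn_pre q j)) (l @ [c])"
        using that by (auto simp: idx_lists_def f_def Rop_append elim!: split_at[of p l])
      also have "\<dots> = Zop (*) q n (Rop (*) q (Suc p) (sgn_pre q j)) (l @ [c])"
        using that assms by (intro Rop_Zop) (auto simp: idx_lists_def)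
      also have "\<dots> = Zop (*) q n (\<lambda>l. - inverse (of_real q) * sgn_pre q j l) (l @ [c])"
      proof (rule Zop_cong)
        fix l' :: "nat list" assume "length l' = length (l @ [c])"
        then obtain a l'' where l': "l' = a # l''" "length l'' = length l"
          by (cases l') auto
        then show "Rop (*) q (Suc p) (sgn_pre q j) l' = - inverse (of_real q) * sgn_pre q j l'"
          using Rop_sgn_q[of p l'' q] that assms(3)
          by (auto simp: Rop_def sgn_pre_def swap_def idx_lists_def)
      qed
      also have "\<dots> = - inverse (of_real q) * f l"
        unfolding Zop_scale by (simp add: f_def)
      finally show ?thesis .
    qed
    from sgn_q_unique[OF l(2) assms(3) this] have "f s = sgn_q q s * f [1..<Suc n]" .
    moreover have "f [1..<Suc n] = 0"
      unfolding f_def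
    proof (rule Zop_content)
      fix l' :: "nat list" assume l': "mset l' = mset ([1..<Suc n] @ [c])"
      show "sgn_pre q j l' = 0"
      proof (rule ccontr)
        assume "sgn_pre q j l' \<noteq> 0"
        then have d: "hd l' = j" "distinct (tl l')"
          by (auto simp: sgn_pre_def sgn_q_def split: if_splits)
        have "l' \<noteq> []" using l' by auto
        then have "count (mset l') c = count (mset (tl l')) c"
          using d(1) False by (cases l') auto
        also have "\<dots> \<le> 1" using d(2) by (simp add: distinct_count_atmost_1)
        finally show False using l(3) l' by (simp del: upt_Suc add: distinct_count_atmost_1)
      qed
    qed simp
    ultimately show ?thesis
      using False by (simp add: f_def l sgn_post_def)
  qed
qed

text \<open>The defining relation with its sums carried out. The row indices \<open>a\<close>,
  \<open>c\<close> are listed before the column indices \<open>b\<close>, \<open>d\<close>.\<close>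

definition rtt_rel :: "real \<Rightarrow> (nat \<Rightarrow> nat \<Rightarrow> 'x falg) \<Rightarrow> nat \<Rightarrow> nat \<Rightarrow> nat \<Rightarrow> nat \<Rightarrow> 'x falg"
  where "rtt_rel q U a c b d = scal (rho q a c) (U c b * U a d) + scal (nuH q a c) (U a b * U c d)
    - (scal (rho q b d) (U a d * U c b) + scal (nuH q b d) (U a b * U c d))"

lemma rtt_rels_eq: "rtt_rels n q U =
  {rtt_rel q U a c b d | a b c d. a \<in> {1..n} \<and> b \<in> {1..n} \<and> c \<in> {1..n} \<and> d \<in> {1..n}}"
proof -
  have "(\<Sum>w = 1..n. \<Sum>x = 1..n. scal (of_real (Rm q (a, c) (w, x))) (U w b * U x d))
      - (\<Sum>y = 1..n. \<Sum>z = 1..n. scal (of_real (Rm q (y, z) (b, d))) (U a y * U c z)) = rtt_rel q U a c b d"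
    if "a \<in> {1..n}" "b \<in> {1..n}" "c \<in> {1..n}" "d \<in> {1..n}" for a b c d
    unfolding Rm_sym[of q _ _ b d] rtt_rel_def
    by (simp only: sum_Rm[OF that(1,3)] sum_Rm[OF that(2,4)])
  then show ?thesis
    unfolding rtt_rels_def by (simp only: cong: rev_conj_cong)
qed

section \<open>The determinant as a sum over index lists\<close>

definition monom :: "(nat \<Rightarrow> nat \<Rightarrow> 'x falg) \<Rightarrow> nat list \<Rightarrow> nat list \<Rightarrow> 'x falg"
  where "monom U k l = prod_list (map2 U k l)"

lemma monom_Nil [simp]: "monom U [] [] = 1"
  and monom_Cons [simp]: "monom U (i # k) (j # l) = U i j * monom U k l"
  by (simp_all add: monom_def)

lemma monom_append [simp]: "length k = length l \<Longrightarrow> monom U (k @ k') (l @ l') = monom U k l * monom U k' l'"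
  by (simp add: monom_def)

lemma invs_conv_card: "invs l = card {(i, j). i < j \<and> j < length l \<and> l ! j < l ! i}"
proof (induction l)
  case (Cons x xs)
  let ?S = "{(i, j). i < j \<and> j < length xs \<and> xs ! j < xs ! i}"
  let ?F = "{j. j < length xs \<and> xs ! j < x}"
  have "{(i, j). i < j \<and> j < length (x # xs) \<and> (x # xs) ! j < (x # xs) ! i} =
    (\<lambda>j. (0, Suc j)) ` ?F \<union> (\<lambda>(i, j). (Suc i, Suc j)) ` ?S"
    (is "?L = ?R")
  proof
    show "?R \<subseteq> ?L" by auto
    show "?L \<subseteq> ?R"
    proof safe
      fix i j assume *: "(i, j) \<notin> (\<lambda>(i, j). (Suc i, Suc j)) ` ?S" "i < j" "j < length (x # xs)" "(x # xs) ! j < (x # xs) ! i"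
      obtain j' where j: "j = Suc j'" using *(2) by (cases j) auto
      show "(i, j) \<in> (\<lambda>j. (0, Suc j)) ` ?F"
        using * by (cases i) (auto simp: j image_iff)
    qed
  qed
  moreover have "finite ?S" by (rule finite_subset[of _ "{..<length xs} \<times> {..<length xs}"]) auto
  moreover have "card ((\<lambda>j. (0::nat, Suc j)) ` ?F) = card ?F" by (intro card_image inj_onI) auto
  moreover have "card ((\<lambda>(i, j). (Suc i, Suc j)) ` ?S) = card ?S" by (intro card_image inj_onI) auto
  moreover have "card ?F = length (filter (\<lambda>y. y < x) xs)" by (simp add: length_filter_conv_card)
  moreover have "card ((\<lambda>j. (0::nat, Suc j)) ` ?F \<union> (\<lambda>(i, j). (Suc i, Suc j)) ` ?S) =
    card ((\<lambda>j. (0::nat, Suc j)) ` ?F) + card ((\<lambda>(i, j). (Suc i, Suc j)) ` ?S)"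
    using \<open>finite ?S\<close> by (intro card_Un_disjoint) auto
  ultimately show ?case
    using Cons.IH by (simp only: invs.simps)
qed simp

lemma perm_length_conv_invs: "perm_length n \<pi> = invs (map \<pi> [1..<Suc n])"
proof -
  let ?S = "{(i, j). i < j \<and> j < length (map \<pi> [1..<Suc n]) \<and> map \<pi> [1..<Suc n] ! j < map \<pi> [1..<Suc n] ! i}"
  have "{(i, j). 1 \<le> i \<and> i < j \<and> j \<le> n \<and> \<pi> j < \<pi> i} = (\<lambda>(i, j). (Suc i, Suc j)) ` ?S" (is "?L = ?R")
  proof
    show "?R \<subseteq> ?L" by (auto simp del: upt_Suc)
    show "?L \<subseteq> ?R"
    proof safe
      fix i j assume "1 \<le> i" "i < j" "j \<le> n" "\<pi> j < \<pi> i"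
      then show "(i, j) \<in> ?R"
        by (intro image_eqI[of _ _ "(i - 1, j - 1)"]) (auto simp del: upt_Suc)
    qed
  qed
  moreover have "card ((\<lambda>(i, j). (Suc i, Suc j)) ` ?S) = card ?S" by (intro card_image inj_onI) auto
  ultimately show ?thesis
    by (simp add: perm_length_def invs_conv_card)
qed

lemma bij_permutes_idx_lists:
  "bij_betw (\<lambda>\<pi>. map \<pi> [1..<Suc n]) {\<pi>. \<pi> permutes {1..n}} {l \<in> idx_lists n n. distinct l}"
proof (rule bij_betw_byWitness[where f' = "\<lambda>l i. if i \<in> {1..n} then l ! (i - 1) else i"])
  show "\<forall>\<pi>\<in>{\<pi>. \<pi> permutes {1..n}}. (\<lambda>i. if i \<in> {1..n} then map \<pi> [1..<Suc n] ! (i - 1) else i) = \<pi>"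
    by (auto simp: fun_eq_iff permutes_def simp del: upt_Suc)
  show "\<forall>l\<in>{l \<in> idx_lists n n. distinct l}. map (\<lambda>i. if i \<in> {1..n} then l ! (i - 1) else i) [1..<Suc n] = l"
    by (auto simp: idx_lists_def list_eq_iff_nth_eq simp del: upt_Suc)
  show "(\<lambda>\<pi>. map \<pi> [1..<Suc n]) ` {\<pi>. \<pi> permutes {1..n}} \<subseteq> {l \<in> idx_lists n n. distinct l}"
  proof safe
    fix \<pi> assume \<pi>: "\<pi> permutes {1..n}"
    have "set (map \<pi> [1..<Suc n]) = \<pi> ` {1..n}"
      by (simp only: set_map set_upt atLeastLessThanSuc_atLeastAtMost)
    then show "map \<pi> [1..<Suc n] \<in> idx_lists n n"
      using permutes_image[OF \<pi>] by (simp add: idx_lists_def del: upt_Suc)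
    show "distinct (map \<pi> [1..<Suc n])"
      using permutes_inj_on[OF \<pi>] by (simp add: distinct_map del: upt_Suc)
  qed
  show "(\<lambda>l i. if i \<in> {1..n} then l ! (i - 1) else i) ` {l \<in> idx_lists n n. distinct l} \<subseteq> {\<pi>. \<pi> permutes {1..n}}"
  proof safe
    fix l assume l: "l \<in> idx_lists n n" "distinct l"
    let ?f = "\<lambda>i. if i \<in> {1..n} then l ! (i - 1) else i"
    have len: "length l = n" using l(1) by (simp add: idx_lists_def)
    have "?f ` {1..n} = set l"
    proof safe
      fix x assume "x \<in> set l"
      then obtain j where "j < n" "l ! j = x" using len by (auto simp: in_set_conv_nth)
      then show "x \<in> ?f ` {1..n}" by (intro image_eqI[of _ _ "Suc j"]) auto
    qed (use len in auto)
    then have img: "?f ` {1..n} = {1..n}" using set_distinct_idx_list[OF l] by simp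
    have "inj_on ?f {1..n}" by (rule eq_card_imp_inj_on) (simp_all only: img finite_atLeastAtMost)
    then have "bij_betw ?f {1..n} {1..n}" using img by (simp add: bij_betw_def)
    then show "?f permutes {1..n}"
      by (intro bij_imp_permutes) auto
  qed
qed

lemma monom_map: "monom U k (map \<pi> k) = prod_list (map (\<lambda>i. U i (\<pi> i)) k)"
  by (induction k) simp_all

text \<open>\<open>sgn_q\<close> is 0 on lists with repetitions, so the sum over permutations may
  run over all lists; this makes the determinant a coordinate of a coaction.\<close>

lemma qdet_conv: "qdet n q U = (\<Sum>l \<in> idx_lists n n. scal (sgn_q q l) (monom U [1..<Suc n] l))"
proof -
  have "qdet n q U = (\<Sum>\<pi> | \<pi> permutes {1..n}. scal (sgn_q q (map \<pi> [1..<Suc n]))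
    (monom U [1..<Suc n] (map \<pi> [1..<Suc n])))"
    unfolding qdet_def
  proof (rule sum.cong)
    fix \<pi> assume "\<pi> \<in> {\<pi>. \<pi> permutes {1..n}}"
    then have "distinct (map \<pi> [1..<Suc n])"
      using bij_permutes_idx_lists[of n] by (auto simp: bij_betw_def simp del: upt_Suc)
    then show "scal ((- of_real q) ^ perm_length n \<pi>) (prod_list (map (\<lambda>i. U i (\<pi> i)) [1..<Suc n])) =
      scal (sgn_q q (map \<pi> [1..<Suc n])) (monom U [1..<Suc n] (map \<pi> [1..<Suc n]))"
      by (simp add: sgn_q_def monom_map perm_length_conv_invs del: upt_Suc)
  qed simp
  also have "\<dots> = (\<Sum>l \<in> {l \<in> idx_lists n n. distinct l}. scal (sgn_q q l) (monom U [1..<Suc n] l))"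
    by (rule sum.reindex_bij_betw[OF bij_permutes_idx_lists])
  also have "\<dots> = (\<Sum>l \<in> idx_lists n n. scal (sgn_q q l) (monom U [1..<Suc n] l))"
    by (rule sum.mono_neutral_left) (auto simp: sgn_q_def)
  finally show ?thesis .
qed

text \<open>Only the relations of the matrix \<open>U\<close> matter here, so the locale serves
  C_q[SU_N] as well as C_q[U_n], where the inverse determinant is an additional generator.\<close>

locale rtt_matrix = alg_ideal A I for A I :: "'x falg set" +
  fixes n :: nat and q :: real and U :: "nat \<Rightarrow> nat \<Rightarrow> 'x falg"
  assumes q_pos: "0 < q"
    and U_A: "i \<in> {1..n} \<Longrightarrow> j \<in> {1..n} \<Longrightarrow> U i j \<in> A"
    and rels_I: "rtt_rels n q U \<subseteq> I"
begin

lemma rtt: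
  assumes "a \<in> {1..n}" "b \<in> {1..n}" "c \<in> {1..n}" "d \<in> {1..n}"
  shows "scal (rho q a c) (U c b * U a d) + scal (nuH q a c) (U a b * U c d)
    \<approx> scal (rho q b d) (U a d * U c b) + scal (nuH q b d) (U a b * U c d)"
proof -
  have "rtt_rel q U a c b d \<in> rtt_rels n q U"
    unfolding rtt_rels_eq using assms by blast
  then have "rtt_rel q U a c b d \<in> I" using rels_I by blast
  then show ?thesis using assms by (auto simp: cg_def rtt_rel_def intro!: A_closed U_A)
qed

lemma monom_A:
  assumes "k \<in> idx_lists n m" "l \<in> idx_lists n m"
  shows "monom U k l \<in> A"
  unfolding monom_def
proof (rule A_prod_list, rule subsetI)
  fix x assume "x \<in> set (map2 U k l)"
  then obtain i j where ij: "(i, j) \<in> set (zip k l)" "x = U i j" by auto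
  then have "i \<in> set k" "j \<in> set l" by (auto dest: set_zip_leftD set_zip_rightD)
  then show "x \<in> A"
    using assms unfolding ij(2) idx_lists_def by (intro U_A) blast+
qed

text \<open>The defining relation, multiplied by monomials on both sides: R on the row indices of a
  monomial agrees with R on its column indices.\<close>

lemma rtt_Rop:
  assumes "k \<in> idx_lists n m" "l \<in> idx_lists n m" "Suc p < m"
  shows "Rop scal q p (\<lambda>k. monom U k l) k \<approx> Rop scal q p (monom U k) l"
proof -
  have "Suc p < length k" "Suc p < length l" using assms by (simp_all add: idx_lists_def)
  then obtain k1 a c k2 l1 b d l2 where
    kl: "k = k1 @ a # c # k2" "length k1 = p" "l = l1 @ b # d # l2" "length l1 = p"
    by (metis split_at)
  have in_range: "a \<in> {1..n}" "b \<in> {1..n}" "c \<in> {1..n}" "d \<in> {1..n}"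
    "k1 \<in> idx_lists n p" "l1 \<in> idx_lists n p" "k2 \<in> idx_lists n (m - p - 2)" "l2 \<in> idx_lists n (m - p - 2)"
    using assms kl by (auto simp: idx_lists_def)
  have "monom U k1 l1 * (scal (rho q a c) (U c b * U a d) + scal (nuH q a c) (U a b * U c d)) * monom U k2 l2
    \<approx> monom U k1 l1 * (scal (rho q b d) (U a d * U c b) + scal (nuH q b d) (U a b * U c d)) * monom U k2 l2"
    using in_range by (intro cg_mult cg_refl monom_A rtt)
  then show ?thesis
    using kl by (simp add: Rop_append distrib_left distrib_right mult.assoc)
qed

text \<open>The coordinates of the image of the tensor \<open>g\<close> under the matrix coaction on
  the \<open>m\<close>-th tensor power.\<close>

definition coact :: "nat \<Rightarrow> (nat list \<Rightarrow> complex) \<Rightarrow> nat list \<Rightarrow> 'x falg"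
  where "coact m g k = (\<Sum>l \<in> idx_lists n m. scal (g l) (monom U k l))"

lemma coact_A: "k \<in> idx_lists n m \<Longrightarrow> coact m g k \<in> A"
  unfolding coact_def by (intro A_sum A_scal monom_A)

text \<open>After \<open>rtt_Rop\<close> the operator sits on the summation index; substituting the
  swapped list moves it onto \<open>g\<close>, because R is a symmetric matrix.\<close>

lemma coact_Rop:
  assumes "k \<in> idx_lists n m" "Suc p < m"
  shows "Rop scal q p (coact m g) k \<approx> coact m (Rop (*) q p g) k"
proof -
  have len: "length l = m" if "l \<in> idx_lists n m" for l
    using that by (simp add: idx_lists_def)
  have swap_nth: "swap p l ! p = l ! Suc p" "swap p l ! Suc p = l ! p" "swap p (swap p l) = l"
    if "l \<in> idx_lists n m" for l
    using assms(2) len[OF that] by (auto simp: swap_def nth_list_update intro!: nth_equalityI)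
  have "Rop scal q p (coact m g) k = (\<Sum>l \<in> idx_lists n m. scal (g l) (Rop scal q p (\<lambda>k. monom U k l) k))"
    by (simp add: Rop_def coact_def cvec.scale_sum_right sum.distrib cvec.scale_right_distrib mult.commute)
  also have "\<dots> \<approx> (\<Sum>l \<in> idx_lists n m. scal (g l) (Rop scal q p (monom U k) l))"
    using assms by (intro cg_sum cg_scal rtt_Rop)
  also have "\<dots> = (\<Sum>l \<in> idx_lists n m. scal (g l * rho q (l ! p) (l ! Suc p)) (monom U k (swap p l)))
      + (\<Sum>l \<in> idx_lists n m. scal (g l * nuH q (l ! p) (l ! Suc p)) (monom U k l))"
    by (simp add: Rop_def sum.distrib cvec.scale_right_distrib)
  also have "(\<Sum>l \<in> idx_lists n m. scal (g l * rho q (l ! p) (l ! Suc p)) (monom U k (swap p l)))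
    = (\<Sum>l \<in> idx_lists n m. scal (g (swap p l) * rho q (swap p l ! p) (swap p l ! Suc p)) (monom U k (swap p (swap p l))))"
    by (rule sum.reindex_bij_betw[OF bij_swap[OF assms(2)], symmetric])
  also have "\<dots> = (\<Sum>l \<in> idx_lists n m. scal (g (swap p l) * rho q (l ! p) (l ! Suc p)) (monom U k l))"
    by (intro sum.cong refl) (simp add: swap_nth rho_commute)
  finally show ?thesis
    by (simp add: coact_def Rop_def cvec.scale_left_distrib sum.distrib mult.commute)
qed

lemma Rop_in_A:
  assumes "\<And>k. k \<in> idx_lists n m \<Longrightarrow> f k \<approx> g k" "k \<in> idx_lists n m" "Suc p < m"
  shows "Rop scal q p f k \<approx> Rop scal q p g k"
  unfolding Rop_def using assms by (intro cg_add cg_scal) (auto intro: swap_in_idx_lists)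

lemma Zop_cg:
  assumes "\<And>k. k \<in> idx_lists n m \<Longrightarrow> f k \<approx> g k" "k \<in> idx_lists n m" "p < m"
  shows "Zop scal q p f k \<approx> Zop scal q p g k"
  using assms(2,3)
proof (induction p arbitrary: k)
  case (Suc p)
  then show ?case unfolding Zop.simps by (intro Rop_in_A) auto
qed (simp add: assms(1))

lemma coact_Zop:
  assumes "k \<in> idx_lists n m" "p < m"
  shows "Zop scal q p (coact m g) k \<approx> coact m (Zop (*) q p g) k"
  using assms
proof (induction p arbitrary: k)
  case 0
  then show ?case by (simp add: cg_refl coact_A)
next
  case (Suc p)
  have "Zop scal q (Suc p) (coact m g) k \<approx> Rop scal q p (coact m (Zop (*) q p g)) k"
    unfolding Zop.simps using Suc by (intro Rop_in_A) auto
  also have "\<dots> \<approx> coact m (Zop (*) q (Suc p) g) k"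
    unfolding Zop.simps using Suc.prems by (intro coact_Rop)
  finally show ?case .
qed

abbreviation det :: "'x falg"
  where "det \<equiv> qdet n q U"

lemma det_eq: "det = coact n (sgn_q q) [1..<Suc n]"
  by (simp only: qdet_conv coact_def)

lemma iota_idx_list: "[1..<Suc n] \<in> idx_lists n n"
  by (auto simp: idx_lists_def)

lemma det_A: "det \<in> A"
  unfolding det_eq by (intro coact_A iota_idx_list)

lemma cg_scal_cancel:
  assumes "scal c x \<approx> scal c y" "c \<noteq> 0" shows "x \<approx> y"
  using cg_scal[OF assms(1), of "inverse c"] assms(2) by simp

text \<open>The tensor \<open>coact n (sgn_q q)\<close> is $q$-antisymmetric, hence a multiple of \<open>sgn_q q\<close>.\<close>

lemma coact_sgn_q:
  assumes "k \<in> idx_lists n n"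
  shows "coact n (sgn_q q) k \<approx> scal (sgn_q q k) det"
  using assms
proof (induction rule: bubble_sort_induct)
  case sorted
  show ?case
    using cg_refl[OF coact_A[OF iota_idx_list]] by (simp add: det_eq del: upt_Suc)
next
  case (equal xs a ys)
  let ?f = "coact n (sgn_q q)"
  have "Rop scal q (length xs) ?f (xs @ a # a # ys) \<approx> coact n (Rop (*) q (length xs) (sgn_q q)) (xs @ a # a # ys)"
    using equal by (intro coact_Rop) (auto simp: idx_lists_def)
  also have "\<dots> = scal (- inverse (of_real q)) (?f (xs @ a # a # ys))"
    unfolding coact_def cvec.scale_sum_right
    by (intro sum.cong refl) (use equal q_pos in \<open>auto simp: Rop_sgn_q idx_lists_def\<close>)
  finally have "scal (of_real q) (?f (xs @ a # a # ys)) \<approx> scal (- inverse (of_real q)) (?f (xs @ a # a # ys))"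
    by (simp add: Rop_append rho_def nuH_def)
  from cg_add[OF this cg_refl[of "scal (inverse (of_real q)) (?f (xs @ a # a # ys))"]] equal
  have "scal (of_real q + inverse (of_real q)) (?f (xs @ a # a # ys)) \<approx> scal (of_real q + inverse (of_real q)) 0"
    by (simp add: A_scal coact_A flip: cvec.scale_left_distrib)
  moreover have "q + inverse q > 0" using q_pos by (intro add_pos_pos) auto
  then have "complex_of_real q + inverse (of_real q) \<noteq> 0"
    by (metis of_real_add of_real_eq_0_iff of_real_inverse less_irrefl)
  ultimately have "?f (xs @ a # a # ys) \<approx> 0" by (rule cg_scal_cancel)
  then show ?case by simp
next
  case (swap xs a b ys)
  let ?f = "coact n (sgn_q q)"
  have in_idx: "xs @ b # a # ys \<in> idx_lists n n" using swap(2) by (simp add: idx_lists_def)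
  have "Rop scal q (length xs) ?f (xs @ a # b # ys) \<approx> coact n (Rop (*) q (length xs) (sgn_q q)) (xs @ a # b # ys)"
    using swap by (intro coact_Rop) (auto simp: idx_lists_def)
  also have "\<dots> = scal (- inverse (of_real q)) (?f (xs @ a # b # ys))"
    unfolding coact_def cvec.scale_sum_right
    by (intro sum.cong refl) (use swap q_pos in \<open>auto simp: Rop_sgn_q idx_lists_def\<close>)
  finally have "?f (xs @ b # a # ys) + scal (of_real (q - inverse q)) (?f (xs @ a # b # ys))
    \<approx> scal (- inverse (of_real q)) (?f (xs @ a # b # ys))"
    using swap(1) by (simp add: Rop_append rho_def nuH_def)
  moreover have "scal (of_real (q - inverse q)) (?f (xs @ a # b # ys)) \<in> A"
    using swap(2) by (intro A_scal coact_A)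
  ultimately have "?f (xs @ b # a # ys) + scal (of_real (q - inverse q)) (?f (xs @ a # b # ys))
      - scal (of_real (q - inverse q)) (?f (xs @ a # b # ys))
    \<approx> scal (- inverse (of_real q)) (?f (xs @ a # b # ys)) - scal (of_real (q - inverse q)) (?f (xs @ a # b # ys))"
    by (intro cg_diff cg_refl)
  then have "?f (xs @ b # a # ys) \<approx> scal (- of_real q) (?f (xs @ a # b # ys))"
    by (simp add: cvec.scale_left_diff_distrib)
  also have "\<dots> \<approx> scal (- of_real q) (scal (sgn_q q (xs @ a # b # ys)) det)"
    by (rule cg_scal[OF swap(3)])
  finally show ?case using swap(1) by (simp add: sgn_q_swap)
qed

lemma Zop_sum: "Zop scal q p (\<lambda>k. \<Sum>c\<in>C. scal (g c k) (x c)) k = (\<Sum>c\<in>C. scal (Zop (*) q p (g c) k) (x c))"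
proof (induction p arbitrary: k)
  case (Suc p)
  have "Zop scal q p (\<lambda>k. \<Sum>c\<in>C. scal (g c k) (x c)) = (\<lambda>k. \<Sum>c\<in>C. scal (Zop (*) q p (g c) k) (x c))"
    by (rule ext) (rule Suc.IH)
  then show ?case
    by (simp add: Rop_def cvec.scale_sum_right cvec.scale_left_distrib sum.distrib)
qed simp

text \<open>The coordinate at [1..n] @ [i] of the transported coaction on e_j (x) epsilon is
  computed in two ways. Coacting before the transport gives the sum of the u^c_j det with
  coefficient tensors e_c (x) epsilon, of which only q times the term c = i remains; transporting
  before the coaction gives q det u^i_j.\<close>

theorem det_central:
  assumes "i \<in> {1..n}" "j \<in> {1..n}"
  shows "U i j * det \<approx> det * U i j"
proof -
  let ?k = "[1..<Suc n] @ [i]"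
  have k: "?k \<in> idx_lists n (Suc n)" using assms by (auto simp: idx_lists_def)
  have pre: "coact (Suc n) (sgn_pre q j) k \<approx> (\<Sum>c = 1..n. scal (sgn_pre q c k) (U c j * det))"
    if k_in: "k \<in> idx_lists n (Suc n)" for k
  proof -
    obtain c k' where k': "k = c # k'" "c \<in> {1..n}" "k' \<in> idx_lists n n"
      using k_in by (cases k) (auto simp: idx_lists_def)
    have "coact (Suc n) (sgn_pre q j) k = (\<Sum>c' = 1..n. if c' = j then U c j * coact n (sgn_q q) k' else 0)"
      unfolding coact_def sum_idx_lists_Suc
      by (intro sum.cong refl) (auto simp: sgn_pre_def k' sum_distrib_left)
    also have "\<dots> = U c j * coact n (sgn_q q) k'" using assms(2) by simp
    also have "\<dots> \<approx> U c j * scal (sgn_q q k') det"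
      using k' assms by (intro cg_mult cg_refl U_A coact_sgn_q)
    also have "\<dots> = (\<Sum>c' = 1..n. if c' = c then scal (sgn_q q k') (U c' j * det) else 0)"
      using k'(2) by simp
    also have "\<dots> = (\<Sum>c = 1..n. scal (sgn_pre q c k) (U c j * det))"
      by (intro sum.cong refl) (auto simp: sgn_pre_def k')
    finally show ?thesis .
  qed
  have Z: "Zop (*) q n (sgn_pre q c) ?k = (if c = i then of_real q else 0)" if "c \<in> {1..n}" for c
    using Zop_sgn_pre[OF k that q_pos] by (simp add: sgn_post_def del: upt_Suc)
  have "Zop scal q n (coact (Suc n) (sgn_pre q j)) ?k
    \<approx> Zop scal q n (\<lambda>k. \<Sum>c = 1..n. scal (sgn_pre q c k) (U c j * det)) ?k"
    by (rule Zop_cg[OF pre k]) simp_all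
  also have "\<dots> = (\<Sum>c = 1..n. scal (Zop (*) q n (sgn_pre q c) ?k) (U c j * det))"
    by (rule Zop_sum)
  also have "\<dots> = (\<Sum>c = 1..n. if c = i then scal (of_real q) (U c j * det) else 0)"
  proof (intro sum.cong refl)
    fix c assume "c \<in> {1..n}"
    show "scal (Zop (*) q n (sgn_pre q c) ?k) (U c j * det) =
      (if c = i then scal (of_real q) (U c j * det) else 0)"
      unfolding Z[OF \<open>c \<in> {1..n}\<close>] by simp
  qed
  also have "\<dots> = scal (of_real q) (U i j * det)" using assms by simp
  finally have 1: "Zop scal q n (coact (Suc n) (sgn_pre q j)) ?k \<approx> scal (of_real q) (U i j * det)" .
  have "Zop scal q n (coact (Suc n) (sgn_pre q j)) ?k \<approx> coact (Suc n) (Zop (*) q n (sgn_pre q j)) ?k"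
    by (rule coact_Zop[OF k]) simp
  also have "\<dots> = scal (of_real q) (\<Sum>l \<in> idx_lists n n. \<Sum>c = 1..n. if c = j then scal (sgn_q q l) (monom U [1..<Suc n] l) * U i c else 0)"
    unfolding coact_def cvec.scale_sum_right sum_idx_lists_snoc
  proof (intro sum.cong refl)
    fix l c assume lc: "l \<in> idx_lists n n" "c \<in> {1..n}"
    then have "l @ [c] \<in> idx_lists n (Suc n)" by (simp add: idx_lists_def)
    then have "Zop (*) q n (sgn_pre q j) (l @ [c]) = of_real q * sgn_post q j (l @ [c])"
      using assms(2) q_pos by (intro Zop_sgn_pre)
    moreover have "length l = length [1..<Suc n]" using lc by (simp add: idx_lists_def)
    ultimately show "scal (Zop (*) q n (sgn_pre q j) (l @ [c])) (monom U ([1..<Suc n] @ [i]) (l @ [c])) =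
      scal (of_real q) (if c = j then scal (sgn_q q l) (monom U [1..<Suc n] l) * U i c else 0)"
      by (simp add: sgn_post_def del: upt_Suc)
  qed
  also have "\<dots> = scal (of_real q) (det * U i j)"
    using assms(2) by (simp add: qdet_conv sum_distrib_right del: upt_Suc)
  finally have "scal (of_real q) (U i j * det) \<approx> scal (of_real q) (det * U i j)"
    using cg_trans cg_sym 1 by blast
  then show ?thesis using q_pos by (rule_tac cg_scal_cancel) auto
qed

end

section \<open>Exchange relations\<close>

lemma sum_Rb:
  assumes "a \<in> {1..n}" "c \<in> {1..n}"
  shows "(\<Sum>w = 1..n. \<Sum>x = 1..n. scal (of_real (Rb q (a, c) (w, x))) (F w x)) =
    scal (inverse (rho q a c)) (F c a) - scal (nuH q a c) (F a c)"
  using assms by (simp add: Rb_eq cvec.scale_left_diff_distrib sum_subtractf scal_if if_distrib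
    [where f = "\<lambda>g. sum g _"] sum.If_cases if_distribR cong: if_cong)

text \<open>The sum runs over one upper and one lower index. The exchange term of R fixes both,
  while the nu term forces s = c and leaves a free sum over the diagonal.\<close>

lemma sum_Rm_skew:
  assumes "c \<in> {1..n}" "s \<in> {1..n}"
  shows "(\<Sum>e = 1..n. \<Sum>f = 1..n. scal (of_real (Rm q (e, c) (f, s))) (F e f)) =
    scal (rho q s c) (F s c) + (if s = c then \<Sum>e = 1..n. scal (nuH q e c) (F e e) else 0)"
  using assms by (simp add: Rm_eq cvec.scale_left_distrib sum.distrib scal_if if_distrib
    [where f = "\<lambda>g. sum g _"] sum.If_cases if_distribR cong: if_cong)

lemma sum_Rm_skew':
  assumes "j \<in> {1..n}" "m \<in> {1..n}"
  shows "(\<Sum>a = 1..n. \<Sum>b = 1..n. scal (of_real (Rm q (j, a) (m, b))) (F a b)) =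
    scal (rho q j m) (F m j) + (if m = j then \<Sum>a = 1..n. scal (nuH q j a) (F a a) else 0)"
  using assms by (simp add: Rm_eq cvec.scale_left_distrib sum.distrib scal_if if_distrib
    [where f = "\<lambda>g. sum g _"] sum.If_cases if_distribR eq_commute[of m] cong: if_cong)

lemma sum_Rb_skew':
  assumes "j \<in> {1..n}" "m \<in> {1..n}"
  shows "(\<Sum>a = 1..n. \<Sum>b = 1..n. scal (of_real (Rb q (j, a) (m, b))) (F a b)) =
    scal (inverse (rho q j m)) (F m j) - (if m = j then \<Sum>a = 1..n. scal (nuH q j a) (F a a) else 0)"
  using assms by (simp add: Rb_eq cvec.scale_left_diff_distrib sum_subtractf scal_if if_distrib
    [where f = "\<lambda>g. sum g _"] sum.If_cases if_distribR eq_commute[of m] cong: if_cong)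

locale rtt_group = rtt_matrix A I n q U for A I :: "'x falg set" and n q U +
  fixes W :: "nat \<Rightarrow> nat \<Rightarrow> 'x falg"
  assumes W_A: "i \<in> {1..n} \<Longrightarrow> j \<in> {1..n} \<Longrightarrow> W i j \<in> A"
    and UW: "i \<in> {1..n} \<Longrightarrow> l \<in> {1..n} \<Longrightarrow> (\<Sum>j = 1..n. U i j * W j l) \<approx> (if i = l then 1 else 0)"
    and WU: "i \<in> {1..n} \<Longrightarrow> l \<in> {1..n} \<Longrightarrow> (\<Sum>j = 1..n. W i j * U j l) \<approx> (if i = l then 1 else 0)"
begin

lemma WU':
  assumes "i \<in> {1..n}" "l \<in> {1..n}"
  shows "(\<Sum>j = 1..n. W i j * U j l) \<approx> (if l = i then 1 else 0)"
  unfolding eq_commute[of l i] using assms by (rule WU)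

lemma sum_cg_delta:
  assumes "\<And>a. a \<in> {1..n} \<Longrightarrow> E a \<approx> (if a = t then 1 else 0)" "t \<in> {1..n}"
    "\<And>a. a \<in> {1..n} \<Longrightarrow> X a \<in> A" "\<And>a. a \<in> {1..n} \<Longrightarrow> Y a \<in> A"
  shows "(\<Sum>a = 1..n. X a * E a * Y a) \<approx> X t * Y t"
proof -
  have "(\<Sum>a = 1..n. X a * E a * Y a) \<approx> (\<Sum>a = 1..n. X a * (if a = t then 1 else 0) * Y a)"
    using assms by (intro cg_sum cg_mult cg_refl) auto
  also have "\<dots> = (\<Sum>a = 1..n. if a = t then X a * Y a else 0)"
    by (intro sum.cong) auto
  finally show ?thesis using assms(2) by simp
qed

text \<open>The relation $W_1 \hat R\, U_1 = U_2 \hat R\, W_2$ obtained from the defining relations by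
  multiplication with \<open>W\<close> from both sides.\<close>

lemma rtt_mixed:
  assumes "m \<in> {1..n}" "b \<in> {1..n}" "c \<in> {1..n}" "t \<in> {1..n}"
  shows "scal (rho q t c) (W m t * U c b) + (if t = c then \<Sum>a = 1..n. scal (nuH q a c) (W m a * U a b) else 0)
    \<approx> scal (rho q m b) (U c b * W m t) + (if m = b then \<Sum>z = 1..n. scal (nuH q m z) (U c z * W z t) else 0)"
proof -
  let ?L = "\<Sum>a = 1..n. \<Sum>d = 1..n. W m a * (scal (rho q a c) (U c b * U a d) + scal (nuH q a c) (U a b * U c d)) * W d t"
  let ?R = "\<Sum>a = 1..n. \<Sum>d = 1..n. W m a * (scal (rho q b d) (U a d * U c b) + scal (nuH q b d) (U a b * U c d)) * W d t"
  have LR: "?L \<approx> ?R"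
    using assms by (intro cg_sum cg_mult cg_refl rtt W_A)
  have L: "?L = (\<Sum>a = 1..n. scal (rho q a c) (W m a * U c b) * (\<Sum>d = 1..n. U a d * W d t) * 1)
    + (\<Sum>a = 1..n. scal (nuH q a c) (W m a * U a b) * (\<Sum>d = 1..n. U c d * W d t))"
    by (simp add: distrib_left distrib_right sum.distrib sum_distrib_left sum_distrib_right mult.assoc
      cvec.scale_sum_right)
  have "\<dots> \<approx> scal (rho q t c) (W m t * U c b) * 1
    + (\<Sum>a = 1..n. scal (nuH q a c) (W m a * U a b) * (if c = t then 1 else 0))"
    using assms by (intro cg_add[OF sum_cg_delta cg_sum[OF cg_mult[OF cg_refl]]] UW A_closed W_A U_A) auto
  then have 1: "?L \<approx> scal (rho q t c) (W m t * U c b) + (if t = c then \<Sum>a = 1..n. scal (nuH q a c) (W m a * U a b) else 0)"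
    unfolding L by (cases "t = c") simp_all
  have R: "?R = (\<Sum>d = 1..n. 1 * (\<Sum>a = 1..n. W m a * U a d) * scal (rho q b d) (U c b * W d t))
    + (\<Sum>d = 1..n. (\<Sum>a = 1..n. W m a * U a b) * scal (nuH q b d) (U c d * W d t))"
    by (subst (1) sum.swap) (simp add: distrib_left distrib_right sum.distrib sum_distrib_left
      sum_distrib_right mult.assoc cvec.scale_sum_right)
  have "\<dots> \<approx> 1 * scal (rho q b m) (U c b * W m t)
    + (\<Sum>d = 1..n. (if m = b then 1 else 0) * scal (nuH q b d) (U c d * W d t))"
    using assms by (intro cg_add[OF sum_cg_delta[OF WU'] cg_sum[OF cg_mult[OF WU cg_refl]]] A_closed W_A U_A)
  then have 2: "?R \<approx> scal (rho q m b) (U c b * W m t) + (if m = b then \<Sum>z = 1..n. scal (nuH q m z) (U c z * W z t) else 0)"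
    unfolding R by (cases "m = b") (simp_all add: rho_commute)
  show ?thesis using cg_trans[OF cg_sym[OF 1] cg_trans[OF LR 2]] .
qed

text \<open>\<open>rtt_mixed\<close> is multiplied by \<open>W\<close> on both sides once more,
  which removes the remaining \<open>U\<close>. On each side the exchange part and the nu part lose
  one sum by the inverse relation.\<close>

lemma rtt_W:
  assumes "m \<in> {1..n}" "y \<in> {1..n}" "s \<in> {1..n}" "t \<in> {1..n}"
  shows "scal (rho q s t) (W y s * W m t) + scal (nuH q s t) (W y t * W m s)
    \<approx> scal (rho q m y) (W m t * W y s) + scal (nuH q m y) (W y t * W m s)"
proof -
  let ?l = "\<lambda>c b. scal (rho q t c) (W m t * U c b) + (if t = c then \<Sum>a = 1..n. scal (nuH q a c) (W m a * U a b) else 0)"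
  let ?r = "\<lambda>c b. scal (rho q m b) (U c b * W m t) + (if m = b then \<Sum>z = 1..n. scal (nuH q m z) (U c z * W z t) else 0)"
  let ?L = "\<Sum>c = 1..n. \<Sum>b = 1..n. W y c * ?l c b * W b s"
  let ?R = "\<Sum>c = 1..n. \<Sum>b = 1..n. W y c * ?r c b * W b s"
  have LR: "?L \<approx> ?R"
    using assms by (intro cg_sum cg_mult cg_refl rtt_mixed W_A)
  have delta': "(\<Sum>c = 1..n. \<Sum>b = 1..n. if b = x then F c else 0) = (\<Sum>c = 1..n. F c)"
    if "x \<in> {1..n}" for x and F :: "nat \<Rightarrow> 'x falg"
    using that by simp
  have delta: "(\<Sum>c = 1..n. \<Sum>b = 1..n. if c = x then F b else 0) = (\<Sum>b = 1..n. F b)"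
    if "x \<in> {1..n}" for x and F :: "nat \<Rightarrow> 'x falg"
    using that by (subst sum.swap) simp
  have "W y c * ?l c b * W b s = scal (rho q t c) (W y c * W m t * (U c b * W b s))
    + (if c = t then \<Sum>a = 1..n. scal (nuH q a t) (W y t * W m a * (U a b * W b s)) else 0)" for c b
    by (auto simp: distrib_left distrib_right mult.assoc sum_distrib_left sum_distrib_right)
  then have L1: "?L = (\<Sum>c = 1..n. \<Sum>b = 1..n. scal (rho q t c) (W y c * W m t * (U c b * W b s)))
    + (\<Sum>b = 1..n. \<Sum>a = 1..n. scal (nuH q a t) (W y t * W m a * (U a b * W b s)))"
    by (simp only: sum.distrib delta[OF assms(4)])
  have L2: "\<dots> = (\<Sum>c = 1..n. scal (rho q t c) (W y c * W m t) * (\<Sum>b = 1..n. U c b * W b s) * 1)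
    + (\<Sum>a = 1..n. scal (nuH q a t) (W y t * W m a) * (\<Sum>b = 1..n. U a b * W b s) * 1)"
    by (simp add: sum_distrib_left cvec.scale_sum_right) (rule sum.swap)
  have "\<dots> \<approx> scal (rho q t s) (W y s * W m t) * 1 + scal (nuH q s t) (W y t * W m s) * 1"
    using assms by (intro cg_add[OF sum_cg_delta[OF UW] sum_cg_delta[OF UW]] A_closed W_A)
  then have 1: "?L \<approx> scal (rho q s t) (W y s * W m t) + scal (nuH q s t) (W y t * W m s)"
    unfolding L1 L2 by (simp add: rho_commute)
  have "W y c * ?r c b * W b s = scal (rho q m b) (W y c * U c b * (W m t * W b s))
    + (if b = m then \<Sum>z = 1..n. scal (nuH q m z) (W y c * U c z * (W z t * W m s)) else 0)" for c b
    by (auto simp: distrib_left distrib_right mult.assoc sum_distrib_left sum_distrib_right)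
  then have R1: "?R = (\<Sum>c = 1..n. \<Sum>b = 1..n. scal (rho q m b) (W y c * U c b * (W m t * W b s)))
    + (\<Sum>c = 1..n. \<Sum>z = 1..n. scal (nuH q m z) (W y c * U c z * (W z t * W m s)))"
    by (simp only: sum.distrib delta'[OF assms(1)])
  have R2: "\<dots> = (\<Sum>b = 1..n. 1 * (\<Sum>c = 1..n. W y c * U c b) * scal (rho q m b) (W m t * W b s))
    + (\<Sum>z = 1..n. 1 * (\<Sum>c = 1..n. W y c * U c z) * scal (nuH q m z) (W z t * W m s))"
    by (simp add: sum_distrib_right cvec.scale_sum_right mult.assoc)
      (intro arg_cong2[where f = "(+)"] sum.swap)
  have "\<dots> \<approx> 1 * scal (rho q m y) (W m t * W y s) + 1 * scal (nuH q m y) (W y t * W m s)"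
    using assms by (intro cg_add[OF sum_cg_delta[OF WU'] sum_cg_delta[OF WU']] A_closed W_A)
  then have 2: "?R \<approx> scal (rho q m y) (W m t * W y s) + scal (nuH q m y) (W y t * W m s)"
    unfolding R1 R2 by simp
  show ?thesis using cg_trans[OF cg_sym[OF 1] cg_trans[OF LR 2]] .
qed

section \<open>Exchanges within u and within S(u)\<close>

lemma UU_exchange:
  assumes "k \<in> {2..n}" "i \<in> {1..n}" "a \<in> {1..n}"
  shows "U i k * U a 1 \<approx> (\<Sum>c = 1..n. \<Sum>d = 1..n. scal (of_real (Rb q (a, i) (c, d))) (U d 1 * U c k))"
proof -
  have k: "k \<in> {1..n}" "1 \<in> {1..n}" "1 < k" using assms(1) by auto
  have rel: "scal (rho q x y) (U y k * U x 1) + scal (nuH q x y) (U x k * U y 1) \<approx> U x 1 * U y k"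
    if "x \<in> {1..n}" "y \<in> {1..n}" for x y
    using rtt[of x k y 1] k that by (simp add: rho_def nuH_def)
  note mem = A_mult[OF U_A U_A] A_scal
  have "U i k * U a 1 \<approx> scal (inverse (rho q a i)) (U a 1 * U i k) - scal (nuH q a i) (U i 1 * U a k)"
  proof -
    consider "a = i" | "i < a" | "a < i" by linarith
    then show ?thesis
    proof cases
      case 1
      then show ?thesis
        using cg_scal[OF rel[of a i], of "inverse (of_real q)"] assms q_pos
        by (simp add: rho_def nuH_def)
    next
      case 2
      then show ?thesis
        using rel[of a i] assms by (simp add: rho_def nuH_def)
    next
      case 3
      \<comment> \<open>For a < i the relation for (a, i) still contains u^a_k u^i_1, which the
        relation for (i, a), free of nu, rewrites.\<close>
      let ?v = "complex_of_real (q - inverse q)"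
      have "U i k * U a 1 + scal ?v (U a k * U i 1) - scal ?v (U a k * U i 1) \<approx> U a 1 * U i k - scal ?v (U i 1 * U a k)"
        using rel[of a i] rel[of i a] 3 assms
        by (intro cg_diff cg_scal) (simp_all add: rho_def nuH_def)
      then show ?thesis using 3 by (simp add: rho_def nuH_def)
    qed
  qed
  also have "\<dots> = (\<Sum>c = 1..n. \<Sum>d = 1..n. scal (of_real (Rb q (a, i) (c, d))) (U d 1 * U c k))"
    by (rule sum_Rb[OF assms(3,2), symmetric])
  finally show ?thesis .
qed

text \<open>In one column the relation for a < c reads x_c x_a + nu x_a x_c = q x_a x_c, and q - nu
  = 1/q. The sign function records which index is larger.\<close>

lemma U_col_exchange:
  assumes "i \<in> {1..n}" "b \<in> {1..n}"
  shows "U i 1 * U b 1 \<approx> scal (of_real (q powi sgn (int b - int i))) (U b 1 * U i 1)"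
proof -
  have 1: "1 \<in> {1..n}" using assms by auto
  have lt: "U c 1 * U a 1 \<approx> scal (of_real (inverse q)) (U a 1 * U c 1)" if "a < c" "a \<in> {1..n}" "c \<in> {1..n}" for a c
  proof -
    have "scal (of_real (q - inverse q)) (U a 1 * U c 1) \<approx> scal (of_real (q - inverse q)) (U a 1 * U c 1)"
      using that 1 by (intro cg_refl A_scal A_mult U_A)
    from cg_diff[OF rtt[of a 1 c 1] this] that 1 show ?thesis
      by (simp add: rho_def nuH_def flip: cvec.scale_left_diff_distrib)
  qed
  consider "b = i" | "b < i" | "i < b" by linarith
  then show ?thesis
  proof cases
    case 1
    then show ?thesis using assms \<open>1 \<in> {1..n}\<close> by (simp add: cg_refl A_mult U_A)
  next
    case 2
    then show ?thesis using lt[of b i] assms by (simp add: power_int_minus)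
  next
    case 3
    have "scal (of_real q) (U b 1 * U i 1) \<approx> scal (of_real q) (scal (of_real (inverse q)) (U i 1 * U b 1))"
      using lt[OF 3] assms by (intro cg_scal)
    then show ?thesis using 3 q_pos by (simp add: cg_sym)
  qed
qed

lemma W_row_exchange:
  assumes "b \<in> {1..n}" "s \<in> {1..n}"
  shows "W 1 b * W 1 s \<approx> scal (of_real (q powi sgn (int b - int s))) (W 1 s * W 1 b)"
proof -
  have 1: "1 \<in> {1..n}" using assms by auto
  have lt: "W 1 a * W 1 c \<approx> scal (of_real (inverse q)) (W 1 c * W 1 a)" if "a < c" "a \<in> {1..n}" "c \<in> {1..n}" for a c
  proof -
    have "scal (of_real (q - inverse q)) (W 1 c * W 1 a) \<approx> scal (of_real (q - inverse q)) (W 1 c * W 1 a)"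
      using that 1 by (intro cg_refl A_scal A_mult W_A)
    from cg_diff[OF rtt_W[of 1 1 a c] this] that 1 show ?thesis
      by (simp add: rho_def nuH_def flip: cvec.scale_left_diff_distrib)
  qed
  consider "b = s" | "b < s" | "s < b" by linarith
  then show ?thesis
  proof cases
    case 1
    then show ?thesis using assms \<open>1 \<in> {1..n}\<close> by (simp add: cg_refl A_mult W_A)
  next
    case 2
    then show ?thesis using lt[of b s] assms by (simp add: power_int_minus)
  next
    case 3
    have "scal (of_real q) (W 1 s * W 1 b) \<approx> scal (of_real q) (scal (of_real (inverse q)) (W 1 b * W 1 s))"
      using lt[OF 3] assms by (intro cg_scal)
    then show ?thesis using 3 q_pos by (simp add: cg_sym)
  qed
qed

lemma WW_exchange:
  assumes "k \<in> {2..n}" "a \<in> {1..n}" "s \<in> {1..n}"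
  shows "W k a * W 1 s \<approx> (\<Sum>c = 1..n. \<Sum>d = 1..n. scal (of_real (Rm q (s, a) (c, d))) (W 1 d * W k c))"
proof -
  have k: "k \<in> {1..n}" "1 \<in> {1..n}" "1 < k" using assms(1) by auto
  have "W k a * W 1 s \<approx> scal (rho q s a) (W 1 s * W k a) + scal (nuH q s a) (W 1 a * W k s)"
    using cg_sym[OF rtt_W[of k 1 s a]] k assms by (simp add: rho_def nuH_def)
  then show ?thesis
    unfolding sum_Rm[OF assms(3,2)] .
qed

lemma UW_exchange:
  assumes "k \<in> {2..n}" "c \<in> {1..n}" "s \<in> {1..n}"
  shows "U c k * W 1 s \<approx> (\<Sum>e = 1..n. \<Sum>f = 1..n. scal (of_real (Rm q (e, c) (f, s))) (W 1 e * U f k))"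
proof -
  have k: "k \<in> {1..n}" "1 \<in> {1..n}" "1 \<noteq> k" using assms(1) by auto
  show ?thesis
    unfolding sum_Rm_skew[OF assms(2,3)]
    using cg_sym[OF rtt_mixed[OF k(2,1) assms(2,3)]] k(3) by (simp add: rho_def)
qed

section \<open>The triangular system for the products S(u) u\<close>

abbreviation nu :: complex
  where "nu \<equiv> of_real (q - inverse q)"

text \<open>The tails T_m, sums of the t_a over a > m, satisfy T_m = kappa s_{m+1} + (1 + q nu)
  T_{m+1}, and 1 + q nu = q^2.\<close>

lemma triangular_solve:
  assumes rec: "\<And>m. m \<in> {1..n} \<Longrightarrow> t m \<approx> scal \<kappa> (s m) + scal (of_real q * nu) (\<Sum>a = Suc m..n. t a)"
    and s_A: "\<And>m. m \<in> {1..n} \<Longrightarrow> s m \<in> A" and m: "m \<in> {1..n}"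
  shows "t m \<approx> scal \<kappa> (s m) + (\<Sum>a = Suc m..n. scal (\<kappa> * of_real (q powi (2 * (int a - int m) - 1)) * nu) (s a))"
proof -
  have tail: "(\<Sum>a = Suc m..n. t a) \<approx> (\<Sum>a = Suc m..n. scal (\<kappa> * of_real (q powi (2 * (int a - int m - 1)))) (s a))"
    if "m \<le> n" for m
    using that
  proof (induction "n - m" arbitrary: m)
    case 0
    then show ?case by (simp add: cg_refl A_0)
  next
    case (Suc d)
    then have m: "Suc m \<in> {1..n}" by auto
    let ?X = "\<lambda>m. \<Sum>a = Suc m..n. scal (\<kappa> * of_real (q powi (2 * (int a - int m - 1)))) (s a)"
    have IH: "(\<Sum>a = Suc (Suc m)..n. t a) \<approx> ?X (Suc m)"
      using Suc by (intro Suc.hyps(1)) auto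
    have q2: "1 + of_real q * nu = of_real (q ^ 2)"
      using q_pos by (simp add: right_diff_distrib power2_eq_square)
    have "(\<Sum>a = Suc m..n. t a) = t (Suc m) + (\<Sum>a = Suc (Suc m)..n. t a)"
      using m by (simp add: sum.atLeast_Suc_atMost)
    also have "\<dots> \<approx> (scal \<kappa> (s (Suc m)) + scal (of_real q * nu) (?X (Suc m))) + ?X (Suc m)"
      by (rule cg_add[OF cg_trans[OF rec[OF m]] IH])
        (intro cg_add cg_refl cg_scal IH A_scal s_A m)
    also have "\<dots> = scal \<kappa> (s (Suc m)) + scal (of_real (q ^ 2)) (?X (Suc m))"
      unfolding q2[symmetric] by (simp add: cvec.scale_left_distrib)
    also have "scal (of_real (q ^ 2)) (?X (Suc m)) = (\<Sum>a = Suc (Suc m)..n. scal (\<kappa> * of_real (q powi (2 * (int a - int m - 1)))) (s a))"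
      unfolding cvec.scale_sum_right
    proof (intro sum.cong refl)
      fix a
      have "2 * (int a - int m - 1) = 2 + 2 * (int a - int (Suc m) - 1)" by simp
      moreover have "q powi (2 + 2 * (int a - int (Suc m) - 1)) = q powi 2 * q powi (2 * (int a - int (Suc m) - 1))"
        by (rule power_int_add) (use q_pos in simp)
      ultimately have "q powi (2 * (int a - int m - 1)) = q ^ 2 * q powi (2 * (int a - int (Suc m) - 1))"
        by (simp only: power_int_numeral)
      then show "scal (of_real (q ^ 2)) (scal (\<kappa> * of_real (q powi (2 * (int a - int (Suc m) - 1)))) (s a)) =
        scal (\<kappa> * of_real (q powi (2 * (int a - int m - 1)))) (s a)"
        by simp
    qed
    also have "scal \<kappa> (s (Suc m)) + \<dots> = ?X m"
      using m by (simp add: sum.atLeast_Suc_atMost)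
    finally show ?case .
  qed
  have "t m \<approx> scal \<kappa> (s m) + scal (of_real q * nu) (\<Sum>a = Suc m..n. scal (\<kappa> * of_real (q powi (2 * (int a - int m - 1)))) (s a))"
    using tail[of m] m by (intro cg_trans[OF rec] cg_add cg_scal cg_refl A_scal s_A) auto
  also have "scal (of_real q * nu) (\<Sum>a = Suc m..n. scal (\<kappa> * of_real (q powi (2 * (int a - int m - 1)))) (s a)) =
    (\<Sum>a = Suc m..n. scal (\<kappa> * of_real (q powi (2 * (int a - int m) - 1)) * nu) (s a))"
    unfolding cvec.scale_sum_right
  proof (intro sum.cong refl)
    fix a
    have "2 * (int a - int m) - 1 = 1 + 2 * (int a - int m - 1)" by simp
    moreover have "q powi (1 + 2 * (int a - int m - 1)) = q powi 1 * q powi (2 * (int a - int m - 1))"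
      by (rule power_int_add) (use q_pos in simp)
    ultimately have "q powi (2 * (int a - int m) - 1) = q * q powi (2 * (int a - int m - 1))"
      by (simp only: power_int_1_right)
    then show "scal (of_real q * nu) (scal (\<kappa> * of_real (q powi (2 * (int a - int m - 1)))) (s a)) =
      scal (\<kappa> * of_real (q powi (2 * (int a - int m) - 1)) * nu) (s a)"
      by (simp add: ac_simps)
  qed
  finally show ?thesis .
qed

text \<open>The sum over a < m is traded for the total, which the inverse relation evaluates, and
  the tail over a > m, which stays in the recursion.\<close>

lemma sum_nuH_lower: "m \<in> {1..n} \<Longrightarrow> (\<Sum>a = 1..n. scal (nuH q a m) (f a)) =
    scal nu (\<Sum>a = 1..n. f a) - scal nu (f m) - scal nu (\<Sum>a = Suc m..n. f a)"
proof -
  assume m: "m \<in> {1..n}"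
  have "(\<Sum>a = 1..n. f a) = (\<Sum>a = 1..<m. f a) + f m + (\<Sum>a = Suc m..n. f a)"
  proof -
    have "{1..n} = {1..<m} \<union> insert m {Suc m..n}" using m by auto
    moreover have "sum f ({1..<m} \<union> insert m {Suc m..n}) = (\<Sum>a = 1..<m. f a) + sum f (insert m {Suc m..n})"
      by (rule sum.union_disjoint) auto
    ultimately show ?thesis by (simp add: add.assoc)
  qed
  moreover have "(\<Sum>a = 1..n. scal (nuH q a m) (f a)) = (\<Sum>a = 1..<m. scal nu (f a))"
    using m by (intro sum.mono_neutral_cong_right) (auto simp: nuH_def)
  ultimately show ?thesis
    by (simp add: cvec.scale_right_distrib cvec.scale_sum_right)
qed

lemma sum_nuH_upper: "m \<in> {1..n} \<Longrightarrow> (\<Sum>a = 1..n. scal (nuH q m a) (f a)) = (\<Sum>a = Suc m..n. scal nu (f a))"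
  by (intro sum.mono_neutral_cong_right) (auto simp: nuH_def)

lemma UW_sum_upper:
  assumes "m \<in> {1..n}" "j \<in> {1..n}"
  shows "(\<Sum>z = 1..n. scal (nuH q 1 z) (U m z * W z j)) \<approx>
    scal nu (if m = j then 1 else 0) - scal nu (U m 1 * W 1 j)"
proof -
  have 1: "1 \<in> {1..n}" using assms by auto
  have "(\<Sum>z = 1..n. scal (nuH q 1 z) (U m z * W z j)) = scal nu (\<Sum>z = Suc 1..n. U m z * W z j)"
    unfolding sum_nuH_upper[OF 1] by (simp only: cvec.scale_sum_right)
  also have "(\<Sum>z = Suc 1..n. U m z * W z j) = (\<Sum>z = 1..n. U m z * W z j) - U m 1 * W 1 j"
    using 1 by (simp add: sum.atLeast_Suc_atMost)
  finally have *: "(\<Sum>z = 1..n. scal (nuH q 1 z) (U m z * W z j)) =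
    scal nu (\<Sum>z = 1..n. U m z * W z j) - scal nu (U m 1 * W 1 j)"
    by (simp only: cvec.scale_right_diff_distrib)
  show ?thesis
    unfolding * using assms 1 by (intro cg_diff cg_scal UW cg_refl A_mult U_A W_A)
qed

text \<open>The sum over z >= 2 of u^m_z S(u^z_j) is delta_mj minus the term z = 1; that term
  combines with q u^m_1 S(u^1_j) to the factor q - nu = 1/q.\<close>

lemma mixed_first_row:
  assumes "m \<in> {1..n}" "j \<in> {1..n}"
  shows "scal (rho q j m) (W 1 j * U m 1) + (if j = m then \<Sum>a = 1..n. scal (nuH q a m) (W 1 a * U a 1) else 0)
    \<approx> scal (inverse (of_real q)) (U m 1 * W 1 j) + scal nu (if m = j then 1 else 0)"
proof -
  have 1: "1 \<in> {1..n}" using assms by auto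
  have "scal (rho q j m) (W 1 j * U m 1) + (if j = m then \<Sum>a = 1..n. scal (nuH q a m) (W 1 a * U a 1) else 0)
    \<approx> scal (rho q 1 1) (U m 1 * W 1 j) + (\<Sum>z = 1..n. scal (nuH q 1 z) (U m z * W z j))"
    using rtt_mixed[OF 1 1 assms] by (simp only: if_True refl)
  also have "\<dots> \<approx> scal (rho q 1 1) (U m 1 * W 1 j) + (scal nu (if m = j then 1 else 0) - scal nu (U m 1 * W 1 j))"
    using assms 1 by (intro cg_add UW_sum_upper cg_refl A_scal A_mult U_A W_A)
  also have "\<dots> = scal (inverse (of_real q)) (U m 1 * W 1 j) + scal nu (if m = j then 1 else 0)"
    by (simp add: rho_def cvec.scale_left_diff_distrib)
  finally show ?thesis .
qed

text \<open>With t_a = S(u^1_a) u^a_1, whose total is 1, the constant nu in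
  \<open>mixed_first_row\<close> cancels. What remains is (q - nu) t_m = q^{-1} u^m_1 S(u^1_m) plus
  nu times the tail, to be multiplied by q.\<close>

lemma WU_rec_first:
  assumes m: "m \<in> {1..n}"
  shows "W 1 m * U m 1 \<approx> scal 1 (U m 1 * W 1 m) + scal (of_real q * nu) (\<Sum>a = Suc m..n. W 1 a * U a 1)"
proof -
  have 1: "1 \<in> {1..n}" using assms by auto
  let ?t = "\<lambda>a. W 1 a * U a 1"
  have t: "?t a \<in> A" if "a \<in> {1..n}" for a
    using that 1 by (intro A_mult W_A U_A)
  have "scal (of_real q) (?t m) + (scal nu (\<Sum>a = 1..n. ?t a) - scal nu (?t m) - scal nu (\<Sum>a = Suc m..n. ?t a))
    \<approx> scal (inverse (of_real q)) (U m 1 * W 1 m) + scal nu 1"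
    using mixed_first_row[OF m m] unfolding sum_nuH_lower[OF m] by (simp add: rho_def)
  then show ?thesis
  proof (rule cg_combine[OF _ WU[OF 1 1], where c = "of_real q" and d = "- (of_real q * nu)"])
    show "?t m - (scal 1 (U m 1 * W 1 m) + scal (of_real q * nu) (\<Sum>a = Suc m..n. ?t a)) =
      scal (of_real q) (scal (of_real q) (?t m) + (scal nu (\<Sum>a = 1..n. ?t a) - scal nu (?t m)
          - scal nu (\<Sum>a = Suc m..n. ?t a)) - (scal (inverse (of_real q)) (U m 1 * W 1 m) + scal nu 1))
        + scal (- (of_real q * nu)) ((\<Sum>a = 1..n. ?t a) - (if 1 = 1 then 1 else 0))"
      using q_pos by (intro poly_mapping_eqI) (simp add: lookup_add lookup_minus algebra_simps)
  qed (use m 1 in \<open>auto intro!: A_closed A_sum U_A W_A\<close>)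
qed

text \<open>Here the total is 0, and the right side of \<open>rtt_mixed\<close> has no nu term since
  k and 1 differ; this is why the coefficient is q in place of 1.\<close>

lemma WU_rec:
  assumes m: "m \<in> {1..n}" and k: "k \<in> {2..n}"
  shows "W k m * U m 1 \<approx> scal (of_real q) (U m 1 * W k m) + scal (of_real q * nu) (\<Sum>a = Suc m..n. W k a * U a 1)"
proof -
  have 1: "1 \<in> {1..n}" "k \<in> {1..n}" "k \<noteq> 1" using assms by auto
  let ?t = "\<lambda>a. W k a * U a 1"
  have "scal (of_real q) (?t m) + (scal nu (\<Sum>a = 1..n. ?t a) - scal nu (?t m) - scal nu (\<Sum>a = Suc m..n. ?t a))
    \<approx> U m 1 * W k m"
    using rtt_mixed[OF 1(2,1) m m] 1(3) unfolding sum_nuH_lower[OF m] by (simp add: rho_def)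
  then show ?thesis
  proof (rule cg_combine[OF _ WU[OF 1(2,1)], where c = "of_real q" and d = "- (of_real q * nu)"])
    show "?t m - (scal (of_real q) (U m 1 * W k m) + scal (of_real q * nu) (\<Sum>a = Suc m..n. ?t a)) =
      scal (of_real q) (scal (of_real q) (?t m) + (scal nu (\<Sum>a = 1..n. ?t a) - scal nu (?t m)
          - scal nu (\<Sum>a = Suc m..n. ?t a)) - U m 1 * W k m)
        + scal (- (of_real q * nu)) ((\<Sum>a = 1..n. ?t a) - (if k = 1 then 1 else 0))"
      using q_pos 1(3) by (intro poly_mapping_eqI) (simp add: lookup_add lookup_minus algebra_simps)
  qed (use m 1 in \<open>auto intro!: A_closed A_sum U_A W_A\<close>)
qed

text \<open>For j different from m this is a single mixed relation. Only j = m needs the triangular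
  system; there the exponent -1 is compensated by the diagonal factor q of R.\<close>

lemma WU_exchange_first:
  assumes "j \<in> {1..n}" "m \<in> {1..n}"
  shows "W 1 j * U m 1 \<approx> (\<Sum>a = 1..n. \<Sum>b = 1..n.
    scal (of_real (q powi (2 * (int b - int j) - 1) * Rm q (j, a) (m, b))) (U a 1 * W 1 b))"
proof -
  have 1: "1 \<in> {1..n}" using assms by auto
  have "(\<Sum>a = 1..n. \<Sum>b = 1..n. scal (of_real (q powi (2 * (int b - int j) - 1) * Rm q (j, a) (m, b))) (U a 1 * W 1 b))
    = (\<Sum>a = 1..n. \<Sum>b = 1..n. scal (of_real (Rm q (j, a) (m, b))) (scal (of_real (q powi (2 * (int b - int j) - 1))) (U a 1 * W 1 b)))"
    by (simp add: mult.commute)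
  also have "\<dots> = scal (rho q j m) (scal (of_real (q powi (2 * (int j - int j) - 1))) (U m 1 * W 1 j))
    + (if m = j then \<Sum>a = 1..n. scal (nuH q j a) (scal (of_real (q powi (2 * (int a - int j) - 1))) (U a 1 * W 1 a)) else 0)"
    by (rule sum_Rm_skew'[OF assms])
  also have "W 1 j * U m 1 \<approx> \<dots>"
  proof (cases "m = j")
    case True
    have "W 1 j * U j 1 \<approx> scal 1 (U j 1 * W 1 j) +
      (\<Sum>a = Suc j..n. scal (1 * of_real (q powi (2 * (int a - int j) - 1)) * nu) (U a 1 * W 1 a))"
      using assms 1 by (intro triangular_solve[of "\<lambda>a. W 1 a * U a 1"] WU_rec_first A_mult U_A W_A)
    then show ?thesis
      unfolding sum_nuH_upper[OF assms(1)] using True q_pos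
      by (simp add: rho_def power_int_minus mult.commute)
  next
    case False
    then show ?thesis
      using mixed_first_row[OF assms(2,1)] by (simp add: rho_def power_int_minus)
  qed
  finally show ?thesis by (simp only:)
qed

lemma WU_exchange:
  assumes "j \<in> {1..n}" "m \<in> {1..n}" "k \<in> {2..n}"
  shows "W k j * U m 1 \<approx> (\<Sum>a = 1..n. \<Sum>b = 1..n.
    scal (of_real (q powi (2 * (int b - int m)) * Rm q (m, a) (j, b))) (U b 1 * W k a))"
proof -
  have 1: "1 \<in> {1..n}" "k \<in> {1..n}" "k \<noteq> 1" using assms by auto
  have "(\<Sum>a = 1..n. \<Sum>b = 1..n. scal (of_real (q powi (2 * (int b - int m)) * Rm q (m, a) (j, b))) (U b 1 * W k a))
    = (\<Sum>a = 1..n. \<Sum>b = 1..n. scal (of_real (Rm q (m, a) (j, b))) (scal (of_real (q powi (2 * (int b - int m)))) (U b 1 * W k a)))"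
    by (simp add: mult.commute)
  also have "\<dots> = scal (rho q m j) (scal (of_real (q powi (2 * (int m - int m)))) (U m 1 * W k j))
    + (if j = m then \<Sum>a = 1..n. scal (nuH q m a) (scal (of_real (q powi (2 * (int a - int m)))) (U a 1 * W k a)) else 0)"
    by (rule sum_Rm_skew'[OF assms(2,1)])
  also have "W k j * U m 1 \<approx> \<dots>"
  proof (cases "j = m")
    case True
    have "W k m * U m 1 \<approx> scal (of_real q) (U m 1 * W k m) +
      (\<Sum>a = Suc m..n. scal (of_real q * of_real (q powi (2 * (int a - int m) - 1)) * nu) (U a 1 * W k a))"
      using assms 1 by (intro triangular_solve[of "\<lambda>a. W k a * U a 1"] WU_rec A_mult U_A W_A)
    moreover have "of_real q * of_real (q powi (2 * (int a - int m) - 1)) = complex_of_real (q powi (2 * (int a - int m)))" for a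
    proof -
      have "q powi (1 + (2 * (int a - int m) - 1)) = q powi 1 * q powi (2 * (int a - int m) - 1)"
        by (rule power_int_add) (use q_pos in simp)
      then show ?thesis by simp
    qed
    ultimately show ?thesis
      unfolding sum_nuH_upper[OF assms(2)] using True
      by (simp add: rho_def mult.commute)
  next
    case False
    then show ?thesis
      using rtt_mixed[OF 1(2,1) assms(2,1)] 1(3) by (simp add: rho_def)
  qed
  finally show ?thesis by (simp only:)
qed

text \<open>No system has to be solved: for i = d the recursion for S(u^1_i) u^i_1 contains the
  wanted product linearly and is read backwards.\<close>

lemma UW_exchange_first:
  assumes "i \<in> {1..n}" "d \<in> {1..n}"
  shows "U i 1 * W 1 d \<approx> (\<Sum>e = 1..n. \<Sum>f = 1..n.
    scal (of_real (q * Rb q (i, e) (d, f))) (W 1 e * U f 1))"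
proof -
  have 1: "1 \<in> {1..n}" using assms by auto
  have "(\<Sum>e = 1..n. \<Sum>f = 1..n. scal (of_real (q * Rb q (i, e) (d, f))) (W 1 e * U f 1))
    = (\<Sum>e = 1..n. \<Sum>f = 1..n. scal (of_real (Rb q (i, e) (d, f))) (scal (of_real q) (W 1 e * U f 1)))"
    by (simp add: mult.commute)
  also have "\<dots> = scal (inverse (rho q i d)) (scal (of_real q) (W 1 d * U i 1))
    - (if d = i then \<Sum>a = 1..n. scal (nuH q i a) (scal (of_real q) (W 1 a * U a 1)) else 0)"
    by (rule sum_Rb_skew'[OF assms])
  also have "U i 1 * W 1 d \<approx> \<dots>"
  proof (cases "d = i")
    case True
    have sum: "(\<Sum>a = Suc i..n. scal nu (scal (of_real q) (W 1 a * U a 1))) =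
      scal (of_real q * nu) (\<Sum>a = Suc i..n. W 1 a * U a 1)"
      by (simp add: cvec.scale_sum_right mult.commute)
    have "scal (of_real q * nu) (\<Sum>a = Suc i..n. W 1 a * U a 1) \<in> A"
      using 1 by (intro A_scal A_sum A_mult W_A U_A) auto
    from cg_diff[OF WU_rec_first[OF assms(1)] cg_refl[OF this]]
    show ?thesis
      unfolding sum_nuH_upper[OF assms(1)] sum using True q_pos by (simp add: rho_def cg_sym)
  next
    case False
    then show ?thesis
      using cg_scal[OF cg_sym[OF mixed_first_row[OF assms]], of "of_real q"] q_pos
      by (auto simp: rho_def)
  qed
  finally show ?thesis by (simp only:)
qed

text \<open>The product w_j x_m contributes q^{2(b-j)-1} and a factor \<open>Rm\<close>, u^i_k x_a
  contributes \<open>Rb\<close>, w_b w_s the sign power, and u^c_k w_s the last \<open>Rm\<close>.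
  The index k is never touched, so the relation can be summed against the e^+ afterwards.\<close>

lemma holomorphic_exchange:
  assumes "k \<in> {2..n}" "i \<in> {1..n}" "j \<in> {1..n}" "m \<in> {1..n}" "s \<in> {1..n}"
  shows "U i k * W 1 j * (U m 1 * W 1 s) \<approx>
    (\<Sum>a = 1..n. \<Sum>b = 1..n. \<Sum>c = 1..n. \<Sum>d = 1..n. \<Sum>e = 1..n. \<Sum>f = 1..n.
      scal (of_real (q powi (2 * (int b - int j) + sgn (int b - int s) - 1)
          * Rm q (j, a) (m, b) * Rb q (a, i) (c, d) * Rm q (e, c) (f, s)))
        (U d 1 * W 1 e * (U f k * W 1 b)))"
proof -
  have k: "k \<in> {1..n}" "1 \<in> {1..n}" using assms by auto
  let ?c1 = "\<lambda>a b. complex_of_real (q powi (2 * (int b - int j) - 1) * Rm q (j, a) (m, b))"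
  let ?c2 = "\<lambda>a c d. complex_of_real (Rb q (a, i) (c, d))"
  let ?c3 = "\<lambda>b. complex_of_real (q powi sgn (int b - int s))"
  let ?c4 = "\<lambda>c e f. complex_of_real (Rm q (e, c) (f, s))"
  have powi: "q powi (2 * (int b - int j) + sgn (int b - int s) - 1) =
    q powi (2 * (int b - int j) - 1) * q powi sgn (int b - int s)" for b
    using power_int_add[of q "2 * (int b - int j) - 1" "sgn (int b - int s)"] q_pos
    by (simp add: algebra_simps)
  have 1: "U i k * (W 1 j * U m 1) * W 1 s \<approx> U i k * (\<Sum>a = 1..n. \<Sum>b = 1..n. scal (?c1 a b) (U a 1 * W 1 b)) * W 1 s"
    using assms k by (intro cg_mult cg_refl U_A W_A WU_exchange_first)
  have 2: "\<dots> = (\<Sum>a = 1..n. \<Sum>b = 1..n. scal (?c1 a b) ((U i k * U a 1) * (W 1 b * W 1 s)))"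
    by (simp add: sum_distrib_left sum_distrib_right mult.assoc)
  have 3: "\<dots> \<approx> (\<Sum>a = 1..n. \<Sum>b = 1..n. scal (?c1 a b) ((\<Sum>c = 1..n. \<Sum>d = 1..n. scal (?c2 a c d) (U d 1 * U c k))
      * scal (?c3 b) (W 1 s * W 1 b)))"
    using assms k by (intro cg_sum cg_scal cg_mult UU_exchange W_row_exchange)
  have 4: "\<dots> = (\<Sum>a = 1..n. \<Sum>b = 1..n. \<Sum>c = 1..n. \<Sum>d = 1..n. scal (?c1 a b * ?c2 a c d * ?c3 b)
      (U d 1 * (U c k * W 1 s) * W 1 b))"
    by (simp add: sum_distrib_left sum_distrib_right cvec.scale_sum_right mult.assoc mult.left_commute mult.commute
      del: of_real_mult)
  have 5: "\<dots> \<approx> (\<Sum>a = 1..n. \<Sum>b = 1..n. \<Sum>c = 1..n. \<Sum>d = 1..n. scal (?c1 a b * ?c2 a c d * ?c3 b)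
      (U d 1 * (\<Sum>e = 1..n. \<Sum>f = 1..n. scal (?c4 c e f) (W 1 e * U f k)) * W 1 b))"
    using assms k by (intro cg_sum cg_scal cg_mult UW_exchange cg_refl U_A W_A)
  have 6: "\<dots> = (\<Sum>a = 1..n. \<Sum>b = 1..n. \<Sum>c = 1..n. \<Sum>d = 1..n. \<Sum>e = 1..n. \<Sum>f = 1..n.
      scal (of_real (q powi (2 * (int b - int j) + sgn (int b - int s) - 1)
          * Rm q (j, a) (m, b) * Rb q (a, i) (c, d) * Rm q (e, c) (f, s)))
        (U d 1 * W 1 e * (U f k * W 1 b)))"
    unfolding powi
    by (simp add: sum_distrib_left sum_distrib_right cvec.scale_sum_right mult.assoc)
      (intro sum.cong refl arg_cong2[where f = scal], simp)
  have "U i k * W 1 j * (U m 1 * W 1 s) = U i k * (W 1 j * U m 1) * W 1 s"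
    by (simp add: mult.assoc)
  then show ?thesis
    using cg_trans[OF 1[unfolded 2] cg_trans[OF 3[unfolded 4] 5[unfolded 6]]] by simp
qed

text \<open>The exponent collects 2(b - m) from S(u^k_j) u^m_1, the sign from u^i_1 u^b_1, and 1
  from u^i_1 S(u^1_d), whose exchange is q times \<open>Rb\<close>.\<close>

lemma antiholomorphic_exchange:
  assumes "k \<in> {2..n}" "i \<in> {1..n}" "j \<in> {1..n}" "m \<in> {1..n}" "s \<in> {1..n}"
  shows "U i 1 * W k j * (U m 1 * W 1 s) \<approx>
    (\<Sum>a = 1..n. \<Sum>b = 1..n. \<Sum>c = 1..n. \<Sum>d = 1..n. \<Sum>e = 1..n. \<Sum>f = 1..n.
      scal (of_real (q powi (2 * (int b - int m) + sgn (int b - int i) + 1)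
          * Rm q (m, a) (j, b) * Rm q (s, a) (c, d) * Rb q (i, e) (d, f)))
        (U b 1 * W 1 e * (U f 1 * W k c)))"
proof -
  have k: "k \<in> {1..n}" "1 \<in> {1..n}" using assms by auto
  let ?c1 = "\<lambda>a b. complex_of_real (q powi (2 * (int b - int m)) * Rm q (m, a) (j, b))"
  let ?c2 = "\<lambda>a c d. complex_of_real (Rm q (s, a) (c, d))"
  let ?c3 = "\<lambda>b. complex_of_real (q powi sgn (int b - int i))"
  let ?c4 = "\<lambda>d e f. complex_of_real (q * Rb q (i, e) (d, f))"
  have powi: "q powi (2 * (int b - int m) + sgn (int b - int i) + 1) =
    q powi (2 * (int b - int m)) * q powi sgn (int b - int i) * q" for b
    using q_pos by (simp add: power_int_add)
  have 1: "U i 1 * (W k j * U m 1) * W 1 s \<approx> U i 1 * (\<Sum>a = 1..n. \<Sum>b = 1..n. scal (?c1 a b) (U b 1 * W k a)) * W 1 s"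
    using assms k by (intro cg_mult cg_refl U_A W_A WU_exchange)
  have 2: "\<dots> = (\<Sum>a = 1..n. \<Sum>b = 1..n. scal (?c1 a b) ((U i 1 * U b 1) * (W k a * W 1 s)))"
    by (simp add: sum_distrib_left sum_distrib_right mult.assoc)
  have 3: "\<dots> \<approx> (\<Sum>a = 1..n. \<Sum>b = 1..n. scal (?c1 a b) (scal (?c3 b) (U b 1 * U i 1)
      * (\<Sum>c = 1..n. \<Sum>d = 1..n. scal (?c2 a c d) (W 1 d * W k c))))"
    using assms k by (intro cg_sum cg_scal cg_mult U_col_exchange WW_exchange)
  have 4: "\<dots> = (\<Sum>a = 1..n. \<Sum>b = 1..n. \<Sum>c = 1..n. \<Sum>d = 1..n. scal (?c1 a b * ?c2 a c d * ?c3 b)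
      (U b 1 * (U i 1 * W 1 d) * W k c))"
    by (simp add: sum_distrib_left sum_distrib_right cvec.scale_sum_right mult.assoc mult.left_commute mult.commute
      del: of_real_mult)
  have 5: "\<dots> \<approx> (\<Sum>a = 1..n. \<Sum>b = 1..n. \<Sum>c = 1..n. \<Sum>d = 1..n. scal (?c1 a b * ?c2 a c d * ?c3 b)
      (U b 1 * (\<Sum>e = 1..n. \<Sum>f = 1..n. scal (?c4 d e f) (W 1 e * U f 1)) * W k c))"
    using assms k by (intro cg_sum cg_scal cg_mult UW_exchange_first cg_refl U_A W_A)
  have 6: "\<dots> = (\<Sum>a = 1..n. \<Sum>b = 1..n. \<Sum>c = 1..n. \<Sum>d = 1..n. \<Sum>e = 1..n. \<Sum>f = 1..n.
      scal (of_real (q powi (2 * (int b - int m) + sgn (int b - int i) + 1)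
          * Rm q (m, a) (j, b) * Rm q (s, a) (c, d) * Rb q (i, e) (d, f)))
        (U b 1 * W 1 e * (U f 1 * W k c)))"
    unfolding powi
    by (simp add: sum_distrib_left sum_distrib_right cvec.scale_sum_right mult.assoc)
      (intro sum.cong refl arg_cong2[where f = scal], simp)
  have "U i 1 * W k j * (U m 1 * W 1 s) = U i 1 * (W k j * U m 1) * W 1 s"
    by (simp add: mult.assoc)
  then show ?thesis
    using cg_trans[OF 1[unfolded 2] cg_trans[OF 3[unfolded 4] 5[unfolded 6]]] by simp
qed

end

section \<open>The quantum special unitary group\<close>

lemma rtt_rels_subset:
  assumes "alg_ideal A I" "\<And>i j. i \<in> {1..n} \<Longrightarrow> j \<in> {1..n} \<Longrightarrow> U i j \<in> A"
  shows "rtt_rels n q U \<subseteq> A"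
proof -
  interpret alg_ideal A I by fact
  show ?thesis
    unfolding rtt_rels_eq rtt_rel_def by (auto intro!: A_closed assms(2))
qed

lemma qdet_in:
  assumes "alg_ideal A I" "\<And>i j. i \<in> {1..n} \<Longrightarrow> j \<in> {1..n} \<Longrightarrow> U i j \<in> A" "0 < q"
  shows "qdet n q U \<in> A"
proof -
  interpret alg_ideal A I by fact
  \<comment> \<open>With I = A every congruence is trivial; only the membership of the determinant
    is extracted.\<close>
  interpret T: rtt_matrix A A n q U
    by unfold_locales (use rtt_rels_subset[OF assms(1,2)] assms in \<open>auto intro: A_1 A_sub A_mult\<close>)
  show ?thesis by (rule T.det_A)
qed

lemma tens_cg:
  assumes "alg_ideal.cg A I x x'" "alg_ideal.cg B K y y'" "alg_ideal A I" "alg_ideal B K"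
  shows "alg_ideal.cg (tens_alg A B) (tens_ker A I B K) (tens x y) (tens x' y')"
proof -
  interpret A: alg_ideal A I by fact
  interpret B: alg_ideal B K by fact
  interpret T: alg_ideal "tens_alg A B" "tens_ker A I B K" by (rule alg_ideal_tens) fact+
  have "tens x y - tens x' y' = tens (x - x') y + tens x' (y - y')"
    by (simp add: tens_simps)
  then show ?thesis
    using assms(1,2) by (auto simp: T.cg_def A.cg_def B.cg_def intro: tens_alg_base T.I_add tens_ker_base)
qed

section \<open>Coproduct and counit on the quotient\<close>

lemma Delta_monom:
  "length k = m \<Longrightarrow> length l = m \<Longrightarrow>
    Delta n (monom u k l) = (\<Sum>h \<in> idx_lists n m. tens (monom u k h) (monom u h l))"
proof (induction m arbitrary: k l)
  case 0
  have "idx_lists n 0 = {[]}" by (auto simp: idx_lists_def)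
  with 0 show ?case by (simp add: Delta_simps)
next
  case (Suc m)
  then obtain i k' j l' where *: "k = i # k'" "l = j # l'" "length k' = m" "length l' = m"
    by (auto simp: length_Suc_conv)
  show ?case
    unfolding * by (simp add: sum_idx_lists_Suc Delta_simps Suc.IH * sum_product)
qed

lemma counit_monom:
  "length k = length l \<Longrightarrow> counit (monom u k l) = of_bool (k = l)"
  by (induction k l rule: list_induct2) (simp_all add: counit_simps)

locale qSU =
  fixes N :: nat and q :: real
  assumes q_pos: "0 < q"
begin

abbreviation "AA \<equiv> matA N"
abbreviation "II \<equiv> SU_ideal N q"
abbreviation "JJ \<equiv> tens_ker AA II AA II"

text \<open>The empty set of relations gives the zero ideal. This instance supplies the closure
  properties of \<open>matA N\<close> before the relations are known to lie in it.\<close>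

lemma free_matA: "alg_ideal AA (ideal_on (idx N) {})"
  unfolding matA_def by (rule alg_ideal_ideal_on) simp

lemma u_A: "i \<in> {1..N} \<Longrightarrow> j \<in> {1..N} \<Longrightarrow> u i j \<in> AA"
  by (simp add: u_def matA_def idx_def free_on_gen)

lemma SU_rels_subset: "rtt_rels N q u \<union> {qdet N q u - 1} \<subseteq> free_on (idx N)"
  using rtt_rels_subset[OF free_matA u_A, where n = N] qdet_in[OF free_matA u_A q_pos]
    alg_ideal.A_diff[OF free_matA] alg_ideal.A_1[OF free_matA]
  by (simp add: matA_def)

sublocale G: alg_ideal AA II
  unfolding matA_def SU_ideal_def by (rule alg_ideal_ideal_on[OF SU_rels_subset])

sublocale GG: alg_ideal "tens_alg AA AA" JJ
  by (rule alg_ideal_tens) (rule G.alg_ideal_axioms)+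

sublocale G: rtt_matrix AA II N q u
  by unfold_locales
    (use ideal_on_base[OF SU_rels_subset] in \<open>auto simp: SU_ideal_def q_pos u_A\<close>)

lemma det_1: "G.cg (qdet N q u) 1"
proof -
  have "qdet N q u - 1 \<in> II"
    unfolding SU_ideal_def by (rule ideal_on_base[OF SU_rels_subset]) simp
  then show ?thesis using G.det_A G.A_1 by (simp add: G.cg_def)
qed

lemmas tens_cg_G = tens_cg[OF _ _ G.alg_ideal_axioms G.alg_ideal_axioms]

lemma Delta_u_in: "i \<in> {1..N} \<Longrightarrow> j \<in> {1..N} \<Longrightarrow> Delta N (u i j) \<in> tens_alg AA AA"
  unfolding Delta_u by (intro GG.A_sum tens_alg_base u_A) auto

lemma Delta_matA:
  assumes "f \<in> AA" shows "Delta N f \<in> tens_alg AA AA"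
  unfolding Delta_def
proof (rule alg_ext_free_on[OF GG.alg_ideal_axioms assms[unfolded matA_def]])
  fix x assume "x \<in> idx N"
  then show "(case x of (i, j) \<Rightarrow> \<Sum>k = 1..N. tens (u i k) (u k j)) \<in> tens_alg AA AA"
    by (auto simp: idx_def intro!: GG.A_sum tens_alg_base u_A)
qed

text \<open>The relation is applied in the left and in the right tensor factor. The terms in which R
  acts on the intermediate indices e, f cancel, after exchanging e and f in the \<open>rho\<close>
  part.\<close>

lemma Delta_rtt_rel:
  "Delta N (rtt_rel q u a c b d) = (\<Sum>e = 1..N. \<Sum>f = 1..N. tens (rtt_rel q u a c e f) (u e b * u f d))
    + (\<Sum>e = 1..N. \<Sum>f = 1..N. tens (u a e * u c f) (rtt_rel q u e f b d))"
proof -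
  have mult: "Delta N (u a b * u c d) = (\<Sum>e = 1..N. \<Sum>f = 1..N. tens (u a e * u c f) (u e b * u f d))" for a b c d
    by (simp add: Delta_simps sum_product)
  have swap: "(\<Sum>e = 1..N. \<Sum>f = 1..N. scal (rho q e f) (tens (u a f * u c e) (u e b * u f d))) =
    (\<Sum>e = 1..N. \<Sum>f = 1..N. scal (rho q e f) (tens (u a e * u c f) (u f b * u e d)))"
    by (subst sum.swap) (simp add: rho_commute)
  show ?thesis
    unfolding rtt_rel_def Delta_simps(1,2,4) mult tens_simps sum.distrib sum_subtractf cvec.scale_sum_right swap
    by (simp add: algebra_simps)
qed

text \<open>Summing over column lists turns the right factor into the coaction on the antisymmetric
  tensor, that is \<open>sgn_q\<close> times the determinant. The left factors then sum up to the
  determinant too.\<close>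

lemma Delta_qdet: "GG.cg (Delta N (qdet N q u)) 1"
proof -
  let ?k = "[1..<Suc N]"
  have "Delta N (qdet N q u) = (\<Sum>l \<in> idx_lists N N. scal (sgn_q q l) (\<Sum>h \<in> idx_lists N N. tens (monom u ?k h) (monom u h l)))"
    unfolding qdet_conv Delta_simps(5)
  proof (intro sum.cong refl)
    fix l assume "l \<in> idx_lists N N"
    then have "Delta N (monom u ?k l) = (\<Sum>h \<in> idx_lists N N. tens (monom u ?k h) (monom u h l))"
      by (intro Delta_monom) (simp_all add: idx_lists_def)
    then show "Delta N (scal (sgn_q q l) (monom u ?k l)) =
      scal (sgn_q q l) (\<Sum>h \<in> idx_lists N N. tens (monom u ?k h) (monom u h l))"
      by (simp only: Delta_simps)
  qed
  also have "\<dots> = (\<Sum>h \<in> idx_lists N N. tens (monom u ?k h) (G.coact N (sgn_q q) h))"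
    unfolding G.coact_def tens_simps cvec.scale_sum_right by (rule sum.swap)
  finally have 1: "Delta N (qdet N q u) = \<dots>" .
  have 2: "GG.cg \<dots> (\<Sum>h \<in> idx_lists N N. tens (monom u ?k h) (scal (sgn_q q h) (qdet N q u)))"
    by (intro GG.cg_sum tens_cg_G G.cg_refl G.monom_A[OF G.iota_idx_list] G.coact_sgn_q)
  have 3: "\<dots> = tens (qdet N q u) (qdet N q u)"
    by (subst (2) qdet_conv) (simp only: tens_simps)
  have 4: "GG.cg \<dots> (tens 1 1)"
    by (intro tens_cg_G det_1)
  show ?thesis
    using GG.cg_trans[OF 2[folded 1, unfolded 3] 4] by simp
qed

lemma Delta_ideal:
  assumes "f \<in> II" shows "Delta N f \<in> JJ"
proof -
  have "alg_ext (Poly_Mapping.single 0) (\<lambda>(i, j). \<Sum>k = 1..N. tens (u i k) (u k j)) f \<in> JJ"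
    using assms[unfolded SU_ideal_def]
  proof (rule alg_ext_ideal_on[OF GG.alg_ideal_axioms])
    fix x assume "x \<in> idx N"
    then show "(case x of (i, j) \<Rightarrow> \<Sum>k = 1..N. tens (u i k) (u k j)) \<in> tens_alg AA AA"
      by (auto simp: idx_def intro!: GG.A_sum tens_alg_base u_A)
  next
    fix a assume "a \<in> rtt_rels N q u \<union> {qdet N q u - 1}"
    then consider a' b c d where "a = rtt_rel q u a' c b d" "a' \<in> {1..N}" "b \<in> {1..N}" "c \<in> {1..N}" "d \<in> {1..N}"
      | "a = qdet N q u - 1"
      unfolding rtt_rels_eq by blast
    then show "alg_ext (Poly_Mapping.single 0) (\<lambda>(i, j). \<Sum>k = 1..N. tens (u i k) (u k j)) a \<in> JJ"
      unfolding Delta_def[symmetric]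
    proof cases
      case 1
      then show "Delta N a \<in> JJ"
        unfolding 1(1) Delta_rtt_rel
        by (intro GG.I_add GG.I_sum tens_ker_base G.A_mult u_A subsetD[OF G.rels_I])
          (auto simp: rtt_rels_eq simp del: One_nat_def)
    next
      case 2
      then show "Delta N a \<in> JJ"
        using Delta_qdet by (simp add: GG.cg_def Delta_simps)
    qed
  qed
  then show ?thesis by (simp add: Delta_def)
qed

lemma counit_ideal:
  assumes "f \<in> II" shows "counit f = 0"
proof -
  have "counit (rtt_rel q u a c b d) = 0" for a b c d
    by (auto simp: rtt_rel_def counit_simps rho_def nuH_def)
  moreover have "counit (qdet N q u) = 1"
  proof -
    have "counit (qdet N q u) = (\<Sum>l \<in> idx_lists N N. if l = [1..<Suc N] then 1 else 0)"
      unfolding qdet_conv counit_simps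
      by (intro sum.cong refl) (auto simp: counit_simps counit_monom idx_lists_def simp del: upt_Suc)
    then show ?thesis
      using G.iota_idx_list by (simp del: upt_Suc)
  qed
  ultimately have "II \<subseteq> {f. counit f = 0}"
    unfolding SU_ideal_def
    by (intro ideal_on_subset) (auto simp: cvec.subspace_def counit_simps rtt_rels_eq)
  then show ?thesis using assms by blast
qed

end

section \<open>The map to the quantum unitary group\<close>

locale qU =
  fixes n :: nat and q :: real
  assumes q_pos: "0 < q"
begin

abbreviation "BB \<equiv> free_on (U_gens n)"
abbreviation "KK \<equiv> U_ideal n q"

lemma free_BB: "alg_ideal BB (ideal_on (U_gens n) {})"
  by (rule alg_ideal_ideal_on) simp

lemma uU_B: "i \<in> {1..n} \<Longrightarrow> j \<in> {1..n} \<Longrightarrow> uU i j \<in> BB"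
  by (simp add: uU_def U_gens_def idx_def free_on_gen)

lemma None_B: "gen None \<in> BB"
  by (simp add: U_gens_def free_on_gen)

lemma U_rels_subset: "rtt_rels n q uU \<union> {qdet n q uU * gen None - 1, gen None * qdet n q uU - 1} \<subseteq> BB"
  using rtt_rels_subset[OF free_BB uU_B, where n = n] qdet_in[OF free_BB uU_B q_pos] None_B
    alg_ideal.A_diff[OF free_BB] alg_ideal.A_1[OF free_BB] alg_ideal.A_mult[OF free_BB]
  by simp

sublocale alg_ideal BB KK
  unfolding U_ideal_def by (rule alg_ideal_ideal_on[OF U_rels_subset])

sublocale rtt_matrix BB KK n q uU
  by unfold_locales (use ideal_on_base[OF U_rels_subset] in \<open>auto simp: U_ideal_def q_pos uU_B\<close>)

notation cg (infix \<open>\<approx>\<close> 50)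

lemma det_inverse: "det * gen None \<approx> 1" "gen None * det \<approx> 1"
proof -
  have "det * gen None - 1 \<in> KK" "gen None * det - 1 \<in> KK"
    unfolding U_ideal_def by (rule ideal_on_base[OF U_rels_subset], simp)+
  then show "det * gen None \<approx> 1" "gen None * det \<approx> 1"
    using None_B det_A by (simp_all add: cg_def A_mult A_1)
qed

lemma inverse_det_central:
  assumes "i \<in> {1..n}" "j \<in> {1..n}"
  shows "gen None * uU i j \<approx> uU i j * gen None"
proof -
  note mem = None_B det_A uU_B[OF assms] A_mult
  have "gen None * uU i j = gen None * uU i j * 1" by simp
  also have "\<dots> \<approx> gen None * uU i j * (det * gen None)"
    using mem by (intro cg_mult cg_refl cg_sym[OF det_inverse(1)])
  also have "\<dots> = gen None * (uU i j * det) * gen None" by (simp add: mult.assoc)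
  also have "\<dots> \<approx> gen None * (det * uU i j) * gen None"
    using mem by (intro cg_mult cg_refl det_central assms)
  also have "\<dots> = (gen None * det) * (uU i j * gen None)" by (simp add: mult.assoc)
  also have "\<dots> \<approx> 1 * (uU i j * gen None)"
    using mem by (intro cg_mult cg_refl det_inverse(2))
  finally show ?thesis by simp
qed

lemma alpha_u_Suc [simp]: "alpha (u (Suc i) (Suc j)) =
    (if i = 0 \<and> j = 0 then gen None else if i = 0 \<or> j = 0 then 0 else uU i j)"
  by (simp add: alpha_u)

lemma alpha_u_B: "i \<in> {1..Suc n} \<Longrightarrow> j \<in> {1..Suc n} \<Longrightarrow> alpha (u i j) \<in> BB"
  by (cases i; cases j) (auto intro: A_0 None_B uU_B)

lemma alpha_matA:
  assumes "f \<in> matA (Suc n)" shows "alpha f \<in> BB"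
  unfolding alpha_def
proof (rule alg_ext_free_on[OF alg_ideal_axioms assms[unfolded matA_def]])
  fix x assume "x \<in> idx (Suc n)"
  then show "(case x of (i, j) \<Rightarrow> if i = 1 \<and> j = 1 then gen None
    else if i = 1 \<or> j = 1 then 0 else uU (i - 1) (j - 1)) \<in> BB"
  proof -
    obtain i j where "x = (i, j)" "i \<in> {1..Suc n}" "j \<in> {1..Suc n}"
      using \<open>x \<in> idx (Suc n)\<close> by (auto simp: idx_def)
    then show ?thesis
      using alpha_u_B[of i j] by (simp only: alpha_u prod.case)
  qed
qed

text \<open>After the shift, index 0 stands for the first row or column, which \<open>alpha\<close>
  sends to the inverse determinant or to 0. Relations without it become relations of C_q[U_n]; the
  others vanish or reduce to commutators of the inverse determinant with a generator.\<close>

lemma alpha_rtt_rel: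
  assumes "a \<le> n" "b \<le> n" "c \<le> n" "d \<le> n"
  shows "alpha (rtt_rel q u (Suc a) (Suc c) (Suc b) (Suc d)) \<in> KK"
proof (cases "a = 0 \<or> b = 0 \<or> c = 0 \<or> d = 0")
  case False
  then have "alpha (rtt_rel q u (Suc a) (Suc c) (Suc b) (Suc d)) = rtt_rel q uU a c b d"
    by (simp add: rtt_rel_def alpha_simps rho_def nuH_def)
  moreover have "rtt_rel q uU a c b d \<in> rtt_rels n q uU"
    unfolding rtt_rels_eq using False assms by (auto simp: Suc_le_eq)
  ultimately show ?thesis using rels_I by auto
next
  case True
  have central: "gen None * uU i j - uU i j * gen None \<in> KK" "uU i j * gen None - gen None * uU i j \<in> KK"
    if "0 < i" "0 < j" "i \<le> n" "j \<le> n" for i j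
    using inverse_det_central[of i j] cg_sym[OF inverse_det_central[of i j]] that by (simp_all add: cg_def)
  then show ?thesis
    using True assms
    by (cases "a = 0"; cases "b = 0"; cases "c = 0"; cases "d = 0")
      (simp_all add: rtt_rel_def alpha_simps rho_def nuH_def I_0)
qed

lemma alpha_monom_Suc: "length k = length l \<Longrightarrow> 0 \<notin> set k \<Longrightarrow> 0 \<notin> set l \<Longrightarrow>
    alpha (monom u (map Suc k) (map Suc l)) = monom uU k l"
  by (induction k l rule: list_induct2) (simp_all add: alpha_simps)

lemma sgn_q_Cons_map_Suc: "0 \<notin> set l \<Longrightarrow> sgn_q q (Suc 0 # map Suc l) = sgn_q q l"
proof -
  assume l: "0 \<notin> set l"
  have "invs (map Suc l) = invs l"
    by (induction l) (simp_all add: filter_map o_def)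
  moreover have "filter (\<lambda>y. y < Suc 0) (map Suc l) = []" by (simp add: filter_map o_def)
  ultimately show ?thesis using l by (auto simp: sgn_q_def distinct_map)
qed

text \<open>Only lists that start with 1 survive, as \<open>alpha\<close> kills u^1_c for c > 1, and
  a second 1 in the tail would give sign 0. The remaining tails are shifted lists with the same
  number of inversions.\<close>

lemma alpha_qdet: "alpha (qdet (Suc n) q u) = gen None * det"
proof -
  let ?k = "[1..<Suc n]"
  have k: "[1..<Suc (Suc n)] = Suc 0 # map Suc ?k"
    by (simp add: upt_conv_Cons map_Suc_upt del: upt_Suc)
  let ?f = "\<lambda>l. scal (sgn_q q (Suc 0 # l)) (gen None * alpha (monom u (map Suc ?k) l))"
  have "alpha (qdet (Suc n) q u) = (\<Sum>l \<in> idx_lists (Suc n) (Suc n). scal (sgn_q q l) (alpha (monom u (Suc 0 # map Suc ?k) l)))"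
    unfolding qdet_conv k alpha_simps ..
  also have "\<dots> = (\<Sum>c = 1..Suc n. if c = 1 then \<Sum>l \<in> idx_lists (Suc n) n. ?f l else 0)"
    unfolding sum_idx_lists_Suc
    by (intro sum.cong refl) (auto simp: alpha_simps alpha_u simp del: upt_Suc)
  also have "\<dots> = (\<Sum>l \<in> idx_lists (Suc n) n. ?f l)" by simp
  also have "\<dots> = (\<Sum>l \<in> map Suc ` idx_lists n n. ?f l)"
  proof (rule sum.mono_neutral_right)
    show "map Suc ` idx_lists n n \<subseteq> idx_lists (Suc n) n" by (auto simp: idx_lists_def subset_iff)
    show "\<forall>l \<in> idx_lists (Suc n) n - map Suc ` idx_lists n n. ?f l = 0"
    proof
      fix l assume l: "l \<in> idx_lists (Suc n) n - map Suc ` idx_lists n n"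
      have "Suc 0 \<in> set l"
      proof (rule ccontr)
        assume no: "Suc 0 \<notin> set l"
        have range: "Suc 0 < x \<and> x \<le> Suc n" if "x \<in> set l" for x
        proof -
          have "x \<in> {1..Suc n}" using l that by (auto simp: idx_lists_def)
          moreover have "x \<noteq> Suc 0" using no that by metis
          ultimately show ?thesis by auto
        qed
        have "l = map Suc (map (\<lambda>x. x - 1) l)"
          unfolding map_map by (rule map_idI[symmetric]) (use range in fastforce)
        moreover have "map (\<lambda>x. x - 1) l \<in> idx_lists n n"
          using l range by (fastforce simp: idx_lists_def)
        ultimately show False using l by blast
      qed
      then show "?f l = 0" by (simp add: sgn_q_def)
    qed
  qed simp
  also have "\<dots> = (\<Sum>l \<in> idx_lists n n. ?f (map Suc l))"
    by (subst sum.reindex) (auto intro!: inj_onI simp: inj_map_eq_map)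
  also have "\<dots> = (\<Sum>l \<in> idx_lists n n. gen None * scal (sgn_q q l) (monom uU ?k l))"
  proof (intro sum.cong refl)
    fix l assume "l \<in> idx_lists n n"
    then have l: "0 \<notin> set l" "length ?k = length l" by (auto simp: idx_lists_def)
    have "0 \<notin> set ?k" by simp
    show "?f (map Suc l) = gen None * scal (sgn_q q l) (monom uU ?k l)"
      unfolding sgn_q_Cons_map_Suc[OF l(1)] alpha_monom_Suc[OF l(2) \<open>0 \<notin> set ?k\<close> l(1)] scal_mult_right ..
  qed
  finally show ?thesis
    unfolding qdet_conv sum_distrib_left .
qed

lemma alpha_ideal:
  assumes "f \<in> SU_ideal (Suc n) q" shows "alpha f \<in> KK"
proof -
  have "alg_ext (Poly_Mapping.single 0) (\<lambda>(i, j). if i = 1 \<and> j = 1 then gen None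
      else if i = 1 \<or> j = 1 then 0 else uU (i - 1) (j - 1)) f \<in> KK"
    using assms[unfolded SU_ideal_def]
  proof (rule alg_ext_ideal_on[OF alg_ideal_axioms])
    fix x assume "x \<in> idx (Suc n)"
    then show "(case x of (i, j) \<Rightarrow> if i = 1 \<and> j = 1 then gen None
      else if i = 1 \<or> j = 1 then 0 else uU (i - 1) (j - 1)) \<in> BB"
  proof -
    obtain i j where "x = (i, j)" "i \<in> {1..Suc n}" "j \<in> {1..Suc n}"
      using \<open>x \<in> idx (Suc n)\<close> by (auto simp: idx_def)
    then show ?thesis
      using alpha_u_B[of i j] by (simp only: alpha_u prod.case)
  qed
  next
    fix a assume "a \<in> rtt_rels (Suc n) q u \<union> {qdet (Suc n) q u - 1}"
    then consider a' b c d where "a = rtt_rel q u a' c b d" "a' \<in> {1..Suc n}" "b \<in> {1..Suc n}" "c \<in> {1..Suc n}" "d \<in> {1..Suc n}"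
      | "a = qdet (Suc n) q u - 1"
      unfolding rtt_rels_eq by blast
    then show "alg_ext (Poly_Mapping.single 0) (\<lambda>(i, j). if i = 1 \<and> j = 1 then gen None
      else if i = 1 \<or> j = 1 then 0 else uU (i - 1) (j - 1)) a \<in> KK"
      unfolding alpha_def[symmetric]
    proof cases
      case 1
      then obtain a1 b1 c1 d1 where "a' = Suc a1" "b = Suc b1" "c = Suc c1" "d = Suc d1"
        by (metis atLeastAtMost_iff not0_implies_Suc not_one_le_zero)
      with 1 show "alpha a \<in> KK"
        using alpha_rtt_rel[of a1 b1 c1 d1] by simp
    next
      case 2
      then show "alpha a \<in> KK"
        using det_inverse(2) by (simp add: cg_def alpha_simps alpha_qdet)
    qed
  qed
  then show ?thesis by (simp add: alpha_def)
qed

end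

section \<open>The antipode and the quantum projective space\<close>

lemma sum_mult_assoc:
  fixes X Z :: "'i \<Rightarrow> 'a::ring"
  shows "(\<Sum>l\<in>L. X l * (\<Sum>m\<in>M. Y l m * Z m)) = (\<Sum>m\<in>M. (\<Sum>l\<in>L. X l * Y l m) * Z m)"
  by (simp add: sum_distrib_left sum_distrib_right mult.assoc) (rule sum.swap)

locale SU_calculus = qSU N q for N :: nat and q :: real +
  fixes p :: complex and S :: "mat_alg \<Rightarrow> mat_alg" and r :: "mat_alg \<Rightarrow> mat_alg \<Rightarrow> complex"
  assumes N_ge_2: "N \<ge> 2" and p_root: "p ^ N = of_real q"
    and antipode: "SU_antipode N q S" and coquasi: "SU_coquasi N q p r"
begin

lemma p_nonzero [simp]: "p \<noteq> 0"
  using p_root q_pos N_ge_2 by (auto simp: power_0_left)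

lemma one_in: "1 \<in> {1..N}"
  using N_ge_2 by auto

abbreviation W :: "nat \<Rightarrow> nat \<Rightarrow> mat_alg"
  where "W i j \<equiv> S (u i j)"

lemma S_linear: "Vector_Spaces.linear scal scal S"
  using antipode by (simp add: SU_antipode_def)

lemma bilinear_S_left: "bilinear_scal scal (\<lambda>f g. S f * g)"
  and bilinear_S_right: "bilinear_scal scal (\<lambda>f g. f * S g)"
  by (auto intro!: bilinear_scalI cvec.vector_space_axioms
    simp: linear_scalD[OF S_linear] distrib_left distrib_right)

lemma W_A: "i \<in> {1..N} \<Longrightarrow> j \<in> {1..N} \<Longrightarrow> W i j \<in> AA"
  using antipode u_A by (auto simp: SU_antipode_def)

sublocale G: rtt_group AA II N q u W
proof unfold_locales
  fix i l assume il: "i \<in> {1..N}" "l \<in> {1..N}"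
  have "contract scal (\<lambda>f g. f * S g) (Delta N (u i l)) = (\<Sum>j = 1..N. u i j * W j l)"
    "contract scal (\<lambda>f g. S f * g) (Delta N (u i l)) = (\<Sum>j = 1..N. W i j * u j l)"
    by (simp_all add: linear_scalD[OF linear_contract[OF cvec.vector_space_axioms]]
      contract_tens[OF bilinear_S_left] contract_tens[OF bilinear_S_right])
  moreover have "scal (counit (u i l)) 1 = (if i = l then 1 else (0 :: mat_alg))"
    by simp
  ultimately have "(\<Sum>j = 1..N. u i j * W j l) - (if i = l then 1 else 0) \<in> II"
    "(\<Sum>j = 1..N. W i j * u j l) - (if i = l then 1 else 0) \<in> II"
    using antipode u_A[OF il] unfolding SU_antipode_def eq_mod_def by auto
  then show "G.cg (\<Sum>j = 1..N. u i j * W j l) (if i = l then 1 else 0)"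
    "G.cg (\<Sum>j = 1..N. W i j * u j l) (if i = l then 1 else 0)"
    using il by (auto simp: G.cg_def intro!: G.A_sum G.A_mult u_A W_A G.A_0 G.A_1)
qed (use W_A in auto)

section \<open>Coproduct of the antipode, and coinvariance\<close>

lemma counit_W:
  assumes "i \<in> {1..N}" "j \<in> {1..N}"
  shows "counit (W i j) = of_bool (i = j)"
proof -
  have "counit ((\<Sum>k = 1..N. u i k * W k j) - (if i = j then 1 else 0)) = 0"
    using G.UW[OF assms] by (intro counit_ideal) (simp add: G.cg_def)
  moreover have "counit (\<Sum>k = 1..N. u i k * W k j) = (\<Sum>k = 1..N. if i = k then counit (W k j) else 0)"
    unfolding counit_simps by (intro sum.cong refl) (simp add: counit_simps)
  ultimately show ?thesis
    using assms by (auto simp: counit_simps split: if_splits)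
qed

text \<open>That the antipode reverses coproducts follows from uniqueness of inverses: Delta(W) is a
  left inverse of the matrix Delta(u), because \<open>Delta\<close> respects the ideal, and the
  right side is a right inverse of it by computation.\<close>

lemma Delta_W:
  assumes "i \<in> {1..N}" "j \<in> {1..N}"
  shows "GG.cg (Delta N (W i j)) (\<Sum>k = 1..N. tens (W k j) (W i k))"
proof -
  let ?Z = "\<lambda>m. \<Sum>k = 1..N. tens (W k j) (W m k)"
  have Z_A: "?Z m \<in> tens_alg AA AA" if "m \<in> {1..N}" for m
    using assms that by (intro GG.A_sum tens_alg_base W_A) auto
  have X_A: "Delta N (W i l) \<in> tens_alg AA AA" if "l \<in> {1..N}" for l
    using assms that by (intro Delta_matA W_A)
  have YZ: "GG.cg (\<Sum>m = 1..N. Delta N (u l m) * ?Z m) (if l = j then 1 else 0)" if l: "l \<in> {1..N}" for l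
  proof -
    have 1: "(\<Sum>m = 1..N. Delta N (u l m) * ?Z m) =
      (\<Sum>h = 1..N. \<Sum>k = 1..N. tens (u l h * W k j) (\<Sum>m = 1..N. u h m * W m k))"
    proof -
      have "(\<Sum>m = 1..N. Delta N (u l m) * ?Z m) =
        (\<Sum>m = 1..N. \<Sum>h = 1..N. \<Sum>k = 1..N. tens (u l h * W k j) (u h m * W m k))"
        by (simp add: sum_product)
      also have "\<dots> = (\<Sum>h = 1..N. \<Sum>m = 1..N. \<Sum>k = 1..N. tens (u l h * W k j) (u h m * W m k))"
        by (rule sum.swap)
      also have "\<dots> = (\<Sum>h = 1..N. \<Sum>k = 1..N. \<Sum>m = 1..N. tens (u l h * W k j) (u h m * W m k))"
        by (intro sum.cong refl sum.swap)
      finally show ?thesis by (simp add: tens_simps)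
    qed
    have 2: "GG.cg \<dots> (\<Sum>h = 1..N. \<Sum>k = 1..N. tens (u l h * W k j) (if h = k then 1 else 0))"
      using l assms by (intro GG.cg_sum tens_cg_G G.cg_refl G.UW G.A_mult u_A W_A)
    have 3: "\<dots> = (\<Sum>h = 1..N. \<Sum>k = 1..N. if h = k then tens (u l h * W k j) 1 else 0)"
      by (intro sum.cong refl) (simp add: tens_simps)
    have 4: "\<dots> = tens (\<Sum>h = 1..N. u l h * W h j) 1"
      by (simp add: tens_simps)
    have 5: "GG.cg \<dots> (tens (if l = j then 1 else 0) 1)"
      using l assms by (intro tens_cg_G G.cg_refl G.UW G.A_1)
    have 6: "tens (if l = j then 1 else 0) (1 :: mat_alg) = (if l = j then 1 else 0)"
      by (simp add: tens_simps)
    show ?thesis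
      using GG.cg_trans[OF 2[folded 1, unfolded 3 4] 5[unfolded 6]] .
  qed
  have XY: "GG.cg (\<Sum>l = 1..N. Delta N (W i l) * Delta N (u l m)) (if m = i then 1 else 0)" if m: "m \<in> {1..N}" for m
  proof -
    have "Delta N ((\<Sum>l = 1..N. W i l * u l m) - (if i = m then 1 else 0)) \<in> JJ"
      using G.WU[OF assms(1) m] by (intro Delta_ideal) (simp add: G.cg_def)
    moreover have "Delta N (if i = m then 1 else 0) = (if m = i then 1 else 0)"
      by (simp add: Delta_simps)
    ultimately have "(\<Sum>l = 1..N. Delta N (W i l) * Delta N (u l m)) - (if m = i then 1 else 0) \<in> JJ"
      by (simp only: Delta_simps)
    moreover have "(if m = i then 1 else 0) \<in> tens_alg AA AA"
      using GG.A_1 GG.A_0 by simp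
    ultimately show ?thesis
      using m by (auto simp: GG.cg_def simp del: Delta_u intro!: GG.A_sum GG.A_mult X_A Delta_u_in)
  qed
  have a: "GG.cg (\<Sum>l = 1..N. Delta N (W i l) * (\<Sum>m = 1..N. Delta N (u l m) * ?Z m))
    (\<Sum>l = 1..N. Delta N (W i l) * (if l = j then 1 else 0))"
    by (intro GG.cg_sum GG.cg_mult GG.cg_refl X_A YZ)
  have a': "(\<Sum>l = 1..N. Delta N (W i l) * (if l = j then 1 else 0)) = Delta N (W i j)"
    using assms(2) by (simp add: if_distrib cong: if_cong)
  have b': "(\<Sum>l = 1..N. Delta N (W i l) * (\<Sum>m = 1..N. Delta N (u l m) * ?Z m)) =
    (\<Sum>m = 1..N. (\<Sum>l = 1..N. Delta N (W i l) * Delta N (u l m)) * ?Z m)"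
    by (rule sum_mult_assoc)
  have b: "GG.cg \<dots> (\<Sum>m = 1..N. (if m = i then 1 else 0) * ?Z m)"
    by (intro GG.cg_sum GG.cg_mult GG.cg_refl Z_A XY)
  have c: "(\<Sum>m = 1..N. (if m = i then 1 else 0) * ?Z m) = ?Z i"
  proof -
    have "(\<Sum>m = 1..N. (if m = i then 1 else 0) * ?Z m) = (\<Sum>m = 1..N. if m = i then ?Z m else 0)"
      by (intro sum.cong refl) simp
    then show ?thesis using assms(1) by simp
  qed
  show ?thesis
    using GG.cg_trans[OF GG.cg_sym[OF a[unfolded a']] b[folded b', unfolded c]] .
qed

lemma Delta_uW:
  assumes "i \<in> {1..N}" "k \<in> {1..N}" "j \<in> {1..N}" "l \<in> {1..N}"
  shows "GG.cg (Delta N (u i k * W l j))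
    (\<Sum>c = 1..N. \<Sum>d = 1..N. tens (u i c * W d j) (u c k * W l d))"
proof -
  have "GG.cg (Delta N (u i k) * Delta N (W l j)) (Delta N (u i k) * (\<Sum>d = 1..N. tens (W d j) (W l d)))"
    using assms by (intro GG.cg_mult GG.cg_refl Delta_u_in Delta_W)
  then show ?thesis by (simp add: Delta_simps sum_product)
qed

lemma zz_A: "i \<in> {1..N} \<Longrightarrow> j \<in> {1..N} \<Longrightarrow> zz S i j \<in> AA"
  unfolding zz_def using one_in by (intro G.A_mult u_A W_A)

text \<open>In Delta(z_ij), the sum of the u^i_c S(u^d_j) (x) u^c_1 S(u^1_d), only c = 1 survives
  under \<open>alpha\<close>. The image of the first row of \<open>u W = 1\<close> shows that the
  inverse determinant times alpha(S(u^1_d)) is delta_1d, which leaves d = 1.\<close>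

lemma zz_CP:
  assumes "i \<in> {1..N}" "j \<in> {1..N}"
  shows "zz S i j \<in> CP N q"
proof -
  obtain n where N: "N = Suc n" using N_ge_2 by (cases N) auto
  interpret Un: qU n q by unfold_locales (rule q_pos)
  interpret GU: alg_ideal "tens_alg AA Un.BB" "tens_ker AA II Un.BB Un.KK"
    by (intro alg_ideal_tens G.alg_ideal_axioms Un.alg_ideal_axioms)
  note tcg = tens_cg[OF _ _ G.alg_ideal_axioms Un.alg_ideal_axioms]
  have \<alpha>_B: "alpha f \<in> Un.BB" if "f \<in> AA" for f
    using Un.alpha_matA that N by simp
  have \<alpha>u: "alpha (u k 1) = (if k = 1 then gen None else 0)" if "k \<in> {1..N}" for k
    by (simp add: alpha_u)
  have \<alpha>W: "Un.cg (gen None * alpha (W 1 l)) (if l = 1 then 1 else 0)" if l: "l \<in> {1..N}" for l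
  proof -
    have "alpha ((\<Sum>k = 1..N. u 1 k * W k l) - (if 1 = l then 1 else 0)) \<in> Un.KK"
      by (rule Un.alpha_ideal[folded N]) (rule G.cg_I[OF G.UW[OF one_in l]])
    moreover have "alpha (\<Sum>k = 1..N. u 1 k * W k l) = (\<Sum>k = 1..N. if k = 1 then gen None * alpha (W k l) else 0)"
      unfolding alpha_simps by (intro sum.cong refl) (simp add: alpha_simps alpha_u)
    ultimately show ?thesis
      using one_in l by (auto simp: Un.cg_def alpha_simps Un.A_0 Un.A_1 intro!: Un.A_mult Un.None_B \<alpha>_B W_A split: if_splits)
  qed
  have bil: "bilinear_scal scal (\<lambda>f\<^sub>1 f\<^sub>2. tens f\<^sub>1 (alpha f\<^sub>2))"
    by (auto intro!: bilinear_scalI cvec.vector_space_axioms simp: tens_simps alpha_simps)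
  let ?c = "contract scal (\<lambda>f\<^sub>1 f\<^sub>2. tens f\<^sub>1 (alpha f\<^sub>2))"
  note c_lin = linear_scalD[OF linear_contract[OF cvec.vector_space_axioms]]
  let ?D = "\<Sum>c = 1..N. \<Sum>d = 1..N. tens (u i c * W d j) (u c 1 * W 1 d)"
  have "Delta N (zz S i j) - ?D \<in> JJ"
    using Delta_uW[OF assms(1) one_in assms(2) one_in] by (simp add: zz_def GG.cg_def)
  then have "?c (Delta N (zz S i j) - ?D) \<in> tens_ker AA II Un.BB Un.KK"
    by (rule contract_tens_ker[OF bil GU.I_sub]) (auto intro: tens_ker_base \<alpha>_B Un.alpha_ideal[folded N])
  then have 1: "?c (Delta N (zz S i j)) - ?c ?D \<in> tens_ker AA II Un.BB Un.KK"
    by (simp only: c_lin)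
  have 2: "?c ?D = (\<Sum>c = 1..N. \<Sum>d = 1..N. if c = 1 then tens (u i c * W d j) (gen None * alpha (W 1 d)) else 0)"
    unfolding c_lin contract_tens[OF bil]
    by (intro sum.cong refl) (auto simp: alpha_simps \<alpha>u tens_simps simp del: One_nat_def)
  have 3: "\<dots> = (\<Sum>d = 1..N. tens (u i 1 * W d j) (gen None * alpha (W 1 d)))"
    using one_in by (subst sum.swap) simp
  have 4: "GU.cg \<dots> (\<Sum>d = 1..N. tens (u i 1 * W d j) (if d = 1 then 1 else 0))"
    using assms one_in by (intro GU.cg_sum tcg G.cg_refl \<alpha>W G.A_mult u_A W_A)
  have 5: "\<dots> = (\<Sum>d = 1..N. if d = 1 then tens (u i 1 * W d j) 1 else 0)"
    by (intro sum.cong refl) (simp add: tens_simps)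
  have 6: "\<dots> = tens (zz S i j) 1"
    using one_in by (simp add: zz_def)
  have "?c ?D - tens (zz S i j) 1 \<in> tens_ker AA II Un.BB Un.KK"
    using 4 unfolding 2 3 5 6 GU.cg_def by blast
  from GU.I_add[OF 1 this] have "?c (Delta N (zz S i j)) - tens (zz S i j) 1 \<in> tens_ker AA II Un.BB Un.KK"
    by simp
  then show ?thesis
    using zz_A[OF assms] by (simp add: CP_def eq_mod_def N)
qed

end

section \<open>The map $Q$\<close>

context SU_calculus
begin

text \<open>\<open>Tm\<close> and \<open>Tp\<close> are the entries of $T^-$ and $T^+$. As
  \<open>r\<close> reverses products in its second argument, $T^-$ is antimultiplicative, while
  $T^+$ is multiplicative.\<close>

definition Tm :: "nat \<Rightarrow> nat \<Rightarrow> mat_alg \<Rightarrow> complex"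
  where "Tm k l h = r (u k l) h"

definition Tp :: "nat \<Rightarrow> nat \<Rightarrow> mat_alg \<Rightarrow> complex"
  where "Tp k l h = r h (u k l)"

lemma r_linear: "Vector_Spaces.linear scal (*) (r f)" "Vector_Spaces.linear scal (*) (\<lambda>f. r f h)"
  using coquasi by (simp_all add: SU_coquasi_def)

lemma T_lin:
  "Tm k l (f + g) = Tm k l f + Tm k l g" "Tm k l (scal c f) = c * Tm k l f" "Tm k l 0 = 0"
  "Tm k l (f - g) = Tm k l f - Tm k l g" "Tm k l (sum h X) = (\<Sum>x\<in>X. Tm k l (h x))"
  "Tp k l (f + g) = Tp k l f + Tp k l g" "Tp k l (scal c f) = c * Tp k l f" "Tp k l 0 = 0"
  "Tp k l (f - g) = Tp k l f - Tp k l g" "Tp k l (sum h X) = (\<Sum>x\<in>X. Tp k l (h x))"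
  unfolding Tm_def Tp_def
  by (simp_all only: linear_scalD[OF r_linear(1)] linear_scalD[OF r_linear(2)])

lemma contract_Delta_u:
  assumes "bilinear_scal (*) \<beta>"
  shows "contract (*) \<beta> (Delta N (u k l)) = (\<Sum>m = 1..N. \<beta> (u k m) (u m l))"
  by (simp add: linear_scalD[OF linear_contract[OF vector_space_complex]] contract_tens[OF assms])

lemma r_mult:
  assumes "f \<in> AA" "g \<in> AA" "h \<in> AA"
  shows "r (f * g) h = contract (*) (\<lambda>h\<^sub>1 h\<^sub>2. r f h\<^sub>1 * r g h\<^sub>2) (Delta N h)"
    "r f (g * h) = contract (*) (\<lambda>f\<^sub>1 f\<^sub>2. r f\<^sub>1 h * r f\<^sub>2 g) (Delta N f)"
  using coquasi assms unfolding SU_coquasi_def by blast+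

lemma Tm_mult:
  assumes "k \<in> {1..N}" "l \<in> {1..N}" "f \<in> AA" "g \<in> AA"
  shows "Tm k l (f * g) = (\<Sum>m = 1..N. Tm k m g * Tm m l f)"
proof -
  have "bilinear_scal (*) (\<lambda>f\<^sub>1 f\<^sub>2. r f\<^sub>1 g * r f\<^sub>2 f)"
    by (intro bilinear_scalI vector_space_complex) (simp_all add: linear_scalD[OF r_linear(2)] algebra_simps)
  from contract_Delta_u[OF this] show ?thesis
    using r_mult(2)[OF u_A[OF assms(1,2)] assms(3,4)] by (simp only: Tm_def)
qed

lemma Tp_mult:
  assumes "k \<in> {1..N}" "l \<in> {1..N}" "f \<in> AA" "g \<in> AA"
  shows "Tp k l (f * g) = (\<Sum>m = 1..N. Tp k m f * Tp m l g)"
proof -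
  have "bilinear_scal (*) (\<lambda>h\<^sub>1 h\<^sub>2. r f h\<^sub>1 * r g h\<^sub>2)"
    by (intro bilinear_scalI vector_space_complex) (simp_all add: linear_scalD[OF r_linear(1)] algebra_simps)
  from contract_Delta_u[OF this] show ?thesis
    using r_mult(1)[OF assms(3,4) u_A[OF assms(1,2)]] by (simp only: Tp_def)
qed

lemma T_1:
  assumes "k \<in> {1..N}" "l \<in> {1..N}"
  shows "Tm k l 1 = (if k = l then 1 else 0)" "Tp k l 1 = (if k = l then 1 else 0)"
  using coquasi u_A[OF assms] by (simp_all add: SU_coquasi_def Tm_def Tp_def)

lemma T_ideal:
  assumes "k \<in> {1..N}" "l \<in> {1..N}" "f \<in> II"
  shows "Tm k l f = 0" "Tp k l f = 0"
  using coquasi u_A[OF assms(1,2)] assms(3) by (simp_all add: SU_coquasi_def Tm_def Tp_def)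

lemma T_cg:
  assumes "k \<in> {1..N}" "l \<in> {1..N}" "G.cg f g"
  shows "Tm k l f = Tm k l g" "Tp k l f = Tp k l g"
  using T_ideal[OF assms(1,2) G.cg_I[OF assms(3)]] by (simp_all add: T_lin)

lemma Tm_u:
  assumes "k \<in> {1..N}" "l \<in> {1..N}" "a \<in> {1..N}" "b \<in> {1..N}"
  shows "Tm k l (u a b) = inverse p * ((if l = k then if b = a then rho q a k else 0 else 0)
    + (if l = a then if b = k then nuH q a k else 0 else 0))"
proof -
  have "Tm k l (u a b) = inverse p * of_real (Rm q (a, k) (l, b))"
    using coquasi assms by (simp add: SU_coquasi_def Tm_def)
  then show ?thesis by (simp only: Rm_eq)
qed

lemma Tp_u:
  assumes "k \<in> {1..N}" "l \<in> {1..N}" "a \<in> {1..N}" "b \<in> {1..N}"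
  shows "Tp k l (u a b) = inverse p * ((if b = a then if l = k then rho q k a else 0 else 0)
    + (if b = k then if l = a then nuH q k a else 0 else 0))"
proof -
  have "Tp k l (u a b) = inverse p * of_real (Rm q (k, a) (b, l))"
    using coquasi assms by (simp add: SU_coquasi_def Tp_def)
  then show ?thesis by (simp only: Rm_eq)
qed

lemma rho_nonzero [simp]: "rho q a b \<noteq> 0"
  using q_pos by (simp add: rho_def)

text \<open>Since H(1 - k) = 0, the matrix T^+(u^1_b) vanishes for b > 1 and is diagonal for b = 1;
  \<open>u W = 1\<close> then makes T^+(S(u^1_c)) equal to delta_1c times the inverse diagonal
  matrix.\<close>

lemma Tp_W:
  assumes "k \<in> {1..N}" "l \<in> {1..N}" "c \<in> {1..N}"
  shows "Tp k l (W 1 c) = (if c = 1 then if k = l then p * inverse (rho q k 1) else 0 else 0)"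
proof -
  have "Tp k l (\<Sum>b = 1..N. u 1 b * W b c) = (\<Sum>b = 1..N. \<Sum>m = 1..N. Tp k m (u 1 b) * Tp m l (W b c))"
    unfolding T_lin using assms one_in by (intro sum.cong refl Tp_mult u_A W_A)
  also have "\<dots> = (\<Sum>b = 1..N. \<Sum>m = 1..N. if m = k then if b = 1 then inverse p * rho q k 1 * Tp m l (W b c) else 0 else 0)"
    using assms one_in by (intro sum.cong refl) (auto simp: Tp_u nuH_def simp del: One_nat_def)
  also have "\<dots> = inverse p * rho q k 1 * Tp k l (W 1 c)"
    using assms one_in by simp
  finally have "inverse p * rho q k 1 * Tp k l (W 1 c) = Tp k l (if 1 = c then 1 else 0)"
    using T_cg(2)[OF assms(1,2) G.UW[OF one_in assms(3)]] by simp
  then show ?thesis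
    using T_1[OF assms(1,2)] by (auto simp: T_lin field_simps split: if_splits)
qed

text \<open>Up to the factor p, the entry (b, 1) of T^-(S(u^1_b)) for b >= 2. Its shape comes from a
  recursion with ratio q^{-2}.\<close>

definition tau :: "nat \<Rightarrow> complex"
  where "tau b = - (G.nu * of_real (q powi (2 - 2 * int b)))"

text \<open>T^- is applied to the first row of \<open>W u = 1\<close>; as it reverses factors, the
  known matrices T^-(u^b_c) stand on the left.\<close>

lemma Tm_W_eq:
  assumes "k \<in> {1..N}" "l \<in> {1..N}" "c \<in> {1..N}"
  shows "rho q c k * Tm k l (W 1 c) + (if k = c then \<Sum>b = 1..N. nuH q b k * Tm b l (W 1 b) else 0) =
    (if c = 1 then if k = l then p else 0 else 0)"
proof -
  have "Tm k l (\<Sum>b = 1..N. W 1 b * u b c) = (\<Sum>b = 1..N. \<Sum>m = 1..N. Tm k m (u b c) * Tm m l (W 1 b))"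
    unfolding T_lin using assms one_in by (intro sum.cong refl Tm_mult u_A W_A)
  also have "\<dots> = (\<Sum>b = 1..N. \<Sum>m = 1..N. (if m = k then if c = b then inverse p * rho q b k * Tm m l (W 1 b) else 0 else 0)
    + (if m = b then if c = k then inverse p * nuH q b k * Tm m l (W 1 b) else 0 else 0))"
    using assms by (intro sum.cong refl) (auto simp: Tm_u algebra_simps)
  also have "\<dots> = inverse p * rho q c k * Tm k l (W 1 c) + (\<Sum>b = 1..N. if c = k then inverse p * nuH q b k * Tm b l (W 1 b) else 0)"
    using assms by (simp add: sum.distrib)
  finally have "inverse p * (rho q c k * Tm k l (W 1 c) + (if k = c then \<Sum>b = 1..N. nuH q b k * Tm b l (W 1 b) else 0))
    = Tm k l (if 1 = c then 1 else 0)"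
    using T_cg(1)[OF assms(1,2) G.WU[OF one_in assms(3)]] by (auto simp: distrib_left sum_distrib_left mult.assoc)
  then have "p * (inverse p * (rho q c k * Tm k l (W 1 c) + (if k = c then \<Sum>b = 1..N. nuH q b k * Tm b l (W 1 b) else 0)))
    = p * Tm k l (if 1 = c then 1 else 0)"
    by simp
  then have "rho q c k * Tm k l (W 1 c) + (if k = c then \<Sum>b = 1..N. nuH q b k * Tm b l (W 1 b) else 0)
    = p * Tm k l (if 1 = c then 1 else 0)"
    by (simp only: mult.assoc[symmetric] right_inverse[OF p_nonzero] mult_1_left)
  then show ?thesis
    using T_1[OF assms(1,2)] by (simp add: T_lin)
qed

lemma Tm_W:
  assumes "k \<in> {1..N}" "l \<in> {1..N}" "b \<in> {1..N}"
  shows "Tm k l (W 1 b) = p * (if b = 1 then if k = l then inverse (rho q k 1) else 0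
    else if k = b then if l = 1 then tau b else 0 else 0)"
proof (cases "k = b")
  case False
  then show ?thesis
    using Tm_W_eq[OF assms] by (auto simp: rho_def)
next
  case True
  let ?X = "\<lambda>b. Tm b l (W 1 b)"
  let ?d = "if l = 1 then p else 0"
  have eq: "of_real q * ?X k + G.nu * (\<Sum>b = 1..<k. ?X b) = (if k = 1 then ?d else 0)" if "k \<in> {1..N}" for k
  proof -
    have "(\<Sum>b = 1..N. nuH q b k * ?X b) = (\<Sum>b = 1..<k. G.nu * ?X b)"
      using that by (intro sum.mono_neutral_cong_right) (auto simp: nuH_def)
    then show ?thesis
      using Tm_W_eq[OF that assms(2) that] by (auto simp: rho_def sum_distrib_left)
  qed
  \<comment> \<open>The partial sums satisfy Y_{k+1} = (1 - nu/q) Y_k with 1 - nu/q = q^{-2},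
    starting from \<open>?d\<close>/q; each entry with b >= 2 is then -nu/q times the preceding
    partial sum.\<close>
  have Y: "(\<Sum>b = 1..<Suc k. ?X b) = ?d * of_real (q powi (1 - 2 * int k))" if "1 \<le> k" "k \<le> N" for k
    using that
  proof (induction k rule: dec_induct)
    case base
    then have "of_real q * ?X 1 = ?d" using eq[of 1] one_in by simp
    then have "?X 1 = inverse (of_real q) * ?d" using q_pos by (simp add: field_simps)
    then show ?case by (simp add: power_int_minus)
  next
    case (step k)
    then have IH: "(\<Sum>b = 1..<Suc k. ?X b) = ?d * of_real (q powi (1 - 2 * int k))" by simp
    have "of_real q * ?X (Suc k) = - (G.nu * (\<Sum>b = 1..<Suc k. ?X b))"
      using eq[of "Suc k"] step by (simp add: add_eq_0_iff)
    then have X: "?X (Suc k) = - (inverse (of_real q) * G.nu * (\<Sum>b = 1..<Suc k. ?X b))"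
      using q_pos by (simp add: field_simps)
    have "(\<Sum>b = 1..<Suc (Suc k). ?X b) = (1 - inverse (of_real q) * G.nu) * (\<Sum>b = 1..<Suc k. ?X b)"
      using step.hyps X by (simp add: algebra_simps)
    also have "1 - inverse (of_real q) * G.nu = of_real (q powi - 2)"
      using q_pos by (simp add: power_int_minus right_diff_distrib power2_eq_square)
    also have "of_real (q powi - 2) * (\<Sum>b = 1..<Suc k. ?X b) = ?d * of_real (q powi - 2 * q powi (1 - 2 * int k))"
      unfolding IH by simp
    also have "q powi - 2 * q powi (1 - 2 * int k) = q powi (- 2 + (1 - 2 * int k))"
      by (rule power_int_add[symmetric]) (use q_pos in simp)
    finally show ?case by (simp add: algebra_simps)
  qed
  show ?thesis
  proof (cases "b = 1")
    case b1: True
    then have "of_real q * ?X 1 = ?d" using eq[of 1] one_in by simp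
    then have "?X 1 = inverse (of_real q) * ?d" using q_pos by (simp add: field_simps)
    then show ?thesis using True b1 by (simp add: rho_def eq_commute[of l])
  next
    case b2: False
    then have b: "1 \<le> b - 1" "b - 1 \<le> N" "Suc (b - 1) = b" using assms(3) by auto
    have e: "int (b - 1) = int b - 1" using b by simp
    have pw: "q powi (1 - 2 * int (b - 1)) = q * q powi (2 - 2 * int b)"
      using power_int_add[of q 1 "2 - 2 * int b"] q_pos unfolding e by (simp add: algebra_simps)
    have "of_real q * ?X b = - (G.nu * (?d * of_real (q * q powi (2 - 2 * int b))))"
      using eq[OF assms(3)] b2 Y[OF b(1,2)] unfolding b(3) pw by (simp add: add_eq_0_iff)
    then have "of_real q * ?X b = of_real q * (?d * tau b)"
      by (simp add: tau_def)
    then have "?X b = ?d * tau b" using q_pos by simp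
    then show ?thesis using True b2 by simp
  qed
qed

text \<open>$Q_{kl}(h)$ as a function of \<open>\<Delta> h\<close>, and of \<open>h\<close>.\<close>

definition Qt :: "nat \<Rightarrow> nat \<Rightarrow> form \<Rightarrow> complex"
  where "Qt k l = contract (*) (\<lambda>f g. \<Sum>m = 1..N. Tm k m f * Tp m l g)"

definition Q :: "nat \<Rightarrow> nat \<Rightarrow> mat_alg \<Rightarrow> complex"
  where "Q k l h = Qt k l (Delta N h)"

lemma bilinear_Qt: "bilinear_scal (*) (\<lambda>f g. \<Sum>m = 1..N. Tm k m f * Tp m l g)"
  by (intro bilinear_scalI vector_space_complex)
    (simp_all add: T_lin algebra_simps sum.distrib sum_distrib_left)

lemmas Qt_lin = linear_scalD[OF linear_contract[OF vector_space_complex, of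
  "\<lambda>f g. \<Sum>m = 1..N. Tm k m f * Tp m l g" for k l], folded Qt_def]

lemma Qt_tens: "Qt k l (tens f g) = (\<Sum>m = 1..N. Tm k m f * Tp m l g)"
  unfolding Qt_def by (rule contract_tens[OF bilinear_Qt])

lemma Qform_eq: "Qform N r h (u k l) = Q k l h"
proof -
  have "contract (*) (\<lambda>g\<^sub>1 g\<^sub>2. r g\<^sub>1 h\<^sub>1 * r h\<^sub>2 g\<^sub>2) (Delta N (u k l)) = (\<Sum>m = 1..N. Tm k m h\<^sub>1 * Tp m l h\<^sub>2)" for h\<^sub>1 h\<^sub>2
  proof -
    have "bilinear_scal (*) (\<lambda>g\<^sub>1 g\<^sub>2. r g\<^sub>1 h\<^sub>1 * r h\<^sub>2 g\<^sub>2)"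
      by (intro bilinear_scalI vector_space_complex)
        (simp_all add: linear_scalD[OF r_linear(1)] linear_scalD[OF r_linear(2)] algebra_simps)
    from contract_Delta_u[OF this] show ?thesis by (simp add: Tm_def Tp_def)
  qed
  then show ?thesis by (simp add: Qform_def Q_def Qt_def)
qed

lemma Q_lin: "Q k l (f + g) = Q k l f + Q k l g" "Q k l (scal c f) = c * Q k l f" "Q k l 0 = 0"
  "Q k l (f - g) = Q k l f - Q k l g" "Q k l (sum h X) = (\<Sum>x\<in>X. Q k l (h x))"
  by (simp_all add: Q_def Delta_simps Qt_lin)

lemma Qt_ker:
  assumes "k \<in> {1..N}" "l \<in> {1..N}" "t \<in> JJ"
  shows "Qt k l t = 0"
proof -
  have "Qt k l t \<in> {0}"
    unfolding Qt_def
  proof (rule contract_tens_ker[OF bilinear_Qt _ assms(3)])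
    have "module ((*) :: complex \<Rightarrow> complex \<Rightarrow> complex)"
      by unfold_locales (simp_all add: algebra_simps)
    then show "module.subspace (*) {0 :: complex}"
      by (simp add: module.subspace_def)
  qed (use assms in \<open>auto simp: T_ideal intro!: sum.neutral\<close>)
  then show ?thesis by simp
qed

text \<open>On pure tensors, antimultiplicativity of \<open>Tm\<close> puts the new factor on the
  far left and multiplicativity of \<open>Tp\<close> on the far right, so the old matrix stays in
  the middle.\<close>

lemma Qt_mult:
  assumes "k \<in> {1..N}" "l \<in> {1..N}" "f \<in> AA" "g \<in> AA" "t \<in> tens_alg AA AA"
  shows "Qt k l (t * tens f g) = (\<Sum>x = 1..N. \<Sum>y = 1..N. Tm k x f * Qt x y t * Tp y l g)"
proof -
  have base: "Qt k l (tens a b * tens f g) = (\<Sum>x = 1..N. \<Sum>y = 1..N. Tm k x f * Qt x y (tens a b) * Tp y l g)"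
    if "a \<in> AA" "b \<in> AA" for a b
  proof -
    have "Qt k l (tens a b * tens f g) = (\<Sum>m = 1..N. (\<Sum>x = 1..N. Tm k x f * Tm x m a) * (\<Sum>y = 1..N. Tp m y b * Tp y l g))"
      unfolding tens_mult Qt_tens using assms that by (intro sum.cong refl) (simp add: Tm_mult Tp_mult)
    also have "\<dots> = (\<Sum>m = 1..N. \<Sum>x = 1..N. \<Sum>y = 1..N. Tm k x f * (Tm x m a * Tp m y b) * Tp y l g)"
      by (simp add: sum_product mult.assoc)
    also have "\<dots> = (\<Sum>x = 1..N. \<Sum>m = 1..N. \<Sum>y = 1..N. Tm k x f * (Tm x m a * Tp m y b) * Tp y l g)"
      by (rule sum.swap)
    also have "\<dots> = (\<Sum>x = 1..N. \<Sum>y = 1..N. \<Sum>m = 1..N. Tm k x f * (Tm x m a * Tp m y b) * Tp y l g)"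
      by (intro sum.cong refl sum.swap)
    finally show ?thesis
      by (simp add: Qt_tens sum_distrib_left sum_distrib_right)
  qed
  have "tens_alg AA AA \<subseteq> {t. Qt k l (t * tens f g) = (\<Sum>x = 1..N. \<Sum>y = 1..N. Tm k x f * Qt x y t * Tp y l g)}"
    unfolding tens_alg_def
  proof (rule cvec.span_minimal)
    show "{tens f g | f g. f \<in> AA \<and> g \<in> AA} \<subseteq>
      {t. Qt k l (t * tens f g) = (\<Sum>x = 1..N. \<Sum>y = 1..N. Tm k x f * Qt x y t * Tp y l g)}"
      using base by auto
    show "cvec.subspace {t. Qt k l (t * tens f g) = (\<Sum>x = 1..N. \<Sum>y = 1..N. Tm k x f * Qt x y t * Tp y l g)}"
      by (auto simp: cvec.subspace_def Qt_lin algebra_simps sum.distrib sum_distrib_left)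
  qed
  then show ?thesis using assms(5) by blast
qed

lemma Q_1: "k \<in> {1..N} \<Longrightarrow> l \<in> {1..N} \<Longrightarrow> Q k l 1 = (if k = l then 1 else 0)"
proof -
  assume "k \<in> {1..N}" "l \<in> {1..N}"
  then have "Q k l 1 = (\<Sum>m = 1..N. if m = k then if k = l then 1 else 0 else 0)"
    unfolding Q_def Delta_simps tens_1_1[symmetric] Qt_tens
    by (intro sum.cong refl) (auto simp: T_1)
  then show ?thesis using \<open>k \<in> {1..N}\<close> by simp
qed

text \<open>The Hecke relation again: the product of the two matrices of \<open>r\<close> is the
  identity plus nu times R, with p^{-2} from the two normalisations.\<close>

lemma Q_u:
  assumes "k \<in> {1..N}" "l \<in> {1..N}" "i \<in> {1..N}" "j \<in> {1..N}"
  shows "Q k l (u i j) = inverse p ^ 2 * ((if i = j then if k = l then 1 else 0 else 0) + G.nu * of_real (Rm q (i, k) (j, l)))"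
proof -
  have "Q k l (u i j) = (\<Sum>m = 1..N. \<Sum>n = 1..N. Tm k n (u i m) * Tp n l (u m j))"
    by (simp add: Q_def Qt_lin Qt_tens)
  also have "\<dots> = (\<Sum>m = 1..N. \<Sum>n = 1..N. (if n = k then if m = i then inverse p * rho q i k * Tp k l (u i j) else 0 else 0)
    + (if n = i then if m = k then inverse p * nuH q i k * Tp i l (u k j) else 0 else 0))"
    using assms by (intro sum.cong refl) (auto simp: Tm_u algebra_simps)
  also have "\<dots> = inverse p * rho q i k * Tp k l (u i j) + inverse p * nuH q i k * Tp i l (u k j)"
    using assms by (simp add: sum.distrib)
  finally have "Q k l (u i j) = inverse p ^ 2 * (rho q i k * of_real (Rm q (k, i) (j, l)) + nuH q i k * of_real (Rm q (i, k) (j, l)))"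
    using assms by (simp only: Tp_u Rm_eq) (simp add: power2_eq_square algebra_simps)
  moreover have "rho q i k * of_real (Rm q (k, i) (j, l)) + nuH q i k * of_real (Rm q (i, k) (j, l)) =
    (if i = j then if k = l then 1 else 0 else 0) + G.nu * of_real (Rm q (i, k) (j, l))"
    using q_pos by (cases i k rule: linorder_cases) (auto simp: Rm_eq rho_def nuH_def algebra_simps)
  ultimately show ?thesis by simp
qed


lemma q_nonzero [simp]: "q \<noteq> 0"
  using q_pos by simp

lemma Q_neg: "Q k l (- f) = - Q k l f"
  using Q_lin(4)[of k l 0 f] by (simp add: Q_lin(3))

text \<open>The part of Q(h z_ab) that is independent of b: this matrix is p times the sum over e of
  T^-(u^a_e) Q(h) T^+(u^e_1 S(u^1_1)), and Q(h z_ab) is p^{-1} T^-(S(u^1_b)) times it.\<close>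

definition Qr :: "nat \<Rightarrow> mat_alg \<Rightarrow> nat \<Rightarrow> nat \<Rightarrow> complex"
  where "Qr a h m l = (if a = 1 then rho q 1 m * Q m l h else 0)
    + (if 1 < l then G.nu * ((if l = a then rho q a m * Q m 1 h else 0) + (if m = l then nuH q a l * Q a 1 h else 0)) else 0)"

text \<open>In Delta(z_ab) only the terms with d = 1 contribute, since T^+(S(u^1_d)) vanishes for d
  > 1. The sums over intermediate indices collapse because each of the explicit matrices is
  supported on at most two index patterns.\<close>

lemma Q_mult_zz:
  assumes h: "h \<in> AA" and in_V: "a \<in> {1..N}" "b \<in> {1..N}" "k \<in> {1..N}" "l \<in> {1..N}"
  shows "Q k l (h * zz S a b) = (if b = 1 then inverse (rho q k 1) * Qr a h k l
    else if k = b then tau b * Qr a h 1 l else 0)"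
proof -
  note V = in_V one_in
  define c where "c = p * inverse (rho q l 1)"
  define Gx where "Gx x e = (if e = 1 then rho q l 1 * Q x l h else 0) + (if e = l then nuH q 1 l * Q x 1 h else 0)" for x e
  define D where "D m = rho q a m * Gx m a + nuH q a m * Gx a m" for m
  have D: "inverse (rho q l 1) * D m = Qr a h m l" for m
    using in_V by (auto simp: D_def Gx_def Qr_def rho_def nuH_def)
  let ?D = "\<Sum>e = 1..N. \<Sum>d = 1..N. tens (u a e * W d b) (u e 1 * W 1 d)"
  have "Delta N (zz S a b) - ?D \<in> JJ"
    using Delta_uW[OF in_V(1) one_in in_V(2) one_in] by (simp add: zz_def GG.cg_def)
  then have "Delta N h * (Delta N (zz S a b) - ?D) \<in> JJ"
    by (rule GG.I_left[OF Delta_matA[OF h]])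
  then have "Qt k l (Delta N h * (Delta N (zz S a b) - ?D)) = 0"
    using in_V by (intro Qt_ker)
  then have "Q k l (h * zz S a b) = Qt k l (Delta N h * ?D)"
    by (simp only: Q_def Delta_simps right_diff_distrib Qt_lin) (simp only: right_minus_eq)
  also have "\<dots> = (\<Sum>e = 1..N. \<Sum>d = 1..N. Qt k l (Delta N h * tens (u a e * W d b) (u e 1 * W 1 d)))"
    by (simp only: sum_distrib_left Qt_lin)
  also have "\<dots> = (\<Sum>e = 1..N. \<Sum>d = 1..N. if d = 1 then
    \<Sum>x = 1..N. Tm k x (u a e * W 1 b) * (c * (\<Sum>y = 1..N. Q x y h * Tp y l (u e 1))) else 0)"
  proof (intro sum.cong refl)
    fix e d assume ed: "e \<in> {1..N}" "d \<in> {1..N}"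
    have Tp: "Tp y l (u e 1 * W 1 d) = (if d = 1 then c * Tp y l (u e 1) else 0)" if y: "y \<in> {1..N}" for y
    proof -
      have "Tp y l (u e 1 * W 1 d) = (\<Sum>m = 1..N. Tp y m (u e 1) * Tp m l (W 1 d))"
        using V ed y by (intro Tp_mult u_A W_A)
      also have "\<dots> = (\<Sum>m = 1..N. if m = l then if d = 1 then c * Tp y l (u e 1) else 0 else 0)"
        using V ed by (intro sum.cong refl) (auto simp: Tp_W c_def simp del: One_nat_def)
      finally show ?thesis using in_V by simp
    qed
    have "Qt k l (Delta N h * tens (u a e * W d b) (u e 1 * W 1 d)) =
      (\<Sum>x = 1..N. \<Sum>y = 1..N. Tm k x (u a e * W d b) * Q x y h * Tp y l (u e 1 * W 1 d))"
      unfolding Q_def using V ed by (intro Qt_mult Delta_matA h G.A_mult u_A W_A)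
    also have "\<dots> = (\<Sum>x = 1..N. \<Sum>y = 1..N. if d = 1 then Tm k x (u a e * W 1 b) * (c * (Q x y h * Tp y l (u e 1))) else 0)"
      by (intro sum.cong refl) (simp add: Tp del: One_nat_def)
    finally show "Qt k l (Delta N h * tens (u a e * W d b) (u e 1 * W 1 d)) = (if d = 1 then
      \<Sum>x = 1..N. Tm k x (u a e * W 1 b) * (c * (\<Sum>y = 1..N. Q x y h * Tp y l (u e 1))) else 0)"
      by (auto simp: sum_distrib_left)
  qed
  also have "\<dots> = (\<Sum>e = 1..N. \<Sum>x = 1..N. Tm k x (u a e * W 1 b) * (c * (\<Sum>y = 1..N. Q x y h * Tp y l (u e 1))))"
    using one_in by simp
  also have "\<dots> = (\<Sum>e = 1..N. \<Sum>x = 1..N. (\<Sum>m = 1..N. Tm k m (W 1 b) * Tm m x (u a e)) * (inverse (rho q l 1) * Gx x e))"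
  proof (intro sum.cong refl)
    fix e x assume ex: "e \<in> {1..N}" "x \<in> {1..N}"
    have 1: "Tm k x (u a e * W 1 b) = (\<Sum>m = 1..N. Tm k m (W 1 b) * Tm m x (u a e))"
      using V ex by (intro Tm_mult u_A W_A)
    have "(\<Sum>y = 1..N. Q x y h * Tp y l (u e 1)) = (\<Sum>y = 1..N.
      (if y = l then if e = 1 then inverse p * (rho q l 1 * Q x l h) else 0 else 0)
      + (if y = 1 then if e = l then inverse p * (nuH q 1 l * Q x 1 h) else 0 else 0))"
      using V ex by (intro sum.cong refl) (auto simp: Tp_u algebra_simps)
    also have "\<dots> = inverse p * Gx x e"
      using V by (simp add: sum.distrib Gx_def distrib_left)
    finally have 2: "c * (\<Sum>y = 1..N. Q x y h * Tp y l (u e 1)) = inverse (rho q l 1) * Gx x e"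
      by (simp add: c_def)
    show "Tm k x (u a e * W 1 b) * (c * (\<Sum>y = 1..N. Q x y h * Tp y l (u e 1))) =
      (\<Sum>m = 1..N. Tm k m (W 1 b) * Tm m x (u a e)) * (inverse (rho q l 1) * Gx x e)"
      unfolding 1 2 ..
  qed
  also have "\<dots> = inverse (rho q l 1) * (\<Sum>e = 1..N. \<Sum>x = 1..N. \<Sum>m = 1..N. Tm k m (W 1 b) * (Tm m x (u a e) * Gx x e))"
    by (simp add: sum_distrib_left sum_distrib_right algebra_simps)
  also have "(\<Sum>e = 1..N. \<Sum>x = 1..N. \<Sum>m = 1..N. Tm k m (W 1 b) * (Tm m x (u a e) * Gx x e)) =
    (\<Sum>m = 1..N. Tm k m (W 1 b) * (\<Sum>e = 1..N. \<Sum>x = 1..N. Tm m x (u a e) * Gx x e))"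
  proof -
    have "(\<Sum>e = 1..N. \<Sum>x = 1..N. \<Sum>m = 1..N. Tm k m (W 1 b) * (Tm m x (u a e) * Gx x e)) =
      (\<Sum>e = 1..N. \<Sum>m = 1..N. \<Sum>x = 1..N. Tm k m (W 1 b) * (Tm m x (u a e) * Gx x e))"
      by (intro sum.cong refl sum.swap)
    also have "\<dots> = (\<Sum>m = 1..N. \<Sum>e = 1..N. \<Sum>x = 1..N. Tm k m (W 1 b) * (Tm m x (u a e) * Gx x e))"
      by (rule sum.swap)
    finally show ?thesis by (simp add: sum_distrib_left)
  qed
  also have "\<dots> = (\<Sum>m = 1..N. Tm k m (W 1 b) * (inverse p * D m))"
  proof (intro sum.cong refl arg_cong2[where f = "(*)"])
    fix m assume m: "m \<in> {1..N}"
    have "(\<Sum>e = 1..N. \<Sum>x = 1..N. Tm m x (u a e) * Gx x e) = (\<Sum>e = 1..N. \<Sum>x = 1..N.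
      (if x = m then if e = a then inverse p * (rho q a m * Gx m a) else 0 else 0)
      + (if x = a then if e = m then inverse p * (nuH q a m * Gx a m) else 0 else 0))"
      using V m by (intro sum.cong refl) (auto simp: Tm_u algebra_simps)
    also have "\<dots> = inverse p * D m"
      using V m by (simp add: sum.distrib D_def distrib_left)
    finally show "(\<Sum>e = 1..N. \<Sum>x = 1..N. Tm m x (u a e) * Gx x e) = inverse p * D m" .
  qed
  also have "\<dots> = (\<Sum>m = 1..N. if b = 1 then if m = k then inverse (rho q k 1) * D m else 0
      else if m = 1 then if k = b then tau b * D m else 0 else 0)"
    using V by (intro sum.cong refl) (auto simp: Tm_W simp del: One_nat_def)
  also have "\<dots> = (if b = 1 then inverse (rho q k 1) * D k else if k = b then tau b * D 1 else 0)"
    using V by simp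
  finally have "Q k l (h * zz S a b) = inverse (rho q l 1) * (if b = 1 then inverse (rho q k 1) * D k else if k = b then tau b * D 1 else 0)" .
  then show ?thesis
    by (simp add: mult.left_commute[of "inverse (rho q l 1)"] D[symmetric])
qed

lemma Q_zz:
  assumes "a \<in> {1..N}" "b \<in> {1..N}" "k \<in> {1..N}" "l \<in> {1..N}"
  shows "Q k l (zz S a b) = (if b = 1 then inverse (rho q k 1) * Qr a 1 k l
    else if k = b then tau b * Qr a 1 1 l else 0)"
  using Q_mult_zz[OF G.A_1 assms] by simp

lemma counit_zz: "i \<in> {1..N} \<Longrightarrow> j \<in> {1..N} \<Longrightarrow> counit (zz S i j) = (if i = 1 \<and> j = 1 then 1 else 0)"
  using one_in by (simp add: zz_def counit_simps counit_W del: One_nat_def)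

section \<open>The ideal and the classes of the z\<close>

abbreviation "Ap \<equiv> matA_plus N"
abbreviation "IS \<equiv> I_SU N q S r"

lemma subspace_Ap: "cvec.subspace Ap"
  by (auto simp: cvec.subspace_def matA_plus_def counit_simps G.A_closed)

lemma subspace_IS: "cvec.subspace IS"
  by (simp add: I_SU_def)

lemmas IS_closed = cvec.subspace_0[OF subspace_IS] cvec.subspace_add[OF subspace_IS]
  cvec.subspace_diff[OF subspace_IS] cvec.subspace_scale[OF subspace_IS]
  cvec.subspace_sum[OF subspace_IS] cvec.subspace_neg[OF subspace_IS]

lemma Ap_mult: "f \<in> Ap \<Longrightarrow> g \<in> AA \<Longrightarrow> f * g \<in> Ap"
  by (simp add: matA_plus_def counit_simps G.A_mult)

lemma II_IS: "II \<subseteq> IS"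
  unfolding I_SU_def by (auto intro: cvec.span_base)

lemma II_Ap: "II \<subseteq> Ap"
  using G.I_A counit_ideal by (auto simp: matA_plus_def)

lemma kerQ_IS:
  assumes "h \<in> Ap" "\<And>k l. k \<in> {1..N} \<Longrightarrow> l \<in> {1..N} \<Longrightarrow> Q k l h = 0"
  shows "h \<in> IS"
  using assms unfolding I_SU_def
  by (intro cvec.span_base) (simp add: kerQ_def matA_plus_def Qform_eq)

lemma zz_diag_IS: "k \<in> {2..N} \<Longrightarrow> zz S k k \<in> IS"
  unfolding I_SU_def zz_def by (intro cvec.span_base) blast

lemma u_offdiag_IS: "k \<in> {2..N} \<Longrightarrow> l \<in> {2..N} \<Longrightarrow> k \<noteq> l \<Longrightarrow> u k l \<in> IS"
  unfolding I_SU_def by (intro cvec.span_base) blast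

lemma u_offdiag_Ap: "k \<in> {1..N} \<Longrightarrow> l \<in> {1..N} \<Longrightarrow> k \<noteq> l \<Longrightarrow> u k l \<in> Ap"
  by (simp add: matA_plus_def u_A)

lemma zz_Ap: "k \<in> {1..N} \<Longrightarrow> l \<in> {1..N} \<Longrightarrow> (k, l) \<noteq> (1, 1) \<Longrightarrow> zz S k l \<in> Ap"
  by (auto simp: matA_plus_def zz_A counit_zz)

lemma IS_Ap: "IS \<subseteq> Ap"
  unfolding I_SU_def
proof (rule cvec.span_minimal[OF _ subspace_Ap])
  have "{u i 1 * W 1 i | i. i \<in> {2..N}} \<subseteq> Ap"
    using zz_Ap unfolding zz_def by auto
  then show "II \<union> (kerQ N r \<inter> Ap) \<union> {u i 1 * W 1 i | i. i \<in> {2..N}} \<union>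
      {u i j | i j. i \<in> {2..N} \<and> j \<in> {2..N} \<and> i \<noteq> j} \<subseteq> Ap"
    using II_Ap u_offdiag_Ap by auto
qed

lemma Q_u_offdiag:
  assumes "k \<in> {1..N}" "l \<in> {1..N}" "i \<in> {1..N}" "j \<in> {1..N}" "i \<noteq> j"
  shows "Q k l (u i j) = (if k = j then if l = i then inverse p ^ 2 * G.nu else 0 else 0)"
  using assms(5) by (auto simp: Q_u[OF assms(1-4)] Rm_eq rho_def)

lemma Q_zz_diag:
  assumes "k \<in> {1..N}" "l \<in> {1..N}" "i \<in> {2..N}"
  shows "Q k l (zz S i i) = (if k = i then if l = i then tau i * G.nu else 0 else 0)"
  using assms one_in by (auto simp: Q_zz Qr_def Q_1 rho_def)

lemma tau_powi: "tau k * of_real (q powi (2 * int k - 2)) = - G.nu"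
proof -
  have "q powi (2 - 2 * int k) * q powi (2 * int k - 2) = q powi ((2 - 2 * int k) + (2 * int k - 2))"
    by (rule power_int_add[symmetric]) (use q_pos in simp)
  then have "q powi (2 - 2 * int k) * q powi (2 * int k - 2) = 1" by simp
  then have "complex_of_real (q powi (2 - 2 * int k)) * of_real (q powi (2 * int k - 2)) = 1"
    by (metis of_real_1 of_real_mult)
  then show ?thesis by (simp only: tau_def mult_minus_left mult.assoc mult_1_right)
qed

text \<open>The generators of \<open>I_SU\<close> other than $\ker Q$ have as \<open>Q\<close>-images the matrix units
  with both indices at least 2, up to a factor that divides $\nu^2$.\<close>

lemma IS_criterion:
  assumes h: "h \<in> Ap"
    and Qh: "\<And>k l. k \<in> {1..N} \<Longrightarrow> l \<in> {1..N} \<Longrightarrow> Q k l h = (if 2 \<le> k \<and> 2 \<le> l then G.nu ^ 2 * c k l else 0)"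
  shows "h \<in> IS"
proof -
  \<comment> \<open>The coefficients make Q(e k l) equal to nu^2 c(k, l) times the matrix unit (k,
    l). Off the diagonal that unit comes from u^l_k, indices exchanged, with factor p^{-2} nu; on
    the diagonal z_kk carries -nu^2 q^{2-2k}.\<close>
  define e where "e k l = (if k = l then scal (- (of_real (q powi (2 * int k - 2)) * c k k)) (zz S k k)
    else scal (G.nu * p ^ 2 * c k l) (u l k))" for k l
  have e_IS: "e k l \<in> IS" if "k \<in> {2..N}" "l \<in> {2..N}" for k l
  proof (cases "k = l")
    case True
    then show ?thesis
      unfolding e_def if_P[OF True] using that by (intro IS_closed(4) zz_diag_IS)
  next
    case False
    then show ?thesis
      unfolding e_def if_not_P[OF False] using that by (intro IS_closed(4) u_offdiag_IS) auto
  qed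
  have Q_e: "Q x y (e k l) = (if k = x then if l = y then G.nu ^ 2 * c x y else 0 else 0)"
    if "k \<in> {2..N}" "l \<in> {2..N}" "x \<in> {1..N}" "y \<in> {1..N}" for k l x y
  proof (cases "k = l")
    case True
    have "- (of_real (q powi (2 * int k - 2)) * c k k) * (tau k * G.nu) =
      - (tau k * of_real (q powi (2 * int k - 2))) * G.nu * c k k"
      by (simp add: algebra_simps)
    also have "\<dots> = G.nu ^ 2 * c k k" unfolding tau_powi by (simp add: power2_eq_square)
    finally show ?thesis
      using True that(2-) by (auto simp: e_def Q_lin Q_neg Q_zz_diag simp del: of_real_diff)
  next
    case False
    have "G.nu * p ^ 2 * c k l * (inverse p ^ 2 * G.nu) = (p * inverse p) ^ 2 * (G.nu ^ 2 * c k l)"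
      by (simp only: power2_eq_square ac_simps)
    also have "\<dots> = G.nu ^ 2 * c k l" by simp
    finally show ?thesis
      using False that by (auto simp: e_def Q_lin Q_u_offdiag simp del: of_real_diff)
  qed
  let ?E = "\<Sum>k = 2..N. \<Sum>l = 2..N. e k l"
  have E: "?E \<in> IS" by (intro IS_closed(5) e_IS)
  have "h - ?E \<in> IS"
  proof (rule kerQ_IS)
    show "h - ?E \<in> Ap"
      using h E IS_Ap by (auto intro: cvec.subspace_diff[OF subspace_Ap])
    fix x y assume xy: "x \<in> {1..N}" "y \<in> {1..N}"
    have "Q x y ?E = (\<Sum>k = 2..N. \<Sum>l = 2..N. if k = x then if l = y then G.nu ^ 2 * c x y else 0 else 0)"
      unfolding Q_lin using xy by (intro sum.cong refl Q_e)
    also have "\<dots> = (if 2 \<le> x \<and> 2 \<le> y then G.nu ^ 2 * c x y else 0)"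
      using xy by (subst sum.swap) (cases "2 \<le> x"; cases "2 \<le> y"; simp)
    finally show "Q x y (h - ?E) = 0"
      by (simp add: Q_lin Qh[OF xy])
  qed
  from IS_closed(2)[OF this E] show ?thesis by simp
qed

text \<open>All generators of the ideal have images supported in the block with both indices at
  least 2. The first row and column of \<open>Q\<close> are thus functionals on the
  quotient.\<close>

lemma Q_IS_border:
  assumes "v \<in> IS" "k \<in> {1..N}"
  shows "Q 1 k v = 0" "Q k 1 v = 0"
proof -
  let ?T = "{v. Q 1 k v = 0 \<and> Q k 1 v = 0}"
  have "Q 1 k v = 0 \<and> Q k 1 v = 0" if v: "v \<in> II" for v
    using v assms(2) one_in unfolding Q_def by (intro conjI Qt_ker Delta_ideal)
  moreover have "Q 1 k (zz S i i) = 0 \<and> Q k 1 (zz S i i) = 0" if "i \<in> {2..N}" for i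
    using that assms(2) one_in by (auto simp: Q_zz_diag)
  moreover have "Q 1 k (u i j) = 0 \<and> Q k 1 (u i j) = 0" if "i \<in> {2..N}" "j \<in> {2..N}" "i \<noteq> j" for i j
    using that assms(2) one_in by (auto simp: Q_u_offdiag)
  ultimately have "IS \<subseteq> ?T"
    unfolding I_SU_def using assms(2) one_in
    by (intro cvec.span_minimal) (auto simp: cvec.subspace_def Q_lin kerQ_def Qform_eq zz_def)
  then show "Q 1 k v = 0" "Q k 1 v = 0" using assms(1) by auto
qed

text \<open>When the first row and column of Q(v) vanish, Q(v z_ab) collapses to Q(v) for a = b = 1
  and to 0 otherwise, so v z_ab minus the corresponding multiple of v lies in the kernel of
  \<open>Q\<close>.\<close>

lemma IS_mult_zz:
  assumes "v \<in> IS" "a \<in> {1..N}" "b \<in> {1..N}"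
  shows "v * zz S a b \<in> IS"
proof -
  have gen: "h * zz S a b \<in> IS" if h: "h \<in> IS" for h
  proof -
    let ?d = "if a = 1 \<and> b = 1 then 1 else (0 :: complex)"
    have h': "h \<in> AA" "counit h = 0" using h IS_Ap by (auto simp: matA_plus_def)
    have "h * zz S a b - scal ?d h \<in> IS"
    proof (rule kerQ_IS)
      show "h * zz S a b - scal ?d h \<in> Ap"
        using h' assms by (simp add: matA_plus_def counit_simps G.A_closed zz_A)
      fix k l assume kl: "k \<in> {1..N}" "l \<in> {1..N}"
      have "Q 1 l h = 0" "Q k 1 h = 0" "Q 1 1 h = 0" "Q a 1 h = 0"
        using Q_IS_border[OF h] kl one_in assms by blast+
      then show "Q k l (h * zz S a b - scal ?d h) = 0"
        using Q_mult_zz[OF h'(1) assms(2,3) kl] by (auto simp: Q_lin Qr_def rho_commute)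
    qed
    from IS_closed(2)[OF this IS_closed(4)[OF h, of ?d]] show ?thesis by simp
  qed
  show ?thesis by (rule gen[OF assms(1)])
qed

text \<open>The two images differ only in the block with indices at least 2, by a multiple of nu^2:
  for a = 1 and b >= 2 the entry tau_b q p^{-2} nu stays at (b, k). This is what lets e^+ commute
  with the z_ab.\<close>

lemma e_plus_mult_zz:
  assumes "k \<in> {2..N}" "a \<in> {1..N}" "b \<in> {1..N}"
  shows "u k 1 * zz S a b - (if a = 1 \<and> b = 1 then u k 1 else 0) \<in> IS"
proof (rule IS_criterion)
  have k: "k \<in> {1..N}" "k \<noteq> 1" using assms by auto
  show "u k 1 * zz S a b - (if a = 1 \<and> b = 1 then u k 1 else 0) \<in> Ap"
    using assms k one_in by (auto simp: matA_plus_def counit_simps G.A_closed zz_A u_A)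
  fix x y assume xy: "x \<in> {1..N}" "y \<in> {1..N}"
  show "Q x y (u k 1 * zz S a b - (if a = 1 \<and> b = 1 then u k 1 else 0)) =
    (if 2 \<le> x \<and> 2 \<le> y then G.nu ^ 2 * (if a = 1 \<and> x = b \<and> y = k
      then - (of_real (q powi (2 - 2 * int b)) * of_real q * inverse p ^ 2) else 0) else 0)"
    using Q_mult_zz[OF u_A[OF k(1) one_in] assms(2,3) xy] xy assms k one_in
    by (auto simp: Q_lin Qr_def Q_u_offdiag rho_def tau_def power2_eq_square simp del: of_real_diff)
qed

text \<open>Here the remainder occurs for b = 1 and carries both terms of R, because the nu part of
  \<open>Qr\<close> involves the first column, where Q(u^1_k) is supported.\<close>

lemma e_minus_mult_zz:
  assumes "k \<in> {2..N}" "a \<in> {1..N}" "b \<in> {1..N}"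
  shows "u 1 k * zz S a b - (if a = 1 \<and> b = 1 then u 1 k else 0) \<in> IS"
proof (rule IS_criterion)
  have k: "k \<in> {1..N}" "k \<noteq> 1" using assms by auto
  show "u 1 k * zz S a b - (if a = 1 \<and> b = 1 then u 1 k else 0) \<in> Ap"
    using assms k one_in by (auto simp: matA_plus_def counit_simps G.A_closed zz_A u_A)
  fix x y assume xy: "x \<in> {1..N}" "y \<in> {1..N}"
  show "Q x y (u 1 k * zz S a b - (if a = 1 \<and> b = 1 then u 1 k else 0)) =
    (if 2 \<le> x \<and> 2 \<le> y then G.nu ^ 2 * (if b = 1 then inverse p ^ 2 * ((if y = a then if x = k then rho q a x else 0 else 0)
      + (if x = y then if a = k then nuH q a y else 0 else 0)) else 0) else 0)"
    using Q_mult_zz[OF u_A[OF one_in k(1)] assms(2,3) xy] xy assms k one_in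
    by (auto simp: Q_lin Qr_def Q_u_offdiag rho_def nuH_def power2_eq_square algebra_simps simp del: of_real_diff)
qed

text \<open>\<open>tau\<close> and \<open>Qr\<close> contribute one factor nu each, so the image,
  concentrated at (l, k), meets the criterion.\<close>

lemma zz_class:
  assumes "k \<in> {2..N}" "l \<in> {2..N}"
  shows "zz S k l \<in> IS"
proof (rule IS_criterion)
  have kl: "k \<in> {1..N}" "l \<in> {1..N}" "k \<noteq> 1" "l \<noteq> 1" using assms by auto
  then show "zz S k l \<in> Ap" by (intro zz_Ap) auto
  fix x y assume xy: "x \<in> {1..N}" "y \<in> {1..N}"
  show "Q x y (zz S k l) = (if 2 \<le> x \<and> 2 \<le> y then G.nu ^ 2 *
    (if x = l \<and> y = k then - of_real (q powi (2 - 2 * int l)) else 0) else 0)"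
    using xy kl one_in by (auto simp: Q_zz Qr_def Q_1 rho_def tau_def power2_eq_square simp del: of_real_diff)
qed

text \<open>Q(z_k1) is q^{-1} nu and Q(u^k_1) is p^{-2} nu times the matrix unit at (1, k). Their
  ratio p^2/q is the constant q^{2/N - 1} of the holomorphic derivative.\<close>

lemma zz_class_plus:
  assumes "k \<in> {2..N}"
  shows "zz S k 1 - scal (p ^ 2 * of_real (q powi (-1))) (u k 1) \<in> IS"
proof (rule IS_criterion[where c = "\<lambda>_ _. 0"])
  have k: "k \<in> {1..N}" "k \<noteq> 1" using assms by auto
  show "zz S k 1 - scal (p ^ 2 * of_real (q powi (-1))) (u k 1) \<in> Ap"
    by (intro cvec.subspace_diff[OF subspace_Ap] cvec.subspace_scale[OF subspace_Ap] zz_Ap u_offdiag_Ap)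
      (use k one_in in simp_all)
  define X where "X = p ^ 2 * of_real (q powi (-1))"
  have "X * inverse p ^ 2 = inverse (of_real q)"
    by (simp add: X_def power_inverse power_int_minus)
  then show "Q x y (zz S k 1 - scal (p ^ 2 * of_real (q powi (-1))) (u k 1)) =
    (if 2 \<le> x \<and> 2 \<le> y then G.nu ^ 2 * 0 else 0)" if xy: "x \<in> {1..N}" "y \<in> {1..N}" for x y
    unfolding X_def[symmetric] using xy k one_in
    by (auto simp: Q_lin Q_zz Qr_def Q_1 Q_u_offdiag rho_def simp del: of_real_diff)
qed

text \<open>At (l, 1) the images are q tau_l = -nu q^{3-2l} and p^{-2} nu; hence the weights
  q^{3-2l} and the minus sign of the anti-holomorphic derivative.\<close>

lemma zz_class_minus:
  assumes "l \<in> {2..N}"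
  shows "zz S 1 l + scal (p ^ 2 * of_real (q powi (3 - 2 * int l))) (u 1 l) \<in> IS"
proof (rule IS_criterion[where c = "\<lambda>_ _. 0"])
  have l: "l \<in> {1..N}" "l \<noteq> 1" using assms by auto
  show "zz S 1 l + scal (p ^ 2 * of_real (q powi (3 - 2 * int l))) (u 1 l) \<in> Ap"
    by (intro cvec.subspace_add[OF subspace_Ap] cvec.subspace_scale[OF subspace_Ap] zz_Ap u_offdiag_Ap)
      (use l one_in in simp_all)
  define X where "X = p ^ 2 * of_real (q powi (3 - 2 * int l))"
  have qq: "q powi (3 - 2 * int l) = q * q powi (2 - 2 * int l)"
    using power_int_add[of q 1 "2 - 2 * int l"] by (simp add: algebra_simps)
  have "X * (inverse p ^ 2 * G.nu) = - (tau l * of_real q)"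
    unfolding X_def qq tau_def by (simp add: power_inverse)
  then show "Q x y (zz S 1 l + scal (p ^ 2 * of_real (q powi (3 - 2 * int l))) (u 1 l)) =
    (if 2 \<le> x \<and> 2 \<le> y then G.nu ^ 2 * 0 else 0)" if xy: "x \<in> {1..N}" "y \<in> {1..N}" for x y
    unfolding X_def[symmetric] using xy l one_in
    by (auto simp: Q_lin Q_zz Qr_def Q_1 Q_u_offdiag rho_def nuH_def simp del: of_real_diff)
qed

lemma zz_class_one: "zz S 1 1 - 1 \<in> IS"
proof (rule IS_criterion)
  show "zz S 1 1 - 1 \<in> Ap"
    using one_in by (simp add: matA_plus_def counit_simps counit_zz zz_A G.A_closed del: One_nat_def)
  fix x y assume xy: "x \<in> {1..N}" "y \<in> {1..N}"
  show "Q x y (zz S 1 1 - 1) = (if 2 \<le> x \<and> 2 \<le> y then G.nu ^ 2 * (if x = y then 1 else 0) else 0)"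
    using xy one_in by (auto simp: Q_lin Q_zz Qr_def Q_1 rho_def nuH_def power2_eq_square simp del: of_real_diff)
qed

end

section \<open>The calculus on the quantum projective space\<close>

lemma sum_swap6:
  "(\<Sum>k\<in>K. \<Sum>a\<in>A. \<Sum>b\<in>B. \<Sum>c\<in>C. \<Sum>d\<in>D. \<Sum>e\<in>E. \<Sum>f\<in>F. g k a b c d e f) =
   (\<Sum>a\<in>A. \<Sum>b\<in>B. \<Sum>c\<in>C. \<Sum>d\<in>D. \<Sum>e\<in>E. \<Sum>f\<in>F. \<Sum>k\<in>K. g k a b c d e f)"
  for g :: "_ \<Rightarrow> _ \<Rightarrow> _ \<Rightarrow> _ \<Rightarrow> _ \<Rightarrow> _ \<Rightarrow> _ \<Rightarrow> 'a::comm_monoid_add"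
  by ((rule trans[OF sum.swap], rule sum.cong[OF refl])+, rule refl)

context SU_calculus
begin

section \<open>Forms modulo zero forms, and the two actions\<close>

abbreviation "FZ \<equiv> forms_zero N q S r"

lemma FZ_def: "FZ = tens_ker AA II Ap IS"
  by (simp add: forms_zero_def)

lemma subspace_FZ: "cvec.subspace FZ"
  by (simp add: FZ_def tens_ker_def)

lemmas FZ_closed = cvec.subspace_0[OF subspace_FZ] cvec.subspace_add[OF subspace_FZ]
  cvec.subspace_diff[OF subspace_FZ] cvec.subspace_scale[OF subspace_FZ]
  cvec.subspace_sum[OF subspace_FZ] cvec.subspace_neg[OF subspace_FZ]

lemma FZ_base: "f \<in> II \<Longrightarrow> g \<in> Ap \<Longrightarrow> tens f g \<in> FZ" "f \<in> AA \<Longrightarrow> g \<in> IS \<Longrightarrow> tens f g \<in> FZ"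
  unfolding FZ_def by (rule tens_ker_base; assumption)+

abbreviation eqF :: "form \<Rightarrow> form \<Rightarrow> bool" (infix \<open>\<simeq>\<close> 50)
  where "x \<simeq> y \<equiv> eq_mod FZ x y"

lemma eqF_refl: "x \<simeq> x"
  by (simp add: eq_mod_def FZ_closed)

lemma eqF_sym: "x \<simeq> y \<Longrightarrow> y \<simeq> x"
  using FZ_closed(6)[of "x - y"] by (simp add: eq_mod_def)

lemma eqF_trans [trans]: "x \<simeq> y \<Longrightarrow> y \<simeq> z \<Longrightarrow> x \<simeq> z"
  using FZ_closed(2)[of "x - y" "y - z"] by (simp add: eq_mod_def)

lemma eqF_add: "x \<simeq> y \<Longrightarrow> x' \<simeq> y' \<Longrightarrow> x + x' \<simeq> y + y'"
  using FZ_closed(2)[of "x - y" "x' - y'"] by (simp add: eq_mod_def algebra_simps)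

lemma eqF_diff: "x \<simeq> y \<Longrightarrow> x' \<simeq> y' \<Longrightarrow> x - x' \<simeq> y - y'"
  using FZ_closed(3)[of "x - y" "x' - y'"] by (simp add: eq_mod_def algebra_simps)

lemma eqF_scal: "x \<simeq> y \<Longrightarrow> scal c x \<simeq> scal c y"
  using FZ_closed(4)[of "x - y" c] by (simp add: eq_mod_def cvec.scale_right_diff_distrib)

lemma eqF_sum: "(\<And>i. i \<in> X \<Longrightarrow> f i \<simeq> g i) \<Longrightarrow> sum f X \<simeq> sum g X"
  by (auto simp: eq_mod_def simp flip: sum_subtractf intro: FZ_closed(5))

lemma eqF_tens_left: "G.cg f g \<Longrightarrow> v \<in> Ap \<Longrightarrow> tens f v \<simeq> tens g v"
  using FZ_base(1)[of "f - g" v] by (simp add: eq_mod_def G.cg_def tens_simps)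

lemma eqF_tens_right: "f \<in> AA \<Longrightarrow> v - w \<in> IS \<Longrightarrow> tens f v \<simeq> tens f w"
  using FZ_base(2)[of f "v - w"] by (simp add: eq_mod_def tens_simps)

lemma FZ_subset:
  assumes "cvec.subspace T" "\<And>f g. f \<in> II \<Longrightarrow> g \<in> Ap \<Longrightarrow> tens f g \<in> T"
    "\<And>f g. f \<in> AA \<Longrightarrow> g \<in> IS \<Longrightarrow> tens f g \<in> T"
  shows "FZ \<subseteq> T"
  unfolding FZ_def tens_ker_def using assms by (intro cvec.span_minimal) auto

lemma FZ_lact:
  assumes "f \<in> AA" "x \<in> FZ" shows "lact f x \<in> FZ"
proof -
  have "FZ \<subseteq> {x. tens f 1 * x \<in> FZ}"
    using assms(1)
    by (intro FZ_subset) (auto simp: cvec.subspace_def distrib_left FZ_closed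
      intro: FZ_base(1)[OF G.I_left] FZ_base(2)[OF G.A_mult])
  then show ?thesis using assms(2) by (auto simp: lact_def)
qed

lemma eqF_lact: "f \<in> AA \<Longrightarrow> x \<simeq> y \<Longrightarrow> lact f x \<simeq> lact f y"
  using FZ_lact[of f "x - y"] by (simp add: eq_mod_def lact_def right_diff_distrib)

lemma lact_tens [simp]: "lact f (tens g v) = tens (f * g) v"
  by (simp add: lact_def)

lemma lact_simps: "lact f (x + y) = lact f x + lact f y" "lact f (x - y) = lact f x - lact f y"
  "lact f (scal c x) = scal c (lact f x)" "lact f (sum g X) = (\<Sum>i\<in>X. lact f (g i))"
  by (simp_all add: lact_def distrib_left right_diff_distrib sum_distrib_left)

abbreviation "FF \<equiv> tens_alg AA Ap"

text \<open>The right action thus depends only on the class of Delta(h). Both tensor factors are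
  handled by two-sidedness of the ideal of G, which is contained in the ideal of the
  calculus.\<close>

lemma FF_JJ:
  assumes "x \<in> FF" "t \<in> JJ" shows "x * t \<in> FZ"
  using assms[unfolded tens_alg_def tens_ker_def]
proof (rule span_mult[OF _ _ subspace_FZ])
  fix a b
  assume "a \<in> {tens f g | f g. f \<in> AA \<and> g \<in> Ap}" "b \<in> {tens f g | f g. f \<in> II \<and> g \<in> AA} \<union> {tens f g | f g. f \<in> AA \<and> g \<in> II}"
  then consider f g f' g' where "a = tens f g" "f \<in> AA" "g \<in> Ap" "b = tens f' g'" "f' \<in> II" "g' \<in> AA"
    | f g f' g' where "a = tens f g" "f \<in> AA" "g \<in> Ap" "b = tens f' g'" "f' \<in> AA" "g' \<in> II"
    by blast
  then show "a * b \<in> FZ"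
  proof cases
    case 1
    then show ?thesis by (auto intro!: FZ_base(1) G.I_left Ap_mult)
  next
    case 2
    then have "g * g' \<in> IS" using G.I_left[of g g'] II_IS by (auto simp: matA_plus_def)
    with 2 show ?thesis by (auto intro!: FZ_base(2) G.A_mult)
  qed
qed

lemma FZ_FF: "FZ \<subseteq> FF"
  unfolding FZ_def tens_ker_def tens_alg_def
  using G.I_A IS_Ap by (intro cvec.span_mono) auto

text \<open>A representative of Delta(z_ij) whose second factors are again of the form z_cd, so that
  their known classes can be inserted.\<close>

definition dz :: "nat \<Rightarrow> nat \<Rightarrow> form"
  where "dz i j = (\<Sum>c = 1..N. \<Sum>d = 1..N. tens (u i c * W d j) (zz S c d))"

lemma Delta_zz: "i \<in> {1..N} \<Longrightarrow> j \<in> {1..N} \<Longrightarrow> Delta N (zz S i j) - dz i j \<in> JJ"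
  using Delta_uW[of i 1 j 1] one_in by (simp add: zz_def dz_def GG.cg_def del: One_nat_def)

text \<open>Well-definedness of the right action of z_ij rests on \<open>IS_mult_zz\<close>, since
  the second tensor factors in \<open>dz\<close> are the z_cd.\<close>

lemma FZ_ract:
  assumes "x \<in> FZ" "i \<in> {1..N}" "j \<in> {1..N}" shows "ract N x (zz S i j) \<in> FZ"
proof -
  have gen: "tens f v * tens (u i c * W d j) (zz S c d) \<in> FZ"
    if "f \<in> II \<and> v \<in> Ap \<or> f \<in> AA \<and> v \<in> IS" "c \<in> {1..N}" "d \<in> {1..N}" for f v c d
  proof -
    have m: "u i c * W d j \<in> AA" "zz S c d \<in> AA"
      by (intro G.A_mult u_A W_A zz_A that assms)+
    from that(1) show ?thesis
    proof
      assume "f \<in> II \<and> v \<in> Ap"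
      then show ?thesis
        unfolding tens_mult by (intro FZ_base(1) G.I_right[OF _ m(1)] Ap_mult[OF _ m(2)]) auto
    next
      assume "f \<in> AA \<and> v \<in> IS"
      then show ?thesis
        unfolding tens_mult using that by (intro FZ_base(2) G.A_mult[OF _ m(1)] IS_mult_zz) auto
    qed
  qed
  have "tens f v * dz i j \<in> FZ" if "f \<in> II \<and> v \<in> Ap \<or> f \<in> AA \<and> v \<in> IS" for f v
    unfolding dz_def sum_distrib_left using that by (intro FZ_closed(5) gen)
  then have "FZ \<subseteq> {x. x * dz i j \<in> FZ}"
    by (intro FZ_subset) (auto simp: cvec.subspace_def distrib_right FZ_closed)
  then have "x * dz i j \<in> FZ" using assms(1) by auto
  moreover have "x * (Delta N (zz S i j) - dz i j) \<in> FZ"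
    using assms FZ_FF by (intro FF_JJ Delta_zz) auto
  ultimately show ?thesis
    using FZ_closed(2) by (fastforce simp: ract_def right_diff_distrib)
qed

lemma eqF_ract:
  "x \<simeq> y \<Longrightarrow> i \<in> {1..N} \<Longrightarrow> j \<in> {1..N} \<Longrightarrow> ract N x (zz S i j) \<simeq> ract N y (zz S i j)"
  using FZ_ract[of "x - y" i j] by (simp add: eq_mod_def ract_def left_diff_distrib)

text \<open>Among the z_cd only z_11 acts on the class of \<open>v\<close>, and it acts as 1; the
  first tensor factor that goes with it is z_ij itself.\<close>

lemma ract_basis:
  assumes f: "f \<in> AA" and v: "v \<in> Ap" and ij: "i \<in> {1..N}" "j \<in> {1..N}"
    and mult: "\<And>a b. a \<in> {1..N} \<Longrightarrow> b \<in> {1..N} \<Longrightarrow> v * zz S a b - (if a = 1 \<and> b = 1 then v else 0) \<in> IS"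
  shows "ract N (tens f v) (zz S i j) \<simeq> tens (f * zz S i j) v"
proof -
  have "ract N (tens f v) (zz S i j) - tens f v * dz i j \<in> FZ"
    unfolding ract_def right_diff_distrib[symmetric] using f v ij by (intro FF_JJ tens_alg_base Delta_zz)
  then have "ract N (tens f v) (zz S i j) \<simeq> tens f v * dz i j"
    by (simp add: eq_mod_def)
  also have "tens f v * dz i j = (\<Sum>c = 1..N. \<Sum>d = 1..N. tens (f * (u i c * W d j)) (v * zz S c d))"
    by (simp add: dz_def sum_distrib_left)
  also have "\<dots> \<simeq> (\<Sum>c = 1..N. \<Sum>d = 1..N. tens (f * (u i c * W d j)) (if c = 1 \<and> d = 1 then v else 0))"
    using f ij by (intro eqF_sum eqF_tens_right mult G.A_mult u_A W_A)
  also have "\<dots> = (\<Sum>c = 1..N. \<Sum>d = 1..N. if d = 1 then if c = 1 then tens (f * (u i c * W d j)) v else 0 else 0)"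
    by (intro sum.cong refl) (simp add: tens_simps)
  also have "\<dots> = tens (f * zz S i j) v"
    using one_in by (simp add: zz_def)
  finally show ?thesis .
qed

definition hol :: "nat \<Rightarrow> nat \<Rightarrow> form"
  where "hol i j = scal (p ^ 2 * of_real (q powi (-1)))
    (\<Sum>k = 2..N. tens (u i k * W 1 j) (u k 1))"

definition ahol :: "nat \<Rightarrow> nat \<Rightarrow> form"
  where "ahol i j = scal (- (of_real (q ^ 3) * p ^ 2))
    (\<Sum>k = 2..N. scal (of_real (q powi (- 2 * int k))) (tens (u i 1 * W k j) (u 1 k)))"

lemma uk1_Ap: "k \<in> {2..N} \<Longrightarrow> u k 1 \<in> Ap" and u1k_Ap: "k \<in> {2..N} \<Longrightarrow> u 1 k \<in> Ap"
  by (auto intro: u_offdiag_Ap)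

lemma sum_split_first: "(\<Sum>c = 1..N. f c) = f 1 + (\<Sum>c = 2..N. f c)"
  for f :: "nat \<Rightarrow> 'a::comm_monoid_add"
  using one_in by (simp add: sum.atLeast_Suc_atMost numeral_2_eq_2)

text \<open>The class of z_cd minus its counit can be nonzero only if exactly one of c, d is 1: the
  case d = 1 produces the e^+ and the case c = 1 the e^-.\<close>

lemma dd_zz:
  assumes ij: "i \<in> {1..N}" "j \<in> {1..N}"
  shows "dd N (zz S i j) \<simeq> hol i j + ahol i j"
proof -
  let ?\<beta> = "\<lambda>f g. tens f (g - scal (counit g) 1) :: form"
  have bil: "bilinear_scal scal ?\<beta>"
    by (intro bilinear_scalI cvec.vector_space_axioms)
      (simp_all add: tens_simps counit_simps cvec.scale_left_distrib algebra_simps)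
  note lin = linear_scalD[OF linear_contract[OF cvec.vector_space_axioms]]
  have "contract scal ?\<beta> (Delta N (zz S i j) - dz i j) \<in> FZ"
  proof (rule contract_tens_ker[OF bil subspace_FZ Delta_zz[OF ij]])
    show "?\<beta> f g \<in> FZ" if "f \<in> II" "g \<in> AA" for f g
      using that by (intro FZ_base(1)) (auto simp: matA_plus_def counit_simps G.A_closed)
    show "?\<beta> f g \<in> FZ" if "f \<in> AA" "g \<in> II" for f g
      using that II_IS counit_ideal[of g] by (intro FZ_base(2)) auto
  qed
  then have "dd N (zz S i j) \<simeq> contract scal ?\<beta> (dz i j)"
    by (simp add: eq_mod_def dd_def lin)
  also have "contract scal ?\<beta> (dz i j) = (\<Sum>c = 1..N. \<Sum>d = 1..N. tens (u i c * W d j) (zz S c d - (if c = 1 \<and> d = 1 then 1 else 0)))"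
    unfolding dz_def lin contract_tens[OF bil]
    by (intro sum.cong refl) (auto simp: counit_zz simp del: One_nat_def)
  also have "\<dots> \<simeq> (\<Sum>c = 1..N. \<Sum>d = 1..N. tens (u i c * W d j)
    (if d = 1 then if c = 1 then 0 else scal (p ^ 2 * of_real (q powi (-1))) (u c 1)
     else if c = 1 then - scal (p ^ 2 * of_real (q powi (3 - 2 * int d))) (u 1 d) else 0))"
  proof (intro eqF_sum eqF_tens_right)
    fix c d assume cd: "c \<in> {1..N}" "d \<in> {1..N}"
    then show "u i c * W d j \<in> AA" using ij by (intro G.A_mult u_A W_A)
    consider "c = 1" "d = 1" | "c \<in> {2..N}" "d = 1" | "c = 1" "d \<in> {2..N}" | "c \<in> {2..N}" "d \<in> {2..N}"
      using cd by force
    then show "zz S c d - (if c = 1 \<and> d = 1 then 1 else 0) -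
      (if d = 1 then if c = 1 then 0 else scal (p ^ 2 * of_real (q powi (-1))) (u c 1)
       else if c = 1 then - scal (p ^ 2 * of_real (q powi (3 - 2 * int d))) (u 1 d) else 0) \<in> IS"
    proof cases
      case 1
      then show ?thesis using zz_class_one by simp
    next
      case 2
      then show ?thesis using zz_class_plus[of c] by simp
    next
      case 3
      then show ?thesis using zz_class_minus[of d] by simp
    next
      case 4
      then show ?thesis using zz_class[of c d] by simp
    qed
  qed
  also have "\<dots> = hol i j + ahol i j"
  proof -
    have qp: "p ^ 2 * of_real (q powi (3 - 2 * int d)) = of_real (q ^ 3) * p ^ 2 * of_real (q powi (- 2 * int d))" for d
    proof -
      have "q powi (3 + (- 2 * int d)) = q powi 3 * q powi (- 2 * int d)"
        by (rule power_int_add) simp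
      then show ?thesis by simp
    qed
    have "hol i j = (\<Sum>c = 2..N. tens (u i c * W 1 j) (scal (p ^ 2 * of_real (q powi (-1))) (u c 1)))"
      unfolding hol_def cvec.scale_sum_right tens_simps ..
    moreover have "ahol i j = (\<Sum>d = 2..N. tens (u i 1 * W d j) (- scal (p ^ 2 * of_real (q powi (3 - 2 * int d))) (u 1 d)))"
      unfolding ahol_def cvec.scale_sum_right
      by (intro sum.cong refl) (simp only: qp cvec.scale_minus_left[symmetric] tens_simps scal_scal mult_minus_left mult.assoc)
    ultimately show ?thesis
      unfolding sum_split_first by (simp add: tens_simps sum.neutral)
  qed
  finally show ?thesis .
qed

lemma hol_eq: "hol i j = scal (p ^ 2 * of_real (q powi (-1)))
    (\<Sum>k = 2..N. lact (u i k * S (u 1 j)) (e_plus (k - 1)))"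
  unfolding hol_def e_plus_def lact_tens
  by (intro arg_cong[where f = "scal _"] sum.cong refl) simp

lemma ahol_eq: "ahol i j = scal (- (of_real (q ^ 3) * p ^ 2))
    (\<Sum>k = 2..N. scal (of_real (q powi (- 2 * int k))) (lact (u i 1 * S (u k j)) (e_minus (k - 1))))"
  unfolding ahol_def e_minus_def lact_tens
  by (intro arg_cong[where f = "scal _"] sum.cong refl) simp

section \<open>The calculus over the projective space and its two summands\<close>

abbreviation "OM \<equiv> Omega_CP N q S r"

lemma subspace_OM: "cvec.subspace OM"
  by (simp add: Omega_CP_def)

lemma FZ_OM: "FZ \<subseteq> OM"
  unfolding Omega_CP_def by (auto intro: cvec.span_base)

lemma OM_eqF: "x \<in> OM \<Longrightarrow> x \<simeq> y \<Longrightarrow> y \<in> OM"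
  using cvec.subspace_diff[OF subspace_OM, of x "x - y"] FZ_OM by (auto simp: eq_mod_def)

text \<open>The inner sum is an entry of \<open>W u = 1\<close>. It vanishes for k >= 2, so left
  multiplication by z removes the holomorphic part, and is 1 for k = 1, so the anti-holomorphic part
  is kept.\<close>

lemma sum_zz_mult:
  assumes "l \<in> {1..N}" "k \<in> {1..N}" "X \<in> AA"
  shows "G.cg (\<Sum>i = 1..N. zz S l i * (u i k * X)) (if k = 1 then u l 1 * X else 0)"
proof -
  have 1: "(\<Sum>i = 1..N. zz S l i * (u i k * X)) = u l 1 * (\<Sum>i = 1..N. W 1 i * u i k) * X"
    by (simp add: zz_def sum_distrib_left sum_distrib_right mult.assoc)
  have 2: "G.cg \<dots> (u l 1 * (if 1 = k then 1 else 0) * X)"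
    using assms one_in by (intro G.cg_mult G.cg_refl u_A G.WU)
  have 3: "u l 1 * (if 1 = k then 1 else 0) * X = (if k = 1 then u l 1 * X else 0)"
    by simp
  show ?thesis unfolding 1 3[symmetric] by (rule 2)
qed

text \<open>The antiholomorphic part of \<open>d z\<close> is \<open>z d z\<close> (matrix product), so it lies in the
  calculus over the projective space.\<close>

lemma sum_zz_dd:
  assumes "l \<in> {1..N}" "j \<in> {1..N}"
  shows "(\<Sum>i = 1..N. lact (zz S l i) (dd N (zz S i j))) \<simeq> ahol l j"
proof -
  have "(\<Sum>i = 1..N. lact (zz S l i) (dd N (zz S i j))) \<simeq> (\<Sum>i = 1..N. lact (zz S l i) (hol i j + ahol i j))"
    using assms by (intro eqF_sum eqF_lact zz_A dd_zz)
  also have "\<dots> = scal (p ^ 2 * of_real (q powi (-1))) (\<Sum>k = 2..N. tens (\<Sum>i = 1..N. zz S l i * (u i k * W 1 j)) (u k 1))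
    + scal (- (of_real (q ^ 3) * p ^ 2)) (\<Sum>k = 2..N. scal (of_real (q powi (- 2 * int k)))
        (tens (\<Sum>i = 1..N. zz S l i * (u i 1 * W k j)) (u 1 k)))"
  proof -
    have 1: "(\<Sum>i = 1..N. lact (zz S l i) (hol i j)) =
      scal (p ^ 2 * of_real (q powi (-1))) (\<Sum>k = 2..N. tens (\<Sum>i = 1..N. zz S l i * (u i k * W 1 j)) (u k 1))"
      unfolding hol_def lact_simps lact_tens tens_simps cvec.scale_sum_right by (rule sum.swap)
    have 2: "(\<Sum>i = 1..N. lact (zz S l i) (ahol i j)) =
      scal (- (of_real (q ^ 3) * p ^ 2)) (\<Sum>k = 2..N. scal (of_real (q powi (- 2 * int k)))
        (tens (\<Sum>i = 1..N. zz S l i * (u i 1 * W k j)) (u 1 k)))"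
      unfolding ahol_def lact_simps lact_tens tens_simps cvec.scale_sum_right by (rule sum.swap)
    show ?thesis unfolding lact_simps sum.distrib 1 2 ..
  qed
  also have "\<dots> \<simeq> scal (p ^ 2 * of_real (q powi (-1))) (\<Sum>k = 2..N. tens (if k = 1 then u l 1 * W 1 j else 0) (u k 1))
    + scal (- (of_real (q ^ 3) * p ^ 2)) (\<Sum>k = 2..N. scal (of_real (q powi (- 2 * int k)))
        (tens (if (1::nat) = 1 then u l 1 * W k j else 0) (u 1 k)))"
    by (intro eqF_add eqF_scal eqF_sum eqF_tens_left sum_zz_mult W_A uk1_Ap u1k_Ap) (use assms one_in in auto)
  also have "\<dots> = ahol l j"
    by (simp add: ahol_def tens_simps sum.neutral)
  finally show ?thesis .
qed

lemma dd_OM: "i \<in> {1..N} \<Longrightarrow> j \<in> {1..N} \<Longrightarrow> dd N (zz S i j) \<in> OM"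
proof -
  assume ij: "i \<in> {1..N}" "j \<in> {1..N}"
  \<comment> \<open>The calculus is spanned by the f dg with f coinvariant, so writing dz as 1 dz
    needs 1 to be coinvariant.\<close>
  have "1 \<in> CP N q"
  proof -
    have "bilinear_scal scal (\<lambda>f\<^sub>1 f\<^sub>2. tens (f\<^sub>1 :: mat_alg) (alpha f\<^sub>2))"
      by (auto intro!: bilinear_scalI cvec.vector_space_axioms simp: tens_simps alpha_simps)
    from contract_tens[OF this, of 1 1] show ?thesis
      using G.A_1 by (simp add: CP_def eq_mod_def Delta_simps alpha_simps tens_ker_def cvec.span_zero)
  qed
  then have "lact 1 (dd N (zz S i j)) \<in> OM"
    unfolding Omega_CP_def using zz_CP[OF ij] by (blast intro: cvec.span_base)
  then show ?thesis by (simp add: lact_def)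
qed

lemma ahol_OM:
  assumes "i \<in> {1..N}" "j \<in> {1..N}"
  shows "ahol i j \<in> OM"
proof (rule OM_eqF[OF _ sum_zz_dd[OF assms]])
  show "(\<Sum>k = 1..N. lact (zz S i k) (dd N (zz S k j))) \<in> OM"
  proof (rule cvec.subspace_sum[OF subspace_OM])
    fix k assume "k \<in> {1..N}"
    then show "lact (zz S i k) (dd N (zz S k j)) \<in> OM"
      unfolding Omega_CP_def using zz_CP assms by (blast intro: cvec.span_base)
  qed
qed

lemma hol_OM:
  assumes "i \<in> {1..N}" "j \<in> {1..N}"
  shows "hol i j \<in> OM"
proof (rule OM_eqF)
  show "dd N (zz S i j) - ahol i j \<in> OM"
    using assms by (intro cvec.subspace_diff[OF subspace_OM] dd_OM ahol_OM)
  show "dd N (zz S i j) - ahol i j \<simeq> hol i j"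
    using eqF_diff[OF dd_zz[OF assms] eqF_refl[of "ahol i j"]] by simp
qed

abbreviation "E10 \<equiv> cvec.span ({tens g (u i 1) | g i. g \<in> AA \<and> i \<in> {2..N}} \<union> FZ)"
abbreviation "E01 \<equiv> cvec.span ({tens g (u 1 i) | g i. g \<in> AA \<and> i \<in> {2..N}} \<union> FZ)"

lemma hol_E10: "i \<in> {1..N} \<Longrightarrow> j \<in> {1..N} \<Longrightarrow> hol i j \<in> E10"
  unfolding hol_def
proof (intro cvec.span_scale cvec.span_sum cvec.span_base)
  fix k assume "i \<in> {1..N}" "j \<in> {1..N}" "k \<in> {2..N}"
  moreover from this have "u i k * W 1 j \<in> AA"
    by (intro G.A_mult u_A W_A) auto
  ultimately show "tens (u i k * W 1 j) (u k 1) \<in> {tens g (u i 1) | g i. g \<in> AA \<and> i \<in> {2..N}} \<union> FZ"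
    by blast
qed

lemma ahol_E01: "i \<in> {1..N} \<Longrightarrow> j \<in> {1..N} \<Longrightarrow> ahol i j \<in> E01"
  unfolding ahol_def
proof (intro cvec.span_scale cvec.span_sum cvec.span_base)
  fix k assume "i \<in> {1..N}" "j \<in> {1..N}" "k \<in> {2..N}"
  moreover from this have "u i 1 * W k j \<in> AA"
    by (intro G.A_mult u_A W_A) auto
  ultimately show "tens (u i 1 * W k j) (u 1 k) \<in> {tens g (u 1 i) | g i. g \<in> AA \<and> i \<in> {2..N}} \<union> FZ"
    by blast
qed

text \<open>For $q < 1$ the functionals \<open>Q 1 i\<close> vanish on \<open>I_SU\<close> and on the $u^1_k$, and
  separate the $u^k_1$; for $q = 1$ both summands are zero.\<close>

lemma E10_E01_direct:
  assumes "x \<in> E10" "x \<in> E01"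
  shows "x \<in> FZ"
proof (cases "G.nu = 0")
  case True
  have "u k 1 \<in> IS" if "k \<in> {2..N}" for k
  proof (rule kerQ_IS[OF uk1_Ap[OF that]])
    show "Q x y (u k 1) = 0" if "x \<in> {1..N}" "y \<in> {1..N}" for x y
      using \<open>k \<in> {2..N}\<close> that one_in True by (subst Q_u_offdiag) auto
  qed
  then have "E10 \<subseteq> FZ"
    by (intro cvec.span_minimal subspace_FZ) (auto intro: FZ_base(2))
  then show ?thesis using assms(1) by blast
next
  case False
  \<comment> \<open>The map id (x) Q_{1i}: modulo the ideal of G it kills zero forms and the g (x)
    u^1_k, and it detects g (x) u^i_1 with the factor p^{-2} nu.\<close>
  define \<phi> where "\<phi> i = contract scal (\<lambda>f g. scal (Q 1 i g) f :: mat_alg)" for i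
  have bil: "bilinear_scal scal (\<lambda>f g. scal (Q 1 i g) f :: mat_alg)" for i
    by (intro bilinear_scalI cvec.vector_space_axioms)
      (simp_all add: Q_lin cvec.scale_left_distrib cvec.scale_right_distrib mult.commute)
  note \<phi>_lin = linear_scalD[OF linear_contract[OF cvec.vector_space_axioms, of "\<lambda>f g. scal (Q 1 i g) f :: mat_alg" for i], folded \<phi>_def]
  have \<phi>_tens: "\<phi> i (tens f g) = scal (Q 1 i g) f" for i f g
    unfolding \<phi>_def by (rule contract_tens[OF bil])
  have \<phi>_FZ: "\<phi> i z \<in> II" if "z \<in> FZ" "i \<in> {1..N}" for z i
    unfolding \<phi>_def
  proof (rule contract_tens_ker[OF bil G.I_sub that(1)[unfolded FZ_def]])
    show "scal (Q 1 i g) f \<in> II" if "f \<in> II" for f g using that by (rule G.I_scal)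
    show "scal (Q 1 i g) f \<in> II" if "g \<in> IS" for f g
      using Q_IS_border(1)[OF that \<open>i \<in> {1..N}\<close>] by (simp add: G.I_0)
  qed
  let ?c = "inverse p ^ 2 * G.nu"
  \<comment> \<open>Modulo zero forms, \<open>?P\<close> is multiplication by the scalar
    \<open>?c\<close> on \<open>E10\<close> and is 0 on \<open>E01\<close>; \<open>?c\<close> is
    invertible since nu is not 0 in this case.\<close>
  let ?P = "\<lambda>x. \<Sum>i = 2..N. tens (\<phi> i x) (u i 1)"
  have P_FZ: "?P x \<in> FZ" if "\<And>i. i \<in> {2..N} \<Longrightarrow> \<phi> i x \<in> II" for x
    using that by (intro FZ_closed(5) FZ_base(1) uk1_Ap)
  have "E10 \<subseteq> {x. scal ?c x - ?P x \<in> FZ}"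
  proof (rule cvec.span_minimal)
    show "cvec.subspace {x. scal ?c x - ?P x \<in> FZ}"
    proof -
      have "Vector_Spaces.linear scal scal (\<lambda>x. scal ?c x - ?P x)"
        by (simp add: Vector_Spaces.linear_iff cvec.vector_space_axioms \<phi>_lin tens_simps sum.distrib
          cvec.scale_right_distrib cvec.scale_right_diff_distrib cvec.scale_sum_right mult.commute algebra_simps
          del: of_real_diff)
      from linear_scalD[OF this] show ?thesis
        by (simp only: cvec.subspace_def mem_Collect_eq) (blast intro: FZ_closed)
    qed
    show "{tens g (u i 1) | g i. g \<in> AA \<and> i \<in> {2..N}} \<union> FZ \<subseteq> {x. scal ?c x - ?P x \<in> FZ}"
    proof safe
      fix g k assume gk: "g \<in> AA" "k \<in> {2..N}"
      have "?P (tens g (u k 1)) = (\<Sum>i = 2..N. if i = k then tens (scal ?c g) (u i 1) else 0)"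
        unfolding \<phi>_tens
      proof (intro sum.cong refl)
        fix i assume "i \<in> {2..N}"
        then have "Q 1 i (u k 1) = (if i = k then ?c else 0)"
          using gk one_in by (subst Q_u_offdiag) auto
        then show "tens (scal (Q 1 i (u k 1)) g) (u i 1) = (if i = k then tens (scal ?c g) (u i 1) else 0)"
          by (simp add: tens_simps)
      qed
      also have "\<dots> = scal ?c (tens g (u k 1))"
        using gk(2) by (simp add: tens_simps)
      finally show "scal ?c (tens g (u k 1)) - ?P (tens g (u k 1)) \<in> FZ"
        by (simp add: FZ_closed)
    next
      fix z assume "z \<in> FZ"
      then show "scal ?c z - ?P z \<in> FZ"
        using \<phi>_FZ by (intro FZ_closed(3,4) P_FZ) auto
    qed
  qed
  then have 1: "scal ?c x - ?P x \<in> FZ" using assms(1) by blast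
  have "E01 \<subseteq> {x. \<forall>i \<in> {2..N}. \<phi> i x \<in> II}"
  proof (rule cvec.span_minimal)
    show "cvec.subspace {x. \<forall>i \<in> {2..N}. \<phi> i x \<in> II}"
      by (auto simp: cvec.subspace_def \<phi>_lin G.I_0 intro: G.I_add G.I_scal)
    have "Q 1 i (u 1 k) = 0" if "k \<in> {2..N}" "i \<in> {2..N}" for i k
      using that one_in by (subst Q_u_offdiag) auto
    then show "{tens g (u 1 i) | g i. g \<in> AA \<and> i \<in> {2..N}} \<union> FZ \<subseteq> {x. \<forall>i \<in> {2..N}. \<phi> i x \<in> II}"
      using \<phi>_FZ by (auto simp: \<phi>_tens G.I_0)
  qed
  then have "?P x \<in> FZ" using assms(2) by (intro P_FZ) blast
  from FZ_closed(2)[OF 1 this] have "scal ?c x \<in> FZ" by simp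
  moreover have "inverse ?c * ?c = 1"
    using False by (intro left_inverse) (simp del: of_real_diff)
  ultimately show ?thesis
    using FZ_closed(4)[of "scal ?c x" "inverse ?c"] by (simp only: scal_scal scal_1)
qed

lemma hol_Omega10: "i \<in> {1..N} \<Longrightarrow> j \<in> {1..N} \<Longrightarrow> hol i j \<in> Omega10 N q S r"
  by (simp only: Omega10_def Int_iff hol_OM hol_E10 simp_thms)

lemma ahol_Omega01: "i \<in> {1..N} \<Longrightarrow> j \<in> {1..N} \<Longrightarrow> ahol i j \<in> Omega01 N q S r"
  by (simp only: Omega01_def Int_iff ahol_OM ahol_E01 simp_thms)

lemma subspace_Omega: "cvec.subspace (Omega10 N q S r)" "cvec.subspace (Omega01 N q S r)"
  unfolding Omega10_def Omega01_def by (intro cvec.subspace_inter subspace_OM cvec.subspace_span)+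

lemma FZ_Omega: "FZ \<subseteq> Omega10 N q S r" "FZ \<subseteq> Omega01 N q S r"
  unfolding Omega10_def Omega01_def using FZ_OM by (auto intro: cvec.span_base)

lemma Omega_direct: "x \<in> Omega10 N q S r \<Longrightarrow> x \<in> Omega01 N q S r \<Longrightarrow> x \<in> FZ"
  by (rule E10_E01_direct) (simp_all only: Omega10_def Omega01_def Int_iff)

text \<open>Both the chosen representative and \<open>hol i j\<close> split dz into the two
  summands. Their difference lies in both summands, hence is a zero form.\<close>

lemma del_zz:
  assumes "i \<in> {1..N}" "j \<in> {1..N}"
  shows "del N q S r (zz S i j) \<simeq> hol i j"
proof -
  let ?d = "dd N (zz S i j)" and ?w = "del N q S r (zz S i j)"
  have "(?d - (hol i j + ahol i j)) + ahol i j \<in> Omega01 N q S r"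
    using dd_zz[OF assms] FZ_Omega(2)
    by (intro cvec.subspace_add[OF subspace_Omega(2)] ahol_Omega01 assms) (auto simp: eq_mod_def)
  then have hol: "?d - hol i j \<in> Omega01 N q S r" by simp
  have w: "?w \<in> Omega10 N q S r \<and> ?d - ?w \<in> Omega01 N q S r"
    unfolding del_def by (rule someI[of _ "hol i j"]) (intro conjI hol hol_Omega10 assms)
  have "(?d - hol i j) - (?d - ?w) \<in> Omega01 N q S r"
    by (rule cvec.subspace_diff[OF subspace_Omega(2) hol conjunct2[OF w]])
  moreover have "?w - hol i j \<in> Omega10 N q S r"
    by (rule cvec.subspace_diff[OF subspace_Omega(1) conjunct1[OF w] hol_Omega10[OF assms]])
  ultimately show ?thesis
    using Omega_direct[of "?w - hol i j"] by (simp add: eq_mod_def)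
qed

lemma delbar_zz:
  assumes "i \<in> {1..N}" "j \<in> {1..N}"
  shows "delbar N q S r (zz S i j) \<simeq> ahol i j"
proof -
  let ?d = "dd N (zz S i j)" and ?w = "delbar N q S r (zz S i j)"
  have "(?d - (hol i j + ahol i j)) + hol i j \<in> Omega10 N q S r"
    using dd_zz[OF assms] FZ_Omega(1)
    by (intro cvec.subspace_add[OF subspace_Omega(1)] hol_Omega10 assms) (auto simp: eq_mod_def)
  then have ahol: "?d - ahol i j \<in> Omega10 N q S r" by (simp add: algebra_simps)
  have w: "?w \<in> Omega01 N q S r \<and> ?d - ?w \<in> Omega10 N q S r"
    unfolding delbar_def by (rule someI[of _ "ahol i j"]) (intro conjI ahol ahol_Omega01 assms)
  have "(?d - ahol i j) - (?d - ?w) \<in> Omega10 N q S r"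
    by (rule cvec.subspace_diff[OF subspace_Omega(1) ahol conjunct2[OF w]])
  moreover have "?w - ahol i j \<in> Omega01 N q S r"
    by (rule cvec.subspace_diff[OF subspace_Omega(2) conjunct1[OF w] ahol_Omega01[OF assms]])
  ultimately show ?thesis
    using Omega_direct[of "?w - ahol i j"] by (simp add: eq_mod_def)
qed

section \<open>The bimodule relations\<close>

lemma ract_lin: "ract N (scal c x) h = scal c (ract N x h)" "ract N (sum g X) h = (\<Sum>i\<in>X. ract N (g i) h)"
  by (simp_all add: ract_def sum_distrib_right)

text \<open>z_ms is moved past the e^+, the exchange relation is applied for each fixed k, and the
  sum over k reassembles into the derivatives of the z_fb. The passage through \<open>hol\<close> is
  needed because \<open>del\<close> returns an unspecified representative.\<close>

lemma hol_ract:
  assumes "i \<in> {1..N}" "j \<in> {1..N}" "m \<in> {1..N}" "s \<in> {1..N}"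
  shows "ract N (del N q S r (zz S i j)) (zz S m s) \<simeq>
    (\<Sum>a = 1..N. \<Sum>b = 1..N. \<Sum>c = 1..N. \<Sum>d = 1..N. \<Sum>e = 1..N. \<Sum>f = 1..N.
      scal (of_real (q powi (2 * (int b - int j) + sgn (int b - int s) - 1)
          * Rm q (j, a) (m, b) * Rb q (a, i) (c, d) * Rm q (e, c) (f, s)))
        (lact (zz S d e) (del N q S r (zz S f b))))"
proof -
  define C where "C a b c d e f = complex_of_real (q powi (2 * (int b - int j) + sgn (int b - int s) - 1)
          * Rm q (j, a) (m, b) * Rb q (a, i) (c, d) * Rm q (e, c) (f, s))" for a b c d e f
  let ?h = "p ^ 2 * of_real (q powi (-1))"
  have "ract N (del N q S r (zz S i j)) (zz S m s) \<simeq> ract N (hol i j) (zz S m s)"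
    using assms by (intro eqF_ract del_zz)
  also have "ract N (hol i j) (zz S m s) = scal ?h (\<Sum>k = 2..N. ract N (tens (u i k * W 1 j) (u k 1)) (zz S m s))"
    by (simp only: hol_def ract_lin)
  also have "\<dots> \<simeq> scal ?h (\<Sum>k = 2..N. tens (u i k * W 1 j * zz S m s) (u k 1))"
    using assms one_in by (intro eqF_scal eqF_sum ract_basis e_plus_mult_zz uk1_Ap G.A_mult u_A W_A) auto
  also have "\<dots> \<simeq> scal ?h (\<Sum>k = 2..N. tens
    (\<Sum>a = 1..N. \<Sum>b = 1..N. \<Sum>c = 1..N. \<Sum>d = 1..N. \<Sum>e = 1..N. \<Sum>f = 1..N.
      scal (C a b c d e f) (u d 1 * W 1 e * (u f k * W 1 b))) (u k 1))"
    unfolding C_def zz_def[of S m s] using assms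
    by (intro eqF_scal eqF_sum eqF_tens_left G.holomorphic_exchange uk1_Ap)
  also have "\<dots> = (\<Sum>a = 1..N. \<Sum>b = 1..N. \<Sum>c = 1..N. \<Sum>d = 1..N. \<Sum>e = 1..N. \<Sum>f = 1..N.
      scal (C a b c d e f) (lact (zz S d e) (hol f b)))"
    unfolding hol_def lact_simps lact_tens tens_simps cvec.scale_sum_right zz_def
    by (subst sum_swap6) (simp only: scal_scal mult.commute)
  also have "\<dots> \<simeq> (\<Sum>a = 1..N. \<Sum>b = 1..N. \<Sum>c = 1..N. \<Sum>d = 1..N. \<Sum>e = 1..N. \<Sum>f = 1..N.
      scal (C a b c d e f) (lact (zz S d e) (del N q S r (zz S f b))))"
    by (intro eqF_sum eqF_scal eqF_lact eqF_sym[OF del_zz] zz_A)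
  finally show ?thesis unfolding C_def .
qed

lemma ahol_ract:
  assumes "i \<in> {1..N}" "j \<in> {1..N}" "m \<in> {1..N}" "s \<in> {1..N}"
  shows "ract N (delbar N q S r (zz S i j)) (zz S m s) \<simeq>
    (\<Sum>a = 1..N. \<Sum>b = 1..N. \<Sum>c = 1..N. \<Sum>d = 1..N. \<Sum>e = 1..N. \<Sum>f = 1..N.
      scal (of_real (q powi (2 * (int b - int m) + sgn (int b - int i) + 1)
          * Rm q (m, a) (j, b) * Rm q (s, a) (c, d) * Rb q (i, e) (d, f)))
        (lact (zz S b e) (delbar N q S r (zz S f c))))"
proof -
  define C where "C a b c d e f = complex_of_real (q powi (2 * (int b - int m) + sgn (int b - int i) + 1)
          * Rm q (m, a) (j, b) * Rm q (s, a) (c, d) * Rb q (i, e) (d, f))" for a b c d e f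
  let ?h = "- (of_real (q ^ 3) * p ^ 2)"
  let ?k = "\<lambda>k. complex_of_real (q powi (- 2 * int k))"
  have "ract N (delbar N q S r (zz S i j)) (zz S m s) \<simeq> ract N (ahol i j) (zz S m s)"
    using assms by (intro eqF_ract delbar_zz)
  also have "ract N (ahol i j) (zz S m s) = scal ?h (\<Sum>k = 2..N. scal (?k k) (ract N (tens (u i 1 * W k j) (u 1 k)) (zz S m s)))"
    by (simp only: ahol_def ract_lin)
  also have "\<dots> \<simeq> scal ?h (\<Sum>k = 2..N. scal (?k k) (tens (u i 1 * W k j * zz S m s) (u 1 k)))"
    using assms one_in by (intro eqF_scal eqF_sum ract_basis e_minus_mult_zz u1k_Ap G.A_mult u_A W_A) auto
  also have "\<dots> \<simeq> scal ?h (\<Sum>k = 2..N. scal (?k k) (tens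
    (\<Sum>a = 1..N. \<Sum>b = 1..N. \<Sum>c = 1..N. \<Sum>d = 1..N. \<Sum>e = 1..N. \<Sum>f = 1..N.
      scal (C a b c d e f) (u b 1 * W 1 e * (u f 1 * W k c))) (u 1 k)))"
    unfolding C_def zz_def[of S m s] using assms
    by (intro eqF_scal eqF_sum eqF_tens_left G.antiholomorphic_exchange u1k_Ap)
  also have "\<dots> = (\<Sum>a = 1..N. \<Sum>b = 1..N. \<Sum>c = 1..N. \<Sum>d = 1..N. \<Sum>e = 1..N. \<Sum>f = 1..N.
      scal (C a b c d e f) (lact (zz S b e) (ahol f c)))"
    unfolding ahol_def lact_simps lact_tens tens_simps cvec.scale_sum_right zz_def
    by (subst sum_swap6) (simp only: scal_scal mult.commute mult.left_commute)
  also have "\<dots> \<simeq> (\<Sum>a = 1..N. \<Sum>b = 1..N. \<Sum>c = 1..N. \<Sum>d = 1..N. \<Sum>e = 1..N. \<Sum>f = 1..N.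
      scal (C a b c d e f) (lact (zz S b e) (delbar N q S r (zz S f c))))"
    by (intro eqF_sum eqF_scal eqF_lact eqF_sym[OF delbar_zz] zz_A)
  finally show ?thesis unfolding C_def .
qed

end

text \<open>The power q^{2/N} is read as \<open>p ^ 2\<close>, with \<open>p\<close> the chosen
  root; \<open>m\<close> is the row index of the right factor, the letter \<open>r\<close> being
  taken by the coquasi-triangular structure.\<close>

theorem corollary7p3:
  fixes N :: nat and q :: real and p :: complex
    and S :: "mat_alg \<Rightarrow> mat_alg" and r :: "mat_alg \<Rightarrow> mat_alg \<Rightarrow> complex"
  assumes "N \<ge> 2" and "0 < q" and "q \<le> 1" and "p ^ N = of_real q"
    and "SU_antipode N q S" and "SU_coquasi N q p r"
  shows "(\<forall>i \<in> {1..N}. \<forall>j \<in> {1..N}.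
      zz S i j \<in> CP N q \<and>
      eq_mod (forms_zero N q S r) (del N q S r (zz S i j))
        (scal (p ^ 2 * of_real (q powi (-1)))
          (\<Sum>k = 2..N. lact (u i k * S (u 1 j)) (e_plus (k - 1)))) \<and>
      eq_mod (forms_zero N q S r) (delbar N q S r (zz S i j))
        (scal (- (of_real (q ^ 3) * p ^ 2))
          (\<Sum>k = 2..N. scal (of_real (q powi (- 2 * int k)))
            (lact (u i 1 * S (u k j)) (e_minus (k - 1)))))) \<and>
    (\<forall>i \<in> {1..N}. \<forall>j \<in> {1..N}. \<forall>m \<in> {1..N}. \<forall>s \<in> {1..N}.
      eq_mod (forms_zero N q S r) (ract N (del N q S r (zz S i j)) (zz S m s))
        (\<Sum>a = 1..N. \<Sum>b = 1..N. \<Sum>c = 1..N. \<Sum>d = 1..N. \<Sum>e = 1..N. \<Sum>f = 1..N.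
          scal (of_real (q powi (2 * (int b - int j) + sgn (int b - int s) - 1)
              * Rm q (j, a) (m, b) * Rb q (a, i) (c, d) * Rm q (e, c) (f, s)))
            (lact (zz S d e) (del N q S r (zz S f b)))) \<and>
      eq_mod (forms_zero N q S r) (ract N (delbar N q S r (zz S i j)) (zz S m s))
        (\<Sum>a = 1..N. \<Sum>b = 1..N. \<Sum>c = 1..N. \<Sum>d = 1..N. \<Sum>e = 1..N. \<Sum>f = 1..N.
          scal (of_real (q powi (2 * (int b - int m) + sgn (int b - int i) + 1)
              * Rm q (m, a) (j, b) * Rm q (s, a) (c, d) * Rb q (i, e) (d, f)))
            (lact (zz S b e) (delbar N q S r (zz S f c)))))"
proof -
  interpret SU_calculus N q p S r
    by unfold_locales fact+
  show ?thesis
    unfolding hol_eq[symmetric] ahol_eq[symmetric]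
    by (intro conjI ballI zz_CP del_zz delbar_zz hol_ract ahol_ract)
qed

end
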